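(* Let $a>0$, $I=[0,a]$, let $\mathbb{X}$ and $\mathbb{K}$ be Banach spaces, and consider the nonlocal measure-driven integrodifferential system $$ \begin{cases} \mathrm{d}\zeta(t)=\Big[\mathcal{A}(t)\zeta(t)+\displaystyle\int_0^t\Delta(t,s)\zeta(s)\,\mathrm{d}s+\mathcal{V}u(t)\Big]\mathrm{d}t+\delta(t,\zeta(t))\,\mathrm{d}h(t),\quad t\in I,\\ \zeta(0)+g(\zeta)=\zeta_0, \end{cases} \qquad (S) $$ where $\mathcal{A}(t)$, $\Delta(t,s)$, $h$, $\mathcal{V}$ and the controls $u\in L^2(I,\mathbb{K})$ are as described in the context, $\delta:I\times\mathbb{X}\to\mathbb{X}$ and $g:\mathcal{R}(I,\mathbb{X})\to\mathbb{X}$. Assume that the conditions (C1), (C2), (C3), (E1), (E2) formulated in the context hold, let $\{\mathsf{R}(t,s):0\le s\le t\le a\}$ be the resolvent operator of the linear part of (S) (defined in the context), and let $\lambda$ denote the Hausdorff measure of noncompactness. Assume moreover: (H1) $(t,s)\mapsto\mathsf{R}(t,s)$ is continuous in operator norm for $0\le s<t\le a$, and $\sup\{\|\mathsf{R}(t,s)\|:0\le s\le t\le a\}\le L_1$ for a constant $L_1>0$. (H2) (i) For $\mu_h$-a.e. $t\in I$ the function $\delta(t,\cdot):\mathbb{X}\to\mathbb{X}$ is continuous, and for every $\zeta\in\mathbb{X}$ the function $\delta(\cdot,\zeta):I\to\mathbb{X}$ is $\mu_h$-measurable. (ii) There exist $n\in\mathcal{LS}_h(I;\mathbb{R}^+)$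 and a non-decreasing continuous function $\omega:\mathbb{R}^+\to\mathbb{R}^+$ such that $\|\delta(t,\zeta)\|\le n(t)\,\omega(\|\zeta\|)$ for all $\zeta\in\mathbb{X}$ and almost all $t\in I$, and $\liminf_{k\to+\infty}\frac{\omega(k)}{k}=\gamma<+\infty$. (iii) There exists $U\in\mathcal{LS}_h(I;\mathbb{R}^+)$ such that $\lambda(\delta(t,D))\le U(t)\lambda(D)$ for almost all $t\in I$ and every bounded subset $D\subset\mathbb{X}$. (H3) $g:\mathcal{R}(I,\mathbb{X})\to\mathbb{X}$ is continuous and compact, and there exist positive constants $c,d$ such that $\|g(\zeta)\|\le c\|\zeta\|_\infty+d$ for all $\zeta\in\mathcal{R}(I,\mathbb{X})$. (H4) The linear operator $Z:L^2(I,\mathbb{K})\to\mathbb{X}$ defined by $Zu=\int_0^a\mathsf{R}(a,s)\mathcal{V}u(s)\,\mathrm{d}s$ satisfies: (i) $Z$ has an inverse operator $Z^{-1}$ taking values in $L^2(I;\mathbb{K})/\ker(Z)$ (read as explained in the context), and there are positive constants $L_2,L_3$ with $\|\mathcal{V}\|\le L_2$ and $\|Z^{-1}\|\le L_3$; (ii) there exists $P_Z\in L^1(I;\mathbb{R}^+)$ such that for almost all $t\in I$ and every bounded set $Q\subset\mathbb{X}$, $\lambda((Z^{-1}Q)(t))\le P_Z(t)\lambda(Q)$. Suppose that $$ c\big[L_1+L_1L_2L_3a^{1/2}(1+L_1)\big]+L_1\gamma\big[1+L_1L_2L_3a^{1/2}\big]\int_0^a n(s)\,\mathrm{d}h(s)<1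 $$ and $$ \Big(2L_1+4L_1^2L_2\int_0^aP_Z(s)\,\mathrm{d}s\Big)\int_0^aU(s)\,\mathrm{d}h(s)<1. $$ Then the system (S) is controllable on $I$; that is, for every $\zeta_0,\zeta_1\in\mathbb{X}$ there is a control $u\in L^2(I;\mathbb{K})$ such that (S) has a mild solution $\zeta\in\mathcal{R}(I,\mathbb{X})$ with $\zeta(a)+g(\zeta)=\zeta_1$.
   Context: **Data of the system.** $\mathcal{A}(t):\mathsf{D}(\mathcal{A})\subset\mathbb{X}\to\mathbb{X}$, $t\ge 0$, is a family of closed linear operators with common fixed domain $\mathsf{D}(\mathcal{A})$. For $0\le s\le t<\infty$, $\Delta(t,s):\mathsf{D}(\Delta)\subset\mathbb{X}\to\mathbb{X}$ is a closed linear operator with $\mathsf{D}(\Delta)\supset\mathsf{D}(\mathcal{A})$. $\mathcal{V}:\mathbb{K}\to\mathbb{X}$ is a bounded linear operator. $h:I\to\mathbb{R}$ is non-decreasing and left-continuous, and $\mathrm{d}h$ denotes its distributional derivative. $\mu_h$ is the Lebesgue–Stieltjes measure on $I$ induced by $h$; $\mathcal{LS}_h(I;E)$ is the space of functions $I\to E$ that are Lebesgue–Stieltjes integrable with respect to $h$. The integral $\int_0^t\cdot\,\mathrm{d}h$ is the Lebesgue–Stieltjes integral, with the convention for left-continuous $h$ that $p(t)=\int_0^t f\,\mathrm{d}h$ satisfies $p(t^+)=p(t)+f(t)(h(t^+)-h(t))$ and $p(t^-)=p(t)-f(t)(h(t)-h(t^-))$. "Almost all $t$" in (H2) is with respect to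 $\mu_h$. **Regulated functions.** A function $f:I\to\mathbb{X}$ is regulated if the limits $f(t^-)$ for $t\in(0,a]$ and $f(t^+)$ for $t\in[0,a)$ exist and are finite. $\mathcal{R}(I,\mathbb{X})$ is the Banach space of regulated functions with norm $\|f\|_\infty=\sup_{t\in I}\|f(t)\|$. **Measure of noncompactness.** For a bounded subset $\mathcal{U}$ of a Banach space, $\lambda(\mathcal{U})$ is the infimum of all $\alpha>0$ such that $\mathcal{U}$ can be covered by finitely many open balls of radius smaller than $\alpha$. **The space $\mathsf{Y}$.** $\mathsf{Y}$ is the Banach space $\mathsf{D}(\mathcal{A})$ with the graph norm $\|y\|_{\mathsf{Y}}=\|\mathcal{A}(0)y\|_{\mathbb{X}}+\|y\|_{\mathbb{X}}$. $\mathsf{B}(\mathsf{Y},E)$ denotes the bounded linear operators from $\mathsf{Y}$ to $E$. It is assumed throughout that $t\mapsto\mathcal{A}(t)$ and $(t,s)\mapsto\Delta(t,s)$ are continuous on $0\le t\le a$ and $0\le s\le t\le a$, respectively, into $\mathsf{B}(\mathsf{Y},\mathbb{X})$. **Stable family.** A family $(\mathcal{A}(t))_{t\in[0,a]}$ of generators of $C_0$-semigroups is stable if there are constants $M_0\ge1$ and $\alpha_0$ such that $\big\|\prod_{k=1}^n(\mathcal{A}(s_k)-\lambda\, id_{\mathbb{X}})^{-1}\big\|\le\frac{M_0}{(\lambda-\alpha_0)^n}$ for all $\lambda>\alpha_0$ and every finite sequence $0\le s_1\le\dots\le s_n$ (in $[0,a]$), $n=1,2,\dots$ **Conditions (C1)–(C3).**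 Let $\mathfrak{F}=BUC(\mathbb{R}^+;\mathbb{X})$ be the space of bounded uniformly continuous functions from $\mathbb{R}^+$ to $\mathbb{X}$. For $t\ge0$ let $\Delta(t):\mathsf{Y}\to\mathfrak{F}$ be the linear operator $(\Delta(t)y)(s)=\Delta(t+s,t)y$, $s\ge0$. Let $\mathsf{D}_s$ be the differentiation operator $\mathsf{D}_s\ell=\ell'$ on $\mathfrak{F}$ with domain $\mathcal{D}(\mathsf{D}_s)\subset\mathfrak{F}$; it is the infinitesimal generator of the translation semigroup $(T(t)\ell)(s)=\ell(t+s)$ on $\mathfrak{F}$. - (C1) $(\mathcal{A}(t))_{t\in[0,a]}$ is a stable family of generators such that $\mathcal{A}(t)\zeta$ is strongly continuously differentiable on $\mathbb{R}^+$ for each $\zeta\in\mathsf{Y}$; additionally, $\Delta(t)\zeta$ is strongly continuously differentiable on $\mathbb{R}^+$ for each $\zeta\in\mathsf{Y}$. - (C2) $t\mapsto\Delta(t)$ is continuous on $[0,+\infty)$ into $\mathsf{B}(\mathsf{Y},\mathfrak{F})$. - (C3) $\Delta(t):\mathsf{Y}\to\mathcal{D}(\mathsf{D}_s)$ for all $t\ge0$, and $t\mapsto\mathsf{D}_s\Delta(t)$ is continuous on $\mathbb{R}^+$ into $\mathsf{B}(\mathsf{Y},\mathfrak{F})$. **Conditions (E1)–(E2).** - (E1) $\mathcal{A}(t)$ is closed, and the domain $\mathsf{D}(\mathcal{A}(t))=\mathsf{D}(\mathcal{A})$ is independent of $t$ and dense in $\mathbb{X}$. - (E2) For each $t\ge0$,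 $(\lambda I+\mathcal{A}(t))^{-1}$ exists for all $\lambda\in\mathbb{C}$ with $\mathrm{Re}\,\lambda\le0$, and there is $M_1>0$ such that $\|(\lambda I+\mathcal{A}(t))^{-1}\|_{\mathcal{L}(\mathbb{X})}\le\frac{M_1}{|\lambda|+1}$. **Resolvent operator.** The linear part of (S) is $\zeta'(t)=\mathcal{A}(t)\zeta(t)+\int_0^t\Delta(t,s)\zeta(s)\,\mathrm{d}s$, $\zeta(0)=\zeta_0$. A resolvent operator for it is a family $\{\mathsf{R}(t,s):0\le s\le t\le a\}$ of bounded linear operators on $\mathbb{X}$ such that: - (i) $\mathsf{R}(t,s)$ is strongly continuous in $s$ and $t$, $\mathsf{R}(s,s)=id_{\mathbb{X}}$, and $\|\mathsf{R}(t,s)\|\le Me^{\beta(t-s)}$ for some constants $M,\beta$; - (ii) $\mathsf{R}(t,s)\mathsf{Y}\subset\mathsf{Y}$ and $\mathsf{R}(t,s)$ is strongly continuous in $s$ and $t$ on $\mathsf{Y}$; - (iii) for every $\zeta\in\mathsf{Y}$, $\mathsf{R}(t,s)\zeta$ is strongly continuously differentiable in $s$ and $t$, with $$\tfrac{\partial\mathsf{R}}{\partial t}(t,s)\zeta=\mathcal{A}(t)\mathsf{R}(t,s)\zeta+\int_s^t\Delta(t,r)\mathsf{R}(r,s)\zeta\,\mathrm{d}r,\qquad \tfrac{\partial\mathsf{R}}{\partial s}(t,s)\zeta=-\mathsf{R}(t,s)\mathcal{A}(s)\zeta-\int_s^t\mathsf{R}(t,r)\Delta(r,s)\zeta\,\mathrm{d}r,$$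 both derivatives being strongly continuous on $0\le s\le t$. Under (C1)–(C3) a unique resolvent operator exists (a known theorem of Grimmer). **Operator $Z^{-1}$.** As is customary, elements of $L^2(I;\mathbb{K})/\ker(Z)$ are identified with representing functions, so that $Z^{-1}$ is regarded as a bounded linear map $\mathbb{X}\to L^2(I;\mathbb{K})$ with $ZZ^{-1}=id_{\mathbb{X}}$, and $(Z^{-1}Q)(t)=\{(Z^{-1}q)(t):q\in Q\}\subset\mathbb{K}$. **Mild solution.** For given $u\in L^2(I;\mathbb{K})$ and $\zeta_0\in\mathbb{X}$, a function $\zeta\in\mathcal{R}(I,\mathbb{X})$ is a mild solution of (S) on $I$ if $$\zeta(t)=\mathsf{R}(t,0)(\zeta_0-g(\zeta))+\int_0^t\mathsf{R}(t,s)\mathcal{V}u(s)\,\mathrm{d}s+\int_0^t\mathsf{R}(t,s)\delta(s,\zeta(s))\,\mathrm{d}h(s),\qquad t\in I.$$ *)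

theory Defs
  imports "HOL-Analysis.Analysis"
begin

section \<open>Complex Banach spaces and closed operators\<close>

text \<open>The resolvent conditions below use complex spectral parameters, so the state space is a
  complex Banach space, that is, a Banach space with a compatible complex scalar multiplication.\<close>

class complex_banach = banach +
  fixes scaleC :: "complex \<Rightarrow> 'a \<Rightarrow> 'a"  (infixr "*\<^sub>C" 75)
  assumes scaleC_add_right: "c *\<^sub>C (x + y) = c *\<^sub>C x + c *\<^sub>C y"
    and scaleC_add_left: "(b + c) *\<^sub>C x = b *\<^sub>C x + c *\<^sub>C x"
    and scaleC_scaleC: "b *\<^sub>C (c *\<^sub>C x) = (b * c) *\<^sub>C x"
    and scaleC_of_real: "complex_of_real r *\<^sub>C x = r *\<^sub>R x"
    and norm_scaleC: "norm (c *\<^sub>C x) = cmod c * norm x"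

instantiation complex :: complex_banach
begin

definition scaleC_complex :: "complex \<Rightarrow> complex \<Rightarrow> complex"
  where "scaleC_complex c x = c * x"

instance
  by standard (auto simp: scaleC_complex_def algebra_simps scaleR_conv_of_real norm_mult)

end

definition complex_homogeneous :: "('x::complex_banach \<Rightarrow> 'x) \<Rightarrow> bool" where
  "complex_homogeneous T \<longleftrightarrow> (\<forall>c x. T (c *\<^sub>C x) = c *\<^sub>C T x)"

definition complex_subspace :: "'x::complex_banach set \<Rightarrow> bool" where
  "complex_subspace D \<longleftrightarrow>
     0 \<in> D \<and> (\<forall>x\<in>D. \<forall>y\<in>D. x + y \<in> D) \<and> (\<forall>c. \<forall>x\<in>D. c *\<^sub>C x \<in> D)"

text \<open>An unbounded operator is a pair of a domain and a total function whose values outside the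
  domain are irrelevant.\<close>

definition closed_operator :: "'x::complex_banach set \<Rightarrow> ('x \<Rightarrow> 'x) \<Rightarrow> bool" where
  "closed_operator D T \<longleftrightarrow>
     complex_subspace D \<and>
     (\<forall>x\<in>D. \<forall>y\<in>D. T (x + y) = T x + T y) \<and>
     (\<forall>c. \<forall>x\<in>D. T (c *\<^sub>C x) = c *\<^sub>C T x) \<and>
     closed ((\<lambda>x. (x, T x)) ` D)"

definition inverse_operator ::
  "'x::complex_banach set \<Rightarrow> ('x \<Rightarrow> 'x) \<Rightarrow> ('x \<Rightarrow>\<^sub>L 'x) \<Rightarrow> bool" where
  "inverse_operator D T B \<longleftrightarrow>
     (\<forall>x. blinfun_apply B x \<in> D \<and> T (blinfun_apply B x) = x) \<and>
     (\<forall>y\<in>D. blinfun_apply B (T y) = y)"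

definition graph_norm :: "('x::real_normed_vector \<Rightarrow> 'x) \<Rightarrow> 'x \<Rightarrow> real" where
  "graph_norm T y = norm (T y) + norm y"

text \<open>Continuity of a family of operators into \<open>B(Y, E)\<close>, where \<open>Y\<close> is \<open>D\<close> with the norm \<open>nY\<close>
  and \<open>nE\<close> is the norm of \<open>E\<close>. An operator norm is at most \<open>e\<close> iff
  \<open>nE (T y) \<le> e * nY y\<close> for all \<open>y\<close>.\<close>

definition continuous_into_B ::
  "'p::metric_space set \<Rightarrow> 'y set \<Rightarrow> ('y \<Rightarrow> real) \<Rightarrow> ('e::minus \<Rightarrow> real) \<Rightarrow> ('p \<Rightarrow> 'y \<Rightarrow> 'e) \<Rightarrow> bool"
  where
  "continuous_into_B S D nY nE T \<longleftrightarrow>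
     (\<forall>p\<in>S. \<exists>C. \<forall>y\<in>D. nE (T p y) \<le> C * nY y) \<and>
     (\<forall>p\<in>S. \<forall>e>0. \<forall>\<^sub>F q in at p within S. \<forall>y\<in>D. nE (T q y - T p y) \<le> e * nY y)"


section \<open>Bochner integral in arbitrary Banach spaces\<close>

text \<open>The integral of the library is restricted to second countable spaces. The following is the
  same construction for arbitrary Banach spaces, with strong measurability in place of Borel
  measurability.\<close>

definition strongly_measurable :: "'m measure \<Rightarrow> ('m \<Rightarrow> 'b::real_normed_vector) \<Rightarrow> bool" where
  "strongly_measurable M f \<longleftrightarrow>
     (\<exists>s. (\<forall>i::nat. simple_function M (s i)) \<and> (AE x in M. (\<lambda>i. s i x) \<longlonglongrightarrow> f x))"

definition has_banach_integral ::
  "'m measure \<Rightarrow> ('m \<Rightarrow> 'b::real_normed_vector) \<Rightarrow> 'b \<Rightarrow> bool" where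
  "has_banach_integral M f I \<longleftrightarrow>
     strongly_measurable M f \<and>
     (\<exists>s. (\<forall>i::nat. Bochner_Integration.simple_bochner_integrable M (s i)) \<and>
          (\<lambda>i. \<integral>\<^sup>+x. ennreal (norm (f x - s i x)) \<partial>M) \<longlonglongrightarrow> 0 \<and>
          (\<lambda>i. Bochner_Integration.simple_bochner_integral M (s i)) \<longlonglongrightarrow> I)"

definition banach_integrable :: "'m measure \<Rightarrow> ('m \<Rightarrow> 'b::real_normed_vector) \<Rightarrow> bool" where
  "banach_integrable M f \<longleftrightarrow> (\<exists>I. has_banach_integral M f I)"

definition banach_integral :: "'m measure \<Rightarrow> ('m \<Rightarrow> 'b::real_normed_vector) \<Rightarrow> 'b" where
  "banach_integral M f = (if banach_integrable M f then THE I. has_banach_integral M f I else 0)"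

lemma has_bochner_integral_imp_has_banach_integral:
  fixes f :: "'m \<Rightarrow> 'b::{banach, second_countable_topology}"
  assumes "has_bochner_integral M f I"
  shows "has_banach_integral M f I"
proof -
  have "f \<in> borel_measurable M"
    using assms by (rule borel_measurable_has_bochner_integral)
  from borel_measurable_implies_sequence_metric[OF this, of 0]
  obtain s where "\<And>i. simple_function M (s i)" "\<And>x. x \<in> space M \<Longrightarrow> (\<lambda>i. s i x) \<longlonglongrightarrow> f x"
    by blast
  then have "strongly_measurable M f"
    unfolding strongly_measurable_def by (intro exI[of _ s]) auto
  with assms show ?thesis
    unfolding has_banach_integral_def has_bochner_integral.simps by blast
qed

text \<open>\<open>L\<^sup>2(I; K)\<close> with \<open>I = [0, a]\<close>, by representing functions.\<close>

definition L2 :: "real \<Rightarrow> (real \<Rightarrow> 'k::banach) set" where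
  "L2 a = {u. strongly_measurable (lebesgue_on {0..a}) u \<and>
              integrable (lebesgue_on {0..a}) (\<lambda>t. (norm (u t))\<^sup>2)}"

definition L2_norm :: "real \<Rightarrow> (real \<Rightarrow> 'k::banach) \<Rightarrow> real" where
  "L2_norm a u = sqrt (integral\<^sup>L (lebesgue_on {0..a}) (\<lambda>t. (norm (u t))\<^sup>2))"


section \<open>Lebesgue--Stieltjes measure of a left-continuous function\<close>

text \<open>The function \<open>h\<close> is extended from \<open>[0, a]\<close> by constants. Since \<^const>\<open>interval_measure\<close>
  expects a right-continuous function, it is applied to the reflection of \<open>h\<close>.\<close>

definition ls_measure :: "real \<Rightarrow> (real \<Rightarrow> real) \<Rightarrow> real measure" where
  "ls_measure a h =
     restrict_space
       (completion
         (distr (interval_measure (\<lambda>x. - h (max 0 (min a (- x))))) borel uminus))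
       {0..a}"

text \<open>The measure for \<open>\<integral>\<^sub>0\<^sup>t \<dots> dh\<close>. By the convention for left-continuous \<open>h\<close> the atom at \<open>0\<close>
  counts and the atom at \<open>t\<close> does not.\<close>

definition ls_upto :: "real \<Rightarrow> (real \<Rightarrow> real) \<Rightarrow> real \<Rightarrow> real measure" where
  "ls_upto a h t = restrict_space (ls_measure a h) {0..<t}"

lemma emeasure_ls_measure:
  assumes mono: "mono_on {0..a} h"
    and left: "\<And>t. t \<in> {0<..a} \<Longrightarrow> (h \<longlongrightarrow> h t) (at_left t)"
    and st: "0 \<le> s" "s \<le> t" "t \<le> a"
  shows "emeasure (ls_measure a h) {s..<t} = ennreal (h t - h s)"
proof -
  define H where "H t = h (max 0 (min a t))" for t
  have H_eq: "H t = h t" if "t \<in> {0..a}" for t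
    using that by (auto simp: H_def)
  have H_mono: "H x \<le> H y" if "x \<le> y" for x y
    unfolding H_def using that st by (intro mono_onD[OF mono]) auto
  have H_left: "(H \<longlongrightarrow> H x) (at_left x)" for x
  proof -
    consider "x \<le> 0" | "0 < x" "x \<le> a" | "a < x" by linarith
    then show ?thesis
    proof cases
      case 1
      have "\<forall>\<^sub>F y in at_left x. H y = H x"
        using 1 st by (auto simp: eventually_at_left_field H_def intro!: exI[of _ "x - 1"])
      then show ?thesis by (simp add: tendsto_eventually)
    next
      case 2
      have "\<forall>\<^sub>F y in at_left x. h y = H y"
        using 2 by (auto simp: eventually_at_left_field H_eq intro!: exI[of _ 0])
      moreover have "(h \<longlongrightarrow> H x) (at_left x)"
        using left[of x] 2 by (simp add: H_eq)
      ultimately show ?thesis by (rule Lim_transform_eventually[rotated])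
    next
      case 3
      have "\<forall>\<^sub>F y in at_left x. H y = H x"
        using 3 by (auto simp: eventually_at_left_field H_def intro!: exI[of _ a])
      then show ?thesis by (simp add: tendsto_eventually)
    qed
  qed
  define F where "F x = - H (- x)" for x
  have F_right: "continuous (at_right x) F" for x
  proof -
    have "((\<lambda>y. H (- y)) \<longlongrightarrow> H (- x)) (at_right x)"
      by (rule filterlim_compose[OF H_left]) (simp add: filterlim_def at_right_minus filtermap_filtermap)
    then show ?thesis
      unfolding F_def continuous_within by (intro tendsto_minus)
  qed
  have F_mono: "F x \<le> F y" if "x \<le> y" for x y
    using H_mono[of "- y" "- x"] that by (simp add: F_def)
  let ?N = "distr (interval_measure F) borel uminus"
  have "emeasure ?N {s..<t} = emeasure (interval_measure F) (uminus -` {s..<t})"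
    by (subst emeasure_distr) auto
  also have "uminus -` {s..<t} = {- t<..- s}"
    by (auto simp: less_minus_iff minus_less_iff le_minus_iff minus_le_iff)
  also have "emeasure (interval_measure F) {- t<..- s} = ennreal (F (- s) - F (- t))"
    using st by (intro emeasure_interval_measure_Ioc F_mono F_right) auto
  also have "F (- s) - F (- t) = h t - h s"
    using st by (simp add: F_def H_eq)
  finally have *: "emeasure ?N {s..<t} = ennreal (h t - h s)" .
  have "ls_measure a h = restrict_space (completion ?N) {0..a}"
    unfolding ls_measure_def F_def[abs_def] H_def[abs_def] ..
  moreover have "emeasure (restrict_space (completion ?N) {0..a}) {s..<t} = emeasure (completion ?N) {s..<t}"
    by (rule emeasure_restrict_space) (use st in \<open>auto intro: sets_completionI_sets\<close>)
  ultimately show ?thesis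
    using * by (simp add: emeasure_completion)
qed


section \<open>Regulated functions and the measure of noncompactness\<close>

text \<open>Functions on \<open>[0, a]\<close> are represented extensionally, so that equality and maps defined on
  the space of regulated functions see only the values on \<open>[0, a]\<close>.\<close>

definition regulated :: "real \<Rightarrow> (real \<Rightarrow> 'x::real_normed_vector) set" where
  "regulated a = {f \<in> extensional {0..a}.
     (\<forall>t\<in>{0<..a}. \<exists>l. (f \<longlongrightarrow> l) (at_left t)) \<and>
     (\<forall>t\<in>{0..<a}. \<exists>l. (f \<longlongrightarrow> l) (at_right t))}"

definition regulated_norm :: "real \<Rightarrow> (real \<Rightarrow> 'x::real_normed_vector) \<Rightarrow> real" where
  "regulated_norm a f = (SUP t\<in>{0..a}. norm (f t))"

definition regulated_continuous ::
  "real \<Rightarrow> ((real \<Rightarrow> 'x::real_normed_vector) \<Rightarrow> 'x) \<Rightarrow> bool" where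
  "regulated_continuous a g \<longleftrightarrow>
     (\<forall>f\<in>regulated a. \<forall>e>0. \<exists>d>0. \<forall>f'\<in>regulated a.
        regulated_norm a (\<lambda>t. f' t - f t) < d \<longrightarrow> norm (g f' - g f) < e)"

definition regulated_compact ::
  "real \<Rightarrow> ((real \<Rightarrow> 'x::real_normed_vector) \<Rightarrow> 'x) \<Rightarrow> bool" where
  "regulated_compact a g \<longleftrightarrow>
     (\<forall>B \<subseteq> regulated a. (\<exists>r. \<forall>f\<in>B. regulated_norm a f \<le> r) \<longrightarrow> compact (closure (g ` B)))"

text \<open>Values in \<^typ>\<open>ennreal\<close>, with value \<open>\<infinity>\<close> exactly on the unbounded sets.\<close>

definition hausdorff_mnc :: "'x::metric_space set \<Rightarrow> ennreal" where
  "hausdorff_mnc U =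
     Inf {ennreal \<alpha> |\<alpha>. 0 < \<alpha> \<and>
       (\<exists>B. finite B \<and> (\<forall>(x, r)\<in>B. r < \<alpha>) \<and> U \<subseteq> (\<Union>(x, r)\<in>B. ball x r))}"


section \<open>The space of bounded uniformly continuous functions on the half-line\<close>

definition BUC :: "(real \<Rightarrow> 'x::real_normed_vector) set" where
  "BUC = {l. uniformly_continuous_on {0..} l \<and> bounded (l ` {0..})}"

definition BUC_norm :: "(real \<Rightarrow> 'x::real_normed_vector) \<Rightarrow> real" where
  "BUC_norm l = (SUP s\<in>{0..}. norm (l s))"

definition BUC_C1 :: "(real \<Rightarrow> real \<Rightarrow> 'x::real_normed_vector) \<Rightarrow> bool" where
  "BUC_C1 \<Phi> \<longleftrightarrow>
     (\<forall>t\<ge>0. \<Phi> t \<in> BUC) \<and>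
     (\<exists>\<Phi>'. (\<forall>t\<ge>0. \<Phi>' t \<in> BUC) \<and>
        (\<forall>t\<ge>0. ((\<lambda>r. BUC_norm (\<lambda>s. (\<Phi> r s - \<Phi> t s) /\<^sub>R (r - t) - \<Phi>' t s)) \<longlongrightarrow> 0)
                 (at t within {0..})) \<and>
        (\<forall>t\<ge>0. ((\<lambda>r. BUC_norm (\<lambda>s. \<Phi>' r s - \<Phi>' t s)) \<longlongrightarrow> 0) (at t within {0..})))"

definition Ds :: "(real \<Rightarrow> 'x::real_normed_vector) \<Rightarrow> real \<Rightarrow> 'x" where
  "Ds l = (\<lambda>s. vector_derivative l (at s within {0..}))"

definition dom_Ds :: "(real \<Rightarrow> 'x::real_normed_vector) set" where
  "dom_Ds = {l \<in> BUC. (\<forall>s\<ge>0. l differentiable (at s within {0..})) \<and> Ds l \<in> BUC}"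


section \<open>Generators, stable families, and the conditions on the linear part\<close>

definition c0_semigroup :: "(real \<Rightarrow> 'x::complex_banach \<Rightarrow>\<^sub>L 'x) \<Rightarrow> bool" where
  "c0_semigroup S \<longleftrightarrow>
     (\<forall>t\<ge>0. complex_homogeneous (blinfun_apply (S t))) \<and>
     S 0 = id_blinfun \<and>
     (\<forall>s\<ge>0. \<forall>t\<ge>0. S (s + t) = S s o\<^sub>L S t) \<and>
     (\<forall>x. ((\<lambda>t. blinfun_apply (S t) x) \<longlongrightarrow> x) (at_right 0))"

definition generates_c0_semigroup :: "'x::complex_banach set \<Rightarrow> ('x \<Rightarrow> 'x) \<Rightarrow> bool" where
  "generates_c0_semigroup D T \<longleftrightarrow>
     (\<exists>S. c0_semigroup S \<and>
        D = {x. \<exists>l. ((\<lambda>t. (blinfun_apply (S t) x - x) /\<^sub>R t) \<longlongrightarrow> l) (at_right 0)} \<and>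
        (\<forall>x\<in>D. ((\<lambda>t. (blinfun_apply (S t) x - x) /\<^sub>R t) \<longlongrightarrow> T x) (at_right 0)))"

text \<open>The product is time-ordered: factors with larger times stand to the left.\<close>

definition stable_family ::
  "real \<Rightarrow> 'x::complex_banach set \<Rightarrow> (real \<Rightarrow> 'x \<Rightarrow> 'x) \<Rightarrow> bool" where
  "stable_family a D A \<longleftrightarrow>
     (\<forall>t\<in>{0..a}. generates_c0_semigroup D (A t)) \<and>
     (\<exists>M0\<ge>1. \<exists>\<alpha>0. \<exists>J. \<forall>l>\<alpha>0.
        (\<forall>s\<in>{0..a}. inverse_operator D (\<lambda>x. A s x - l *\<^sub>R x) (J l s)) \<and>
        (\<forall>ss. ss \<noteq> [] \<and> sorted ss \<and> set ss \<subseteq> {0..a} \<longrightarrow>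
           norm (fold (\<lambda>s B. J l s o\<^sub>L B) ss id_blinfun) \<le> M0 / (l - \<alpha>0) ^ length ss))"

text \<open>\<open>D\<close> is the common domain of the operators \<open>A t\<close> and \<open>DB\<close> that of the operators \<open>\<Delta> t s\<close>;
  the space \<open>Y\<close> is \<open>D\<close> with the norm \<open>graph_norm (A 0)\<close>.\<close>

definition linear_data ::
  "real \<Rightarrow> 'x::complex_banach set \<Rightarrow> (real \<Rightarrow> 'x \<Rightarrow> 'x) \<Rightarrow> 'x set \<Rightarrow> (real \<Rightarrow> real \<Rightarrow> 'x \<Rightarrow> 'x) \<Rightarrow> bool"
  where
  "linear_data a D A DB \<Delta> \<longleftrightarrow>
     (\<forall>t\<ge>0. closed_operator D (A t)) \<and>
     (\<forall>s\<ge>0. \<forall>t\<ge>s. closed_operator DB (\<Delta> t s)) \<and>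
     D \<subseteq> DB \<and>
     continuous_into_B {0..a} D (graph_norm (A 0)) norm A \<and>
     continuous_into_B {(t, s). 0 \<le> s \<and> s \<le> t \<and> t \<le> a} D (graph_norm (A 0)) norm
       (\<lambda>(t, s). \<Delta> t s)"

definition shifted_kernel :: "(real \<Rightarrow> real \<Rightarrow> 'x \<Rightarrow> 'x) \<Rightarrow> real \<Rightarrow> 'x \<Rightarrow> real \<Rightarrow> 'x" where
  "shifted_kernel \<Delta> t y = (\<lambda>s. \<Delta> (t + s) t y)"

definition cond_C1 ::
  "real \<Rightarrow> 'x::complex_banach set \<Rightarrow> (real \<Rightarrow> 'x \<Rightarrow> 'x) \<Rightarrow> (real \<Rightarrow> real \<Rightarrow> 'x \<Rightarrow> 'x) \<Rightarrow> bool" where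
  "cond_C1 a D A \<Delta> \<longleftrightarrow>
     stable_family a D A \<and>
     (\<forall>y\<in>D. \<exists>A'. continuous_on {0..} A' \<and>
        (\<forall>t\<ge>0. ((\<lambda>t. A t y) has_vector_derivative A' t) (at t within {0..}))) \<and>
     (\<forall>y\<in>D. BUC_C1 (\<lambda>t. shifted_kernel \<Delta> t y))"

definition cond_C2 ::
  "'x::complex_banach set \<Rightarrow> (real \<Rightarrow> 'x \<Rightarrow> 'x) \<Rightarrow> (real \<Rightarrow> real \<Rightarrow> 'x \<Rightarrow> 'x) \<Rightarrow> bool" where
  "cond_C2 D A \<Delta> \<longleftrightarrow>
     (\<forall>t\<ge>0. \<forall>y\<in>D. shifted_kernel \<Delta> t y \<in> BUC) \<and>
     continuous_into_B {0..} D (graph_norm (A 0)) BUC_norm (shifted_kernel \<Delta>)"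

definition cond_C3 ::
  "'x::complex_banach set \<Rightarrow> (real \<Rightarrow> 'x \<Rightarrow> 'x) \<Rightarrow> (real \<Rightarrow> real \<Rightarrow> 'x \<Rightarrow> 'x) \<Rightarrow> bool" where
  "cond_C3 D A \<Delta> \<longleftrightarrow>
     (\<forall>t\<ge>0. \<forall>y\<in>D. shifted_kernel \<Delta> t y \<in> dom_Ds) \<and>
     continuous_into_B {0..} D (graph_norm (A 0)) BUC_norm (\<lambda>t y. Ds (shifted_kernel \<Delta> t y))"

definition cond_E1 :: "'x::complex_banach set \<Rightarrow> (real \<Rightarrow> 'x \<Rightarrow> 'x) \<Rightarrow> bool" where
  "cond_E1 D A \<longleftrightarrow> (\<forall>t\<ge>0. closed_operator D (A t)) \<and> closure D = UNIV"

definition cond_E2 :: "'x::complex_banach set \<Rightarrow> (real \<Rightarrow> 'x \<Rightarrow> 'x) \<Rightarrow> bool" where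
  "cond_E2 D A \<longleftrightarrow>
     (\<forall>t\<ge>0. \<exists>M1>0. \<forall>l. Re l \<le> 0 \<longrightarrow>
        (\<exists>B. inverse_operator D (\<lambda>x. l *\<^sub>C x + A t x) B \<and> norm B \<le> M1 / (cmod l + 1)))"

text \<open>The integrands below are continuous in \<open>r\<close>, so the library's \<^const>\<open>integral\<close> of
  vector-valued functions on an interval is the Riemann integral.\<close>

definition resolvent_operator ::
  "real \<Rightarrow> 'x::complex_banach set \<Rightarrow> (real \<Rightarrow> 'x \<Rightarrow> 'x) \<Rightarrow> (real \<Rightarrow> real \<Rightarrow> 'x \<Rightarrow> 'x) \<Rightarrow>
   (real \<Rightarrow> real \<Rightarrow> 'x \<Rightarrow>\<^sub>L 'x) \<Rightarrow> bool" where
  "resolvent_operator a D A \<Delta> R \<longleftrightarrow>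
   (let T = {(t, s). 0 \<le> s \<and> s \<le> t \<and> t \<le> a};
        dt = (\<lambda>y t s. A t (blinfun_apply (R t s) y) +
                integral {s..t} (\<lambda>r. \<Delta> t r (blinfun_apply (R r s) y)));
        ds = (\<lambda>y t s. - blinfun_apply (R t s) (A s y) -
                integral {s..t} (\<lambda>r. blinfun_apply (R t r) (\<Delta> r s y)))
    in (\<forall>(t, s)\<in>T. complex_homogeneous (blinfun_apply (R t s))) \<and>
       (\<forall>x. continuous_on T (\<lambda>(t, s). blinfun_apply (R t s) x)) \<and>
       (\<forall>s\<in>{0..a}. R s s = id_blinfun) \<and>
       (\<exists>M \<beta>. \<forall>(t, s)\<in>T. norm (R t s) \<le> M * exp (\<beta> * (t - s))) \<and>
       (\<forall>(t, s)\<in>T. \<forall>y\<in>D. blinfun_apply (R t s) y \<in> D) \<and>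
       (\<forall>y\<in>D. \<forall>(t, s)\<in>T.
          ((\<lambda>(t', s'). graph_norm (A 0) (blinfun_apply (R t' s') y - blinfun_apply (R t s) y)) \<longlongrightarrow> 0)
            (at (t, s) within T)) \<and>
       (\<forall>y\<in>D. \<forall>(t, s)\<in>T.
          ((\<lambda>t'. blinfun_apply (R t' s) y) has_vector_derivative dt y t s) (at t within {s..a}) \<and>
          ((\<lambda>s'. blinfun_apply (R t s') y) has_vector_derivative ds y t s) (at s within {0..t})) \<and>
       (\<forall>y\<in>D. continuous_on T (\<lambda>(t, s). dt y t s) \<and> continuous_on T (\<lambda>(t, s). ds y t s)))"


section \<open>Control operator, mild solutions, controllability\<close>

text \<open>The control space is a real Banach space and \<open>V\<close> is real-linear. This covers complex control
  spaces as well, a complex Banach space being in particular a real one.\<close>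

definition control_op ::
  "real \<Rightarrow> (real \<Rightarrow> real \<Rightarrow> 'x::complex_banach \<Rightarrow>\<^sub>L 'x) \<Rightarrow> ('k::banach \<Rightarrow>\<^sub>L 'x) \<Rightarrow> (real \<Rightarrow> 'k) \<Rightarrow> 'x"
  where
  "control_op a R V u =
     banach_integral (lebesgue_on {0..a}) (\<lambda>s. blinfun_apply (R a s) (blinfun_apply V (u s)))"

text \<open>\<open>W q\<close> is a representing function of \<open>Z\<^sup>-\<^sup>1 q\<close>; linearity into \<open>L\<^sup>2\<close> is linearity up to null sets.\<close>

definition control_inverse ::
  "real \<Rightarrow> ((real \<Rightarrow> 'k::banach) \<Rightarrow> 'x::real_normed_vector) \<Rightarrow> ('x \<Rightarrow> real \<Rightarrow> 'k) \<Rightarrow> bool" where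
  "control_inverse a Z W \<longleftrightarrow>
     (\<forall>q. W q \<in> L2 a) \<and>
     (\<forall>q q'. AE t in lebesgue_on {0..a}. W (q + q') t = W q t + W q' t) \<and>
     (\<forall>c q. AE t in lebesgue_on {0..a}. W (c *\<^sub>R q) t = c *\<^sub>R W q t) \<and>
     (\<forall>q. Z (W q) = q)"

definition mild_solution ::
  "real \<Rightarrow> (real \<Rightarrow> real) \<Rightarrow> (real \<Rightarrow> real \<Rightarrow> 'x::complex_banach \<Rightarrow>\<^sub>L 'x) \<Rightarrow> ('k::banach \<Rightarrow>\<^sub>L 'x) \<Rightarrow>
   (real \<Rightarrow> 'x \<Rightarrow> 'x) \<Rightarrow> ((real \<Rightarrow> 'x) \<Rightarrow> 'x) \<Rightarrow> 'x \<Rightarrow> (real \<Rightarrow> 'k) \<Rightarrow> (real \<Rightarrow> 'x) \<Rightarrow> bool" where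
  "mild_solution a h R V \<delta> g \<zeta>0 u \<zeta> \<longleftrightarrow>
     \<zeta> \<in> regulated a \<and>
     (\<forall>t\<in>{0..a}.
        banach_integrable (lebesgue_on {0..t})
          (\<lambda>s. blinfun_apply (R t s) (blinfun_apply V (u s))) \<and>
        banach_integrable (ls_upto a h t) (\<lambda>s. blinfun_apply (R t s) (\<delta> s (\<zeta> s))) \<and>
        \<zeta> t = blinfun_apply (R t 0) (\<zeta>0 - g \<zeta>)
          + banach_integral (lebesgue_on {0..t})
              (\<lambda>s. blinfun_apply (R t s) (blinfun_apply V (u s)))
          + banach_integral (ls_upto a h t) (\<lambda>s. blinfun_apply (R t s) (\<delta> s (\<zeta> s))))"

definition controllable ::
  "real \<Rightarrow> (real \<Rightarrow> real) \<Rightarrow> (real \<Rightarrow> real \<Rightarrow> 'x::complex_banach \<Rightarrow>\<^sub>L 'x) \<Rightarrow> ('k::banach \<Rightarrow>\<^sub>L 'x) \<Rightarrow>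
   (real \<Rightarrow> 'x \<Rightarrow> 'x) \<Rightarrow> ((real \<Rightarrow> 'x) \<Rightarrow> 'x) \<Rightarrow> bool" where
  "controllable a h R V \<delta> g \<longleftrightarrow>
     (\<forall>\<zeta>0 \<zeta>1. \<exists>u\<in>L2 a. \<exists>\<zeta>. mild_solution a h R V \<delta> g \<zeta>0 u \<zeta> \<and> \<zeta> a + g \<zeta> = \<zeta>1)"

end

theory Submission
  imports Defs "HOL-Probability.Discrete_Topology"
begin

text \<open>A trajectory is sought as a fixed point. Given a candidate \<open>F\<close>, the initial value and the impulses
  \<open>\<delta>(s, F(s))\<close> that it produces determine the state that the control still has to reach at time \<open>a\<close>;
  \<open>Z\<^sup>-\<^sup>1\<close> supplies such a control, and \<open>steer F\<close> is the right-hand side of the mild solution formula for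
  these data. A fixed point is a mild solution, and since \<open>Z Z\<^sup>-\<^sup>1 = id\<close> it satisfies the terminal condition
  (\<open>fixed_point_solves\<close>). The first smallness condition, with the lower limit of \<open>\<omega>(k)/k\<close>, provides a
  ball that \<open>steer\<close> maps into itself (\<open>affine_growth_radius\<close>).

  The map \<open>steer\<close> need not be compact; its effect on noncompactness is under control only for countable
  families. If \<open>f\<^sub>0, f\<^sub>1, \<dots>\<close> take values in a Banach space and for almost every \<open>s\<close> the set of all
  \<open>f\<^sub>n(s)\<close> is covered by finitely many balls of radius close to \<open>\<psi>(s)\<close>, then finitely many balls of radius close
  to \<open>2 \<integral>\<psi>\<close> cover the integrals (\<open>finite_net_banach_integrals\<close>). Indeed almost all values of all \<open>f\<^sub>n\<close> lie in
  the closure of one sequence \<open>c\<close>. Rounding \<open>f\<^sub>n(s)\<close> to the nearest of \<open>c\<^sub>0, \<dots>, c\<^sub>i\<close> makes an error that, for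
  large \<open>i\<close>, is almost at most \<open>2 \<psi>(s)\<close>: twice, because the centres of the balls have to be moved
  into the sequence. The rounded functions have values in one fixed finite set, so their integrals
  stay in a compact set, a multiple of its convex hull. The same rounding
  constructs the Bochner integral. Applied to the impulses and to the
  controls, this shows that \<open>steer\<close> multiplies the radius of such coverings by at most
  \<open>\<kappa> = (2 L\<^sub>1 + 4 L\<^sub>1\<^sup>2 L\<^sub>2 \<integral>P\<^sub>Z) \<integral>U dh\<close> at each time (\<open>steered_net\<close>).

  Countable families suffice: \<open>fixed_point_of_countable_compactness\<close> reduces the existence of a fixed point
  to the compactness of one countable set \<open>S\<close> contained in the convex hull of \<open>0\<close> and \<open>steer S\<close>. Convex hulls do
  not change the radius of coverings, so a radius \<open>r\<close> valid for \<open>S\<close> at all times may be replaced by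
  \<open>\<kappa> r\<close>. Iteration gives radius \<open>0\<close>, as \<open>\<kappa> < 1\<close> by the second smallness condition.

  It remains to pass from compactness at each time to compactness in the supremum norm. Functions with
  jumps are not equicontinuous, but trajectories vary little between times \<open>t\<close> and \<open>t'\<close> at which the
  increasing function \<open>p(t) = t + h(t)\<close> has nearly the same value (\<open>equicontrolled\<close>). This notion is as
  good as equicontinuity in the theorem of Arzela and Ascoli (\<open>finite_net_of_equicontrolled\<close>), and it
  makes a function regulated because \<open>p\<close> has one-sided limits. For the integrals over
  \<open>[0, t)\<close> it is uniform over countable families with compact values, since rounding leaves only
  finitely many orbits of the resolvent operator to be considered, and each of them is uniformly
  continuous (\<open>volterra_equi_modulus\<close>).

  Since Banach space arguments need a type, functions on the interval are embedded into the
  bounded continuous functions on a discrete copy of the real line.\<close>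

section \<open>Finite nets and the measure of noncompactness\<close>

text \<open>The infimum of all such \<open>r\<close> is the Hausdorff measure of noncompactness. As a predicate it
  avoids infima and extended values, and it makes sense for families of functions as well.\<close>

definition finite_net :: "real \<Rightarrow> 'b::real_normed_vector set \<Rightarrow> bool" where
  "finite_net r B \<longleftrightarrow> (\<exists>F. finite F \<and> (\<forall>b\<in>B. \<exists>x\<in>F. norm (b - x) \<le> r))"

lemma finite_net_mono:
  assumes "finite_net r B" "r \<le> r'" "B' \<subseteq> B"
  shows "finite_net r' B'"
  using assms unfolding finite_net_def by (meson order_trans subsetD)

lemma finite_net_finite: "finite B \<Longrightarrow> 0 \<le> r \<Longrightarrow> finite_net r B"
  unfolding finite_net_def by (intro exI[of _ B]) force

lemma finite_net_perturb:
  assumes "finite_net r (f ` J)" "\<And>j. j \<in> J \<Longrightarrow> norm (g j - f j) \<le> s"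
  shows "finite_net (r + s) (g ` J)"
proof -
  obtain F where F: "finite F" "\<And>j. j \<in> J \<Longrightarrow> \<exists>x\<in>F. norm (f j - x) \<le> r"
    using assms(1) unfolding finite_net_def by auto
  have "\<exists>x\<in>F. norm (g j - x) \<le> r + s" if j: "j \<in> J" for j
  proof -
    obtain x where x: "x \<in> F" "norm (f j - x) \<le> r" using F(2)[OF j] by blast
    have "norm (g j - x) \<le> norm (f j - x) + norm (g j - f j)"
      using norm_triangle_ineq[of "f j - x" "g j - f j"] by simp
    then show ?thesis using x assms(2)[OF j] by (intro bexI[of _ x]) auto
  qed
  then show ?thesis using F(1) unfolding finite_net_def by auto
qed

lemma finite_net_add:
  assumes "finite_net r (f ` J)" "finite_net s (g ` J)"
  shows "finite_net (r + s) ((\<lambda>j. f j + g j) ` J)"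
proof -
  obtain F where F: "finite F" "\<And>j. j \<in> J \<Longrightarrow> \<exists>x\<in>F. norm (f j - x) \<le> r"
    using assms(1) unfolding finite_net_def by auto
  obtain G where G: "finite G" "\<And>j. j \<in> J \<Longrightarrow> \<exists>x\<in>G. norm (g j - x) \<le> s"
    using assms(2) unfolding finite_net_def by auto
  have "\<exists>z\<in>(\<lambda>(x, y). x + y) ` (F \<times> G). norm (f j + g j - z) \<le> r + s" if j: "j \<in> J" for j
  proof -
    obtain x y where "x \<in> F" "norm (f j - x) \<le> r" "y \<in> G" "norm (g j - y) \<le> s"
      using F G j by metis
    moreover have "norm (f j + g j - (x + y)) \<le> norm (f j - x) + norm (g j - y)"
      by (metis add_diff_add norm_triangle_ineq)
    ultimately show ?thesis by (intro bexI[of _ "x + y"]) auto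
  qed
  then show ?thesis
    unfolding finite_net_def using F(1) G(1) by (intro exI[of _ "(\<lambda>(x, y). x + y) ` (F \<times> G)"]) auto
qed

lemma finite_net_lipschitz_image:
  assumes "finite_net r B" "0 \<le> L" "\<And>x y. norm (T x - T y) \<le> L * norm (x - y)"
  shows "finite_net (L * r) (T ` B)"
proof -
  obtain F where F: "finite F" "\<And>b. b \<in> B \<Longrightarrow> \<exists>x\<in>F. norm (b - x) \<le> r"
    using assms(1) unfolding finite_net_def by auto
  have "\<exists>z\<in>T ` F. norm (T b - z) \<le> L * r" if b: "b \<in> B" for b
    using F(2)[OF b] assms(2,3) by (meson image_eqI mult_left_mono order_trans)
  then show ?thesis unfolding finite_net_def using F(1) by (intro exI[of _ "T ` F"]) auto
qed

lemma compact_imp_finite_net: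
  assumes "compact K" "B \<subseteq> K" "0 < e"
  shows "finite_net e B"
proof -
  obtain F where F: "finite F" "K \<subseteq> (\<Union>x\<in>F. ball x e)"
    using compactE_image[OF assms(1), of K "\<lambda>x. ball x e"] assms(3)
    by (metis (no_types, lifting) UN_I centre_in_ball open_ball subsetI)
  then show ?thesis unfolding finite_net_def using assms(2)
    by (intro exI[of _ F]) (force simp: dist_norm norm_minus_commute)
qed

lemma finite_nets_imp_compact_closure:
  fixes B :: "'b::banach set"
  assumes "\<And>e. 0 < e \<Longrightarrow> finite_net e B"
  shows "compact (closure B)"
  unfolding compact_eq_totally_bounded
proof (intro conjI allI impI)
  show "complete (closure B)" by (simp add: complete_eq_closed)
  fix e :: real assume e: "0 < e"
  then obtain F where F: "finite F" "\<And>b. b \<in> B \<Longrightarrow> \<exists>x\<in>F. norm (b - x) \<le> e/2"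
    using assms[of "e/2"] unfolding finite_net_def by auto
  have "closure B \<subseteq> (\<Union>x\<in>F. cball x (e/2))"
    by (rule closure_minimal) (use F in \<open>force simp: dist_norm norm_minus_commute\<close>)+
  also have "\<dots> \<subseteq> (\<Union>x\<in>F. ball x e)" using e by force
  finally show "\<exists>k. finite k \<and> closure B \<subseteq> (\<Union>x\<in>k. ball x e)" using F(1) by blast
qed

text \<open>The convex hull of a finite set is compact, so it is covered again by finitely many
  arbitrarily small balls; the points within distance \<open>r\<close> of it form a convex set.\<close>

lemma finite_net_convex_hull:
  assumes "finite_net r B" "0 < e"
  shows "finite_net (r + e) (convex hull B)"
proof -
  obtain F where F: "finite F" "\<And>b. b \<in> B \<Longrightarrow> \<exists>x\<in>F. norm (b - x) \<le> r"
    using assms(1) unfolding finite_net_def by auto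
  let ?C = "convex hull F"
  have "finite_net e ?C"
    using compact_imp_finite_net[OF finite_imp_compact_convex_hull[OF F(1)] order_refl assms(2)] .
  then obtain G where G: "finite G" "\<And>b. b \<in> ?C \<Longrightarrow> \<exists>x\<in>G. norm (b - x) \<le> e"
    unfolding finite_net_def by auto
  let ?H = "{b. \<exists>x\<in>?C. norm (b - x) \<le> r}"
  have "convex ?H"
  proof (rule convexI)
    fix b b' u v assume b: "b \<in> ?H" "b' \<in> ?H" and uv: "0 \<le> (u::real)" "0 \<le> v" "u + v = 1"
    then obtain x x' where x: "x \<in> ?C" "norm (b - x) \<le> r" "x' \<in> ?C" "norm (b' - x') \<le> r" by auto
    have "norm ((u *\<^sub>R b + v *\<^sub>R b') - (u *\<^sub>R x + v *\<^sub>R x')) = norm (u *\<^sub>R (b - x) + v *\<^sub>R (b' - x'))"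
      by (simp add: algebra_simps)
    also have "\<dots> \<le> u * norm (b - x) + v * norm (b' - x')"
      using norm_triangle_ineq[of "u *\<^sub>R (b - x)" "v *\<^sub>R (b' - x')"] uv by simp
    also have "\<dots> \<le> u * r + v * r"
      using x uv by (intro add_mono mult_left_mono) auto
    also have "\<dots> = r" using uv by (simp flip: distrib_right)
    finally show "u *\<^sub>R b + v *\<^sub>R b' \<in> ?H"
      using convexD[OF convex_convex_hull x(1) x(3) uv] by blast
  qed
  moreover have "B \<subseteq> ?H" using F(2) hull_subset[of F convex] by blast
  ultimately have "convex hull B \<subseteq> ?H" by (rule hull_minimal[rotated])
  moreover have "\<exists>y\<in>G. norm (b - y) \<le> r + e" if b: "b \<in> ?H" for b
  proof -
    obtain x where x: "x \<in> ?C" "norm (b - x) \<le> r" using b by auto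
    obtain y where y: "y \<in> G" "norm (x - y) \<le> e" using G x by blast
    have "norm (b - y) \<le> norm (b - x) + norm (x - y)"
      by (metis diff_add_cancel add_diff_eq norm_triangle_ineq)
    then show ?thesis using x y by (intro bexI[of _ y]) auto
  qed
  ultimately show ?thesis unfolding finite_net_def using G(1) by blast
qed

lemma hausdorff_mnc_less_imp_finite_net:
  assumes "hausdorff_mnc B < ennreal r"
  shows "finite_net r B"
proof -
  obtain x where x: "x < ennreal r" "\<exists>\<alpha>. x = ennreal \<alpha> \<and> 0 < \<alpha> \<and>
       (\<exists>C. finite C \<and> (\<forall>(x, r)\<in>C. r < \<alpha>) \<and> B \<subseteq> (\<Union>(x, r)\<in>C. ball x r))"
    using assms unfolding hausdorff_mnc_def Inf_less_iff by blast
  then obtain \<alpha> C where C: "ennreal \<alpha> < ennreal r" "0 < \<alpha>" "finite C"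
      "\<And>x r. (x, r) \<in> C \<Longrightarrow> r < \<alpha>" "B \<subseteq> (\<Union>(x, r)\<in>C. ball x r)" by blast
  then have "\<alpha> < r" by (simp add: ennreal_less_iff)
  have "\<exists>x\<in>fst ` C. norm (b - x) \<le> r" if "b \<in> B" for b
  proof -
    obtain x s where "(x, s) \<in> C" "b \<in> ball x s" using C(5) \<open>b \<in> B\<close> by blast
    with C(4)[of x s] \<open>\<alpha> < r\<close> show ?thesis
      by (intro bexI[of _ x]) (force simp: dist_norm norm_minus_commute)+
  qed
  then show ?thesis unfolding finite_net_def using C(3) by (intro exI[of _ "fst ` C"]) auto
qed

lemma hausdorff_mnc_le_of_finite_net:
  assumes "finite_net r B" "r < r'" "0 < r'"
  shows "hausdorff_mnc B \<le> ennreal r'"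
proof -
  obtain F where F: "finite F" "\<And>b. b \<in> B \<Longrightarrow> \<exists>x\<in>F. norm (b - x) \<le> r"
    using assms(1) unfolding finite_net_def by auto
  let ?s = "(r + r') / 2"
  have "B \<subseteq> (\<Union>(x, r)\<in>(\<lambda>x. (x, ?s)) ` F. ball x r)"
  proof
    fix b assume "b \<in> B"
    then obtain x where "x \<in> F" "norm (b - x) \<le> r" using F by blast
    moreover then have "dist x b < ?s" using assms(2) by (simp add: dist_norm norm_minus_commute field_simps)
    ultimately show "b \<in> (\<Union>(x, r)\<in>(\<lambda>x. (x, ?s)) ` F. ball x r)" by auto
  qed
  then show ?thesis unfolding hausdorff_mnc_def
    using F(1) assms by (intro Inf_lower CollectI exI[of _ r'] conjI refl exI[of _ "(\<lambda>x. (x, ?s)) ` F"]) auto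
qed

text \<open>The form in which the hypotheses on the measure of noncompactness enter: a bound for the measures
  becomes a bound for the radii of finite nets.\<close>

lemma hausdorff_mnc_le_imp_finite_nets:
  assumes "hausdorff_mnc B' \<le> ennreal c * hausdorff_mnc B" "0 \<le> c"
    and B: "\<And>r. q < r \<Longrightarrow> finite_net r B" and "0 \<le> q" "c * q < r'"
  shows "finite_net r' B'"
proof -
  obtain r where r: "q < r" "c * r < r'"
  proof (cases "c = 0")
    case True then show ?thesis using that[of "q + 1"] assms by auto
  next
    case False
    then have "q < r' / c" using assms by (simp add: field_simps)
    then obtain r where "q < r" "r < r' / c" using dense by blast
    then show ?thesis using that[of r] False assms by (simp add: field_simps)
  qed
  have "hausdorff_mnc B \<le> ennreal r"
    using hausdorff_mnc_le_of_finite_net[OF B[of "(q + r)/2"], of r] r assms by auto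
  then have "ennreal c * hausdorff_mnc B \<le> ennreal c * ennreal r" by (rule mult_left_mono) simp
  also have "\<dots> = ennreal (c * r)" using assms r by (simp add: ennreal_mult'')
  also have "\<dots> < ennreal r'" using r assms by (intro ennreal_lessI) (smt (verit) mult_nonneg_nonneg)+
  finally show ?thesis using assms(1) hausdorff_mnc_less_imp_finite_net by (meson le_less_trans)
qed

lemma finite_net_insert:
  assumes "finite_net r B" "0 \<le> r"
  shows "finite_net r (insert x B)"
proof -
  obtain F where F: "finite F" "\<And>b. b \<in> B \<Longrightarrow> \<exists>x\<in>F. norm (b - x) \<le> r" using assms(1) unfolding finite_net_def by auto
  show ?thesis unfolding finite_net_def
  proof (intro exI conjI ballI)
    show "finite (insert x F)" using F(1) by simp
    fix b assume "b \<in> insert x B"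
    then show "\<exists>y\<in>insert x F. norm (b - y) \<le> r" using F(2)[of b] assms(2) by auto
  qed
qed

lemma finite_net_imp_bounded:
  assumes "finite_net r (range y)"
  shows "\<exists>b. \<forall>n. norm (y n) \<le> b"
proof -
  obtain F where F: "finite F" "\<And>n. \<exists>x\<in>F. norm (y n - x) \<le> r" using assms unfolding finite_net_def by auto
  have "norm (y n) \<le> r + (\<Sum>x\<in>F. norm x)" for n
  proof -
    obtain x where x: "x \<in> F" "norm (y n - x) \<le> r" using F(2) by blast
    have "norm x \<le> (\<Sum>x\<in>F. norm x)" using F(1) x(1) by (intro member_le_sum) auto
    then show ?thesis using norm_triangle_sub[of "y n" x] x(2) by linarith
  qed
  then show ?thesis by blast
qed


section \<open>Fixed points of maps on convex sets\<close>

text \<open>Brouwer's theorem for the cube of dimension \<open>n\<close>, up to an arbitrarily small error. The dimension must be a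
  number, not a type, because Schauder's theorem needs all dimensions at once; therefore the argument
  starts from the combinatorial lemma of Kuhn, for the labelling that tells in each coordinate
  whether \<open>F\<close> moves the point down.\<close>

lemma cube_approximate_fixed_point:
  fixes F :: "(nat \<Rightarrow> real) \<Rightarrow> nat \<Rightarrow> real" and n :: nat
  defines "Q \<equiv> {x. \<forall>i<n. 0 \<le> x i \<and> x i \<le> 1}"
  assumes self: "\<And>x i. x \<in> Q \<Longrightarrow> i < n \<Longrightarrow> 0 \<le> F x i \<and> F x i \<le> 1"
    and cont: "\<And>e. 0 < e \<Longrightarrow> \<exists>d>0. \<forall>x\<in>Q. \<forall>y\<in>Q.
        (\<forall>i<n. \<bar>x i - y i\<bar> \<le> d) \<longrightarrow> (\<forall>i<n. \<bar>F x i - F y i\<bar> \<le> e)"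
    and e: "0 < e"
  obtains x where "x \<in> Q" "\<And>i. i < n \<Longrightarrow> \<bar>F x i - x i\<bar> \<le> e"
proof -
  obtain d where d: "d > 0" and Fd: "\<And>x y i. x \<in> Q \<Longrightarrow> y \<in> Q \<Longrightarrow> (\<forall>i<n. \<bar>x i - y i\<bar> \<le> d) \<Longrightarrow> i < n
      \<Longrightarrow> \<bar>F x i - F y i\<bar> \<le> e/2"
    using cont[of "e/2"] e by auto
  obtain p0 :: nat where "inverse (real (Suc p0)) < min d (e/2)"
    using reals_Archimedean[of "min d (e/2)"] d e by auto
  then obtain p :: nat where p: "0 < p" "1 / real p \<le> d" "1 / real p \<le> e/2"
    by (intro that[of "Suc p0"]) (auto simp: field_simps)
  define S where "S x = (\<lambda>i. real (x i) / real p)" for x :: "nat \<Rightarrow> nat"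
  \<comment> \<open>The lemma of Kuhn prescribes the labels on the boundary; elsewhere \<open>1\<close> means that \<open>F\<close>
    decreases the coordinate.\<close>
  define label :: "(nat \<Rightarrow> nat) \<Rightarrow> nat \<Rightarrow> nat" where
    "label x i = (if x i = p \<or> (x i \<noteq> 0 \<and> F (S x) i < S x i) then 1 else 0)" for x i
  have S: "S x \<in> Q" if "\<forall>i<n. x i \<le> p" for x
    using that p by (auto simp: Q_def S_def)
  obtain q where q: "\<forall>i<n. q i < p"
    and rs: "\<forall>i<n. \<exists>r s. (\<forall>j<n. q j \<le> r j \<and> r j \<le> q j + 1) \<and> (\<forall>j<n. q j \<le> s j \<and> s j \<le> q j + 1) \<and> label r i \<noteq> label s i"
    by (rule kuhn_lemma[of p n label]) (use p in \<open>auto simp: label_def\<close>)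
  show ?thesis
  proof (rule that)
    show Sq: "S q \<in> Q" using q by (intro S) auto
    fix i assume i: "i < n"
    obtain r s where rs: "\<forall>j<n. q j \<le> r j \<and> r j \<le> q j + 1" "\<forall>j<n. q j \<le> s j \<and> s j \<le> q j + 1"
      "label r i = 0" "label s i = 1"
    proof -
      obtain r s where *: "\<forall>j<n. q j \<le> r j \<and> r j \<le> q j + 1" "\<forall>j<n. q j \<le> s j \<and> s j \<le> q j + 1"
        "label r i \<noteq> label s i" using rs i by blast
      have "label r i = 0 \<and> label s i = 1 \<or> label r i = 1 \<and> label s i = 0"
        using *(3) by (auto simp: label_def split: if_splits)
      with * show ?thesis using that by blast
    qed
    have near: "S x \<in> Q \<and> \<bar>F (S q) i - F (S x) i\<bar> \<le> e/2 \<and> S q i \<le> S x i \<and> S x i \<le> S q i + 1 / p"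
      if x: "\<forall>j<n. q j \<le> x j \<and> x j \<le> q j + 1" for x
    proof -
      have "\<forall>j<n. x j \<le> p" using x q by (metis Suc_eq_plus1 Suc_leI le_trans)
      then have Sx: "S x \<in> Q" by (rule S)
      have le: "S q j \<le> S x j \<and> S x j \<le> S q j + 1 / p" if "j < n" for j
      proof -
        have "real (q j) \<le> real (x j)" "real (x j) \<le> real (q j) + 1" using x that by force+
        then show ?thesis using p(1) by (auto simp: S_def field_simps)
      qed
      have "\<forall>j<n. \<bar>S q j - S x j\<bar> \<le> d" using le p(2) by (force simp: abs_le_iff)
      then show ?thesis using Fd[OF Sq Sx _ i] le i Sx by auto
    qed
    have "S r i \<le> F (S r) i"
      using rs(3) near[OF rs(1)] self[of "S r" i] i by (auto simp: label_def S_def split: if_splits)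
    moreover have "F (S s) i \<le> S s i"
      using rs(4) near[OF rs(2)] self[of "S s" i] i p(1) by (auto simp: label_def S_def split: if_splits)
    ultimately show "\<bar>F (S q) i - S q i\<bar> \<le> e"
      using near[OF rs(1)] near[OF rs(2)] p(3) by linarith
  qed
qed

text \<open>Turns any point of the cube into weights of a convex combination. The division enforces a sum
  of at most one, and what is missing is put on the first weight; this depends Lipschitz continuously on
  the point and leaves it alone if its coordinates already add up to one.\<close>

definition simplex_weight :: "nat \<Rightarrow> (nat \<Rightarrow> real) \<Rightarrow> nat \<Rightarrow> real" where
  "simplex_weight n c i =
     (c i + (if i = 0 then max 0 (1 - (\<Sum>j<n. c j)) else 0)) / max 1 (\<Sum>j<n. c j)"

lemma simplex_weight:
  assumes "0 < n" "\<forall>i<n. 0 \<le> c i"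
  shows "i < n \<Longrightarrow> 0 \<le> simplex_weight n c i" "(\<Sum>i<n. simplex_weight n c i) = 1"
    "(\<Sum>i<n. c i) = 1 \<Longrightarrow> simplex_weight n c i = c i"
proof -
  let ?s = "\<Sum>j<n. c j"
  show "0 \<le> simplex_weight n c i" if "i < n"
    using assms that unfolding simplex_weight_def by (intro divide_nonneg_pos add_nonneg_nonneg) auto
  have "(\<Sum>i<n. simplex_weight n c i) = (?s + max 0 (1 - ?s)) / max 1 ?s"
    unfolding simplex_weight_def using assms(1)
    by (simp add: sum_divide_distrib[symmetric] sum.distrib)
  also have "\<dots> = 1" by (auto simp: max_def)
  finally show "(\<Sum>i<n. simplex_weight n c i) = 1" .
  show "simplex_weight n c i = c i" if "?s = 1" using that by (simp add: simplex_weight_def)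
qed

lemma simplex_weight_lipschitz:
  assumes c: "\<forall>i<n. 0 \<le> c i" "\<forall>i<n. 0 \<le> c' i" "\<And>i. i < n \<Longrightarrow> \<bar>c i - c' i\<bar> \<le> d" and i: "i < n"
  shows "\<bar>simplex_weight n c i - simplex_weight n c' i\<bar> \<le> (1 + 2 * real n) * d"
proof -
  define s s' where "s = (\<Sum>j<n. c j)" "s' = (\<Sum>j<n. c' j)"
  define u u' where "u = c i + (if i = 0 then max 0 (1 - s) else 0)" "u' = c' i + (if i = 0 then max 0 (1 - s') else 0)"
  have "\<bar>s - s'\<bar> \<le> (\<Sum>j<n. \<bar>c j - c' j\<bar>)" unfolding s_s'_def by (simp add: sum_subtractf[symmetric] sum_abs)
  also have "\<dots> \<le> (\<Sum>j<n. d)" using c by (intro sum_mono) auto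
  finally have ss: "\<bar>s - s'\<bar> \<le> n * d" by simp
  have uu: "\<bar>u - u'\<bar> \<le> d + n * d" unfolding u_u'_def using c(3)[OF i] ss by (auto simp: max_def)
  have mm: "\<bar>max 1 s' - max 1 s\<bar> \<le> n * d" using ss by (auto simp: max_def)
  have "c' i \<le> s'" unfolding s_s'_def using c i by (intro member_le_sum) auto
  moreover have "0 \<le> c' i" using c i by auto
  ultimately have "0 \<le> u'" "u' \<le> max 1 s'" unfolding u_u'_def
    by (auto simp: max_def)
  moreover have "u' \<le> max 1 s'" using \<open>u' \<le> max 1 s'\<close> .
  ultimately have q: "0 \<le> u' / max 1 s'" "u' / max 1 s' \<le> 1" by (auto simp: divide_le_eq)
  have "u / max 1 s - u' / max 1 s' = (u - u' + (u' / max 1 s') * (max 1 s' - max 1 s)) / max 1 s"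
  proof -
    have "0 < max 1 s" "0 < max 1 s'" by auto
    then show ?thesis by (simp add: field_simps del: less_max_iff_disj)
  qed
  also have "\<bar>\<dots>\<bar> \<le> \<bar>u - u' + (u' / max 1 s') * (max 1 s' - max 1 s)\<bar> / 1"
    unfolding abs_divide by (rule divide_left_mono) auto
  also have "\<dots> = \<bar>u - u' + (u' / max 1 s') * (max 1 s' - max 1 s)\<bar>" by simp
  also have "\<dots> \<le> \<bar>u - u'\<bar> + \<bar>(u' / max 1 s') * (max 1 s' - max 1 s)\<bar>" by (rule abs_triangle_ineq)
  also have "\<bar>(u' / max 1 s') * (max 1 s' - max 1 s)\<bar> \<le> 1 * (n * d)"
    unfolding abs_mult using q mm by (intro mult_mono) (auto simp only: abs_of_nonneg)
  finally have "\<bar>u / max 1 s - u' / max 1 s'\<bar> \<le> \<bar>u - u'\<bar> + n * d" by simp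
  also have "\<dots> \<le> (1 + 2 * real n) * d" using uu by (simp add: algebra_simps)
  finally show ?thesis unfolding simplex_weight_def u_u'_def s_s'_def .
qed

text \<open>A partition of unity subordinate to a finite \<open>\<epsilon>\<close>-net \<open>x\<^sub>0, \<dots>, x\<^sub>n\<^sub>-\<^sub>1\<close> of \<open>K\<close> maps \<open>K\<close> to weights, and weights give
  back a point of \<open>K\<close> that is \<open>\<epsilon>\<close>-close to the original one. Composing with \<open>f\<close> yields a self-map of the
  cube, whose approximate fixed points give those of \<open>f\<close>.\<close>

lemma schauder_approximate_fixed_point:
  fixes K :: "'b::real_normed_vector set"
  assumes K: "compact K" "convex K" "K \<noteq> {}" and f: "continuous_on K f" "f ` K \<subseteq> K" and e: "0 < e"
  obtains y where "y \<in> K" "norm (f y - y) \<le> e"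
proof -
  define \<epsilon> where "\<epsilon> = e / 2"
  have \<epsilon>: "0 < \<epsilon>" using e by (simp add: \<epsilon>_def)
  obtain X where X: "finite X" "X \<subseteq> K" "K \<subseteq> (\<Union>x\<in>X. ball x \<epsilon>)"
    using compactE_image[OF K(1), of K "\<lambda>x. ball x \<epsilon>"] \<epsilon>
    by (metis (no_types, lifting) UN_I centre_in_ball open_ball subsetI)
  obtain xs where xs: "set xs = X" using finite_list[OF X(1)] by blast
  define n where "n = length xs"
  define x where "x i = xs ! i" for i
  have xK: "x i \<in> K" if "i < n" for i using that X(2) xs unfolding n_def x_def by (metis nth_mem subsetD)
  have cover: "\<exists>i<n. norm (y - x i) < \<epsilon>" if "y \<in> K" for y
  proof -
    obtain z where "z \<in> X" "norm (y - z) < \<epsilon>"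
      using X(3) \<open>y \<in> K\<close> by (auto simp: dist_norm norm_minus_commute)
    then show ?thesis using xs by (metis in_set_conv_nth n_def x_def)
  qed
  have n: "0 < n" using cover K(3) by fastforce
  define w where "w y i = max 0 (\<epsilon> - norm (y - x i))" for y i
  define W where "W y = (\<Sum>i<n. w y i)" for y
  define \<pi> where "\<pi> y i = w y i / W y" for y i
  have W: "0 < W y" if "y \<in> K" for y
  proof -
    obtain i where "i < n" "norm (y - x i) < \<epsilon>" using cover[OF \<open>y \<in> K\<close>] by blast
    then show ?thesis unfolding W_def by (intro sum_pos2[of _ i]) (auto simp: w_def)
  qed
  have \<pi>0: "0 \<le> \<pi> y i" if "y \<in> K" for y i using W[OF that] by (simp add: \<pi>_def w_def)
  have \<pi>sum: "(\<Sum>i<n. \<pi> y i) = 1" if "y \<in> K" for y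
    using W[OF that] by (simp add: \<pi>_def sum_divide_distrib[symmetric] flip: W_def)
  have \<pi>1: "\<pi> y i \<le> 1" if "y \<in> K" "i < n" for y i
    using \<pi>sum[OF that(1)] member_le_sum[of i "{..<n}" "\<pi> y"] \<pi>0[OF that(1)] that(2) by auto
  define Y where "Y c = (\<Sum>i<n. simplex_weight n c i *\<^sub>R x i)" for c
  define Q :: "(nat \<Rightarrow> real) set" where "Q = {c. \<forall>i<n. 0 \<le> c i \<and> c i \<le> 1}"
  have YK: "Y c \<in> K" if "c \<in> Q" for c
    unfolding Y_def using that simplex_weight[OF n, of c] xK unfolding Q_def
    by (intro convex_sum[OF _ K(2)]) auto
  define B where "B = (1 + 2 * real n) * (1 + (\<Sum>i<n. norm (x i)))"
  have B: "0 < B" unfolding B_def by (intro mult_pos_pos add_pos_nonneg sum_nonneg) auto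
  have Ylip: "norm (Y c - Y c') \<le> B * d"
    if "c \<in> Q" "c' \<in> Q" "\<And>i. i < n \<Longrightarrow> \<bar>c i - c' i\<bar> \<le> d" for c c' d
  proof -
    have d: "0 \<le> d" using that(3)[OF n] by linarith
    have "norm (Y c - Y c') = norm (\<Sum>i<n. (simplex_weight n c i - simplex_weight n c' i) *\<^sub>R x i)"
      by (simp add: Y_def sum_subtractf scaleR_diff_left)
    also have "\<dots> \<le> (\<Sum>i<n. \<bar>simplex_weight n c i - simplex_weight n c' i\<bar> * norm (x i))"
      by (rule order_trans[OF norm_sum]) simp
    also have "\<dots> \<le> (\<Sum>i<n. ((1 + 2 * real n) * d) * norm (x i))"
      using simplex_weight_lipschitz[of n c c' d] that unfolding Q_def
      by (intro sum_mono mult_right_mono) auto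
    also have "\<dots> = (1 + 2 * real n) * d * (\<Sum>i<n. norm (x i))" by (simp add: sum_distrib_left)
    also have "\<dots> \<le> B * d" unfolding B_def using d by (simp add: algebra_simps)
    finally show ?thesis .
  qed
  have cont: "uniformly_continuous_on K (\<lambda>y. \<pi> (f y) i)" for i
  proof (rule compact_uniformly_continuous[OF _ K(1)])
    have "continuous_on K (\<lambda>y. \<pi> y i)"
      unfolding \<pi>_def W_def w_def using W unfolding W_def w_def
      by (intro continuous_intros) (auto simp: less_imp_neq[symmetric])
    then show "continuous_on K (\<lambda>y. \<pi> (f y) i)"
      using f by (auto intro: continuous_on_compose2)
  qed
  \<comment> \<open>From the cube to \<open>K\<close>, then \<open>f\<close>, then back to the cube by the partition of unity.\<close>
  define F where "F c = \<pi> (f (Y c))" for c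
  have self: "0 \<le> F c i \<and> F c i \<le> 1" if "c \<in> Q" "i < n" for c i
    using \<pi>0 \<pi>1 YK[OF that(1)] f(2) that(2) unfolding F_def by blast
  have Fcont: "\<exists>d>0. \<forall>c\<in>Q. \<forall>c'\<in>Q. (\<forall>i<n. \<bar>c i - c' i\<bar> \<le> d) \<longrightarrow> (\<forall>i<n. \<bar>F c i - F c' i\<bar> \<le> e')"
    if e': "0 < e'" for e'
  proof -
    have "\<forall>i. \<exists>d>0. \<forall>y\<in>K. \<forall>y'\<in>K. norm (y - y') < d \<longrightarrow> \<bar>\<pi> (f y) i - \<pi> (f y') i\<bar> < e'"
      using cont e' unfolding uniformly_continuous_on_def dist_norm real_norm_def by (metis norm_minus_commute)
    then obtain d where d: "\<And>i. d i > 0"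
      "\<And>i y y'. y \<in> K \<Longrightarrow> y' \<in> K \<Longrightarrow> norm (y - y') < d i \<Longrightarrow> \<bar>\<pi> (f y) i - \<pi> (f y') i\<bar> < e'"
      by metis
    define m where "m = Min (d ` {..<n})"
    have "m \<in> d ` {..<n}" unfolding m_def using n by (intro Min_in) auto
    then have m: "m > 0" "\<And>i. i < n \<Longrightarrow> m \<le> d i" using d(1) by (auto simp: m_def)
    show ?thesis
    proof (intro exI[of _ "m / (2 * B)"] conjI ballI impI allI)
      show "0 < m / (2 * B)" using m B by simp
      fix c c' i assume c: "c \<in> Q" "c' \<in> Q" "\<forall>i<n. \<bar>c i - c' i\<bar> \<le> m / (2 * B)" and i: "i < n"
      have "norm (Y c - Y c') \<le> B * (m / (2 * B))" using c by (intro Ylip) auto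
      also have "\<dots> = m / 2" using B by simp
      also have "\<dots> < d i" using m(1) m(2)[OF i] by simp
      finally show "\<bar>F c i - F c' i\<bar> \<le> e'"
        unfolding F_def using d(2)[OF YK[OF c(1)] YK[OF c(2)]] by (simp add: less_imp_le)
    qed
  qed
  obtain c where c: "c \<in> Q" "\<And>i. i < n \<Longrightarrow> \<bar>F c i - c i\<bar> \<le> \<epsilon> / B"
    using cube_approximate_fixed_point[of n F "\<epsilon> / B"] self Fcont \<epsilon> B unfolding Q_def by auto
  define y where "y = Y c"
  have yK: "y \<in> K" "f y \<in> K" using YK[OF c(1)] f(2) by (auto simp: y_def)
  have FQ: "F c \<in> Q" using self[OF c(1)] by (simp add: Q_def)
  have "norm (Y (F c) - Y c) \<le> B * (\<epsilon> / B)" using c FQ by (intro Ylip) auto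
  then have 1: "norm (Y (F c) - y) \<le> \<epsilon>" using B by (simp add: y_def)
  have YF: "Y (F c) = (\<Sum>i<n. \<pi> (f y) i *\<^sub>R x i)"
    unfolding Y_def y_def F_def using simplex_weight(3)[OF n] \<pi>0 \<pi>sum yK(2)
    by (intro sum.cong) (auto simp: y_def Y_def)
  have "f y - Y (F c) = (\<Sum>i<n. \<pi> (f y) i *\<^sub>R f y) - (\<Sum>i<n. \<pi> (f y) i *\<^sub>R x i)"
    using \<pi>sum[OF yK(2)] by (simp add: YF flip: scaleR_sum_left)
  also have "\<dots> = (\<Sum>i<n. \<pi> (f y) i *\<^sub>R (f y - x i))"
    by (simp add: sum_subtractf scaleR_diff_right)
  also have "norm \<dots> \<le> (\<Sum>i<n. \<pi> (f y) i * norm (f y - x i))"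
    by (rule order_trans[OF norm_sum]) (use \<pi>0[OF yK(2)] in simp)
  also have "\<dots> \<le> (\<Sum>i<n. \<pi> (f y) i * \<epsilon>)"
  proof (rule sum_mono)
    fix i
    show "\<pi> (f y) i * norm (f y - x i) \<le> \<pi> (f y) i * \<epsilon>"
    proof (cases "norm (f y - x i) \<le> \<epsilon>")
      case True then show ?thesis using \<pi>0[OF yK(2)] by (intro mult_left_mono) auto
    next
      case False then show ?thesis by (simp add: \<pi>_def w_def)
    qed
  qed
  also have "\<dots> = \<epsilon>" using \<pi>sum[OF yK(2)] by (simp flip: sum_distrib_right)
  finally have "norm (f y - y) \<le> e"
    using 1 norm_triangle_ineq[of "f y - Y (F c)" "Y (F c) - y"] by (simp add: \<epsilon>_def)
  then show ?thesis using that yK by blast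
qed

text \<open>On a compact set \<open>norm (f y - y)\<close> attains its infimum, which is zero by the previous lemma.\<close>

theorem schauder_fixed_point:
  fixes K :: "'b::real_normed_vector set"
  assumes K: "compact K" "convex K" "K \<noteq> {}" and f: "continuous_on K f" "f ` K \<subseteq> K"
  obtains y where "y \<in> K" "f y = y"
proof -
  obtain y where y: "y \<in> K" "\<And>z. z \<in> K \<Longrightarrow> norm (f y - y) \<le> norm (f z - z)"
  proof -
    have "continuous_on K (\<lambda>z. norm (f z - z))" by (intro continuous_intros f(1))
    from continuous_attains_inf[OF K(1,3) this] show ?thesis using that by blast
  qed
  have "norm (f y - y) = 0"
  proof (rule ccontr)
    assume "norm (f y - y) \<noteq> 0"
    then have pos: "0 < norm (f y - y) / 2" by simp
    obtain z where "z \<in> K" "norm (f z - z) \<le> norm (f y - y) / 2"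
      by (rule schauder_approximate_fixed_point[OF K f pos])
    with y(2)[of z] pos show False by simp
  qed
  then show ?thesis using that y by simp
qed

text \<open>Midpoints are enough to generate a convex closure, and in contrast to the convex hull they
  keep the set countable.\<close>

inductive_set midpoint_orbit :: "('b::real_vector \<Rightarrow> 'b) \<Rightarrow> 'b \<Rightarrow> 'b set" for G x0 where
  start: "x0 \<in> midpoint_orbit G x0"
| image: "x \<in> midpoint_orbit G x0 \<Longrightarrow> G x \<in> midpoint_orbit G x0"
| midpoint: "x \<in> midpoint_orbit G x0 \<Longrightarrow> y \<in> midpoint_orbit G x0 \<Longrightarrow>
    (1/2) *\<^sub>R x + (1/2) *\<^sub>R y \<in> midpoint_orbit G x0"

lemma countable_midpoint_orbit: "countable (midpoint_orbit G x0)"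
proof -
  define step where "step S = S \<union> G ` S \<union> (\<lambda>(x, y). (1/2) *\<^sub>R x + (1/2) *\<^sub>R y) ` (S \<times> S)" for S
  define S where "S n = (step ^^ n) {x0}" for n
  have Suc: "S (Suc n) = step (S n)" for n by (simp add: S_def)
  have "countable (S n)" for n
    by (induction n) (auto simp: Suc, auto simp: S_def step_def)
  moreover have mono: "S m \<subseteq> S n" if "m \<le> n" for m n
    using that by (induction rule: dec_induct) (auto simp: Suc step_def)
  have "x \<in> (\<Union>n. S n)" if "x \<in> midpoint_orbit G x0" for x
    using that
  proof induction
    case start then show ?case by (auto simp: S_def intro: exI[of _ 0])
  next
    case (image x)
    then obtain n where "x \<in> S n" by blast
    then have "G x \<in> S (Suc n)" by (simp add: Suc step_def)
    then show ?case by blast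
  next
    case (midpoint x y)
    then obtain m n where "x \<in> S m" "y \<in> S n" by blast
    then have "x \<in> S (max m n)" "y \<in> S (max m n)" using mono by (meson max.cobounded1 max.cobounded2 subsetD)+
    then have "(1/2) *\<^sub>R x + (1/2) *\<^sub>R y \<in> S (Suc (max m n))" by (force simp: Suc step_def)
    then show ?case by blast
  qed
  ultimately show ?thesis by (meson countable_UN countable_subset subsetI uncountable_def countableI_type UNIV_I)
qed

lemma midpoint_orbit_subset_convex_hull:
  "midpoint_orbit G x0 \<subseteq> convex hull (insert x0 (G ` midpoint_orbit G x0))" (is "_ \<subseteq> ?H")
proof
  fix x assume "x \<in> midpoint_orbit G x0"
  then show "x \<in> ?H"
  proof induction
    case (midpoint x y)
    then show ?case by (intro convexD[OF convex_convex_hull]) auto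
  qed (auto intro: hull_inc)
qed

text \<open>If a point of a segment were missing from \<open>C\<close>, the nearest points of \<open>C\<close> on both sides of it would
  bound a gap containing their midpoint.\<close>

lemma convex_if_closed_midpoint:
  fixes C :: "'b::real_normed_vector set"
  assumes "closed C" and mid: "\<And>x y. x \<in> C \<Longrightarrow> y \<in> C \<Longrightarrow> (1/2) *\<^sub>R x + (1/2) *\<^sub>R y \<in> C"
  shows "convex C"
  unfolding convex_alt
proof (intro ballI allI impI)
  fix x y t assume xy: "x \<in> C" "y \<in> C" and t: "0 \<le> t \<and> t \<le> (1::real)"
  define p where "p t = (1 - t) *\<^sub>R x + t *\<^sub>R y" for t :: real
  let ?T = "p -` C"
  have "continuous_on UNIV p" unfolding p_def by (intro continuous_intros)
  then have closed: "closed ?T" using closed_vimage assms(1) by blast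
  have midT: "(s + r) / 2 \<in> ?T" if "s \<in> ?T" "r \<in> ?T" for s r
  proof -
    have "p ((s + r) / 2) = (1/2) *\<^sub>R p s + (1/2) *\<^sub>R p r"
    proof -
      have "1 - (s + r) / 2 = (1/2) * (1 - s) + (1/2) * (1 - r)" "(s + r) / 2 = (1/2) * s + (1/2) * r"
        by (auto simp: field_simps)
      then show ?thesis
        unfolding p_def scaleR_add_right scaleR_scaleR by (simp only: scaleR_add_left) (simp only: ac_simps)
    qed
    then show ?thesis using mid that by simp
  qed
  define l r where "l = Sup (?T \<inter> {0..t})" "r = Inf (?T \<inter> {t..1})"
  have ne: "0 \<in> ?T \<inter> {0..t}" "1 \<in> ?T \<inter> {t..1}" using xy t by (auto simp: p_def)
  have bdd: "bdd_above (?T \<inter> {0..t})" "bdd_below (?T \<inter> {t..1})" by (auto intro: bdd_aboveI[of _ t] bdd_belowI[of _ t])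
  have l: "l \<in> ?T \<inter> {0..t}" unfolding l_r_def using ne(1) bdd closed by (intro closed_contains_Sup) auto
  have r: "r \<in> ?T \<inter> {t..1}" unfolding l_r_def using ne(2) bdd closed by (intro closed_contains_Inf) auto
  have m: "(l + r) / 2 \<in> ?T" using midT l r by blast
  have "l = t \<or> r = t"
  proof (cases "(l + r) / 2 \<le> t")
    case True
    then have "(l + r) / 2 \<le> l" unfolding l_r_def(1) using m l r
      by (intro cSup_upper bdd) (auto simp: l_r_def(1)[symmetric])
    then show ?thesis using l r by auto
  next
    case False
    then have "r \<le> (l + r) / 2" unfolding l_r_def(2) using m l r
      by (intro cInf_lower bdd) (auto simp: l_r_def(2)[symmetric])
    then show ?thesis using l r by auto
  qed
  then have "t \<in> ?T" using l r by auto
  then show "(1 - t) *\<^sub>R x + t *\<^sub>R y \<in> C" by (simp add: p_def)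
qed

lemma convex_closure_midpoint_orbit: "convex (closure (midpoint_orbit G x0))"
  for G :: "'b::real_normed_vector \<Rightarrow> 'b"
proof -
  let ?S = "midpoint_orbit G x0"
  have mid: "(1/2) *\<^sub>R x + (1/2) *\<^sub>R y \<in> closure ?S" if xy: "x \<in> closure ?S" "y \<in> closure ?S" for x y
  proof -
    obtain u v where "\<forall>n. u n \<in> ?S" "u \<longlonglongrightarrow> x" "\<forall>n. v n \<in> ?S" "v \<longlonglongrightarrow> y"
      using xy unfolding closure_sequential by blast
    then show ?thesis unfolding closure_sequential
      by (intro exI[of _ "\<lambda>n. (1/2) *\<^sub>R u n + (1/2) *\<^sub>R v n"] conjI allI midpoint_orbit.midpoint tendsto_intros) auto
  qed
  show ?thesis using mid by (intro convex_if_closed_midpoint) auto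
qed

text \<open>A form of the fixed point principle of Moench. The smallest set containing \<open>x0\<close> and closed under
  \<open>G\<close> and midpoints is countable and, by its minimality, inside the convex hull of \<open>x0\<close> and its own
  image. Its closure is convex and invariant, so compactness of this one set allows Schauder's theorem
  to be applied to it.\<close>

theorem fixed_point_of_countable_compactness:
  fixes G :: "'b::banach \<Rightarrow> 'b"
  assumes C: "closed C" "convex C" "x0 \<in> C" and G: "continuous_on C G" "G ` C \<subseteq> C"
    and net: "\<And>S e. countable S \<Longrightarrow> x0 \<in> S \<Longrightarrow> S \<subseteq> C \<Longrightarrow> S \<subseteq> convex hull (insert x0 (G ` S)) \<Longrightarrow> 0 < e
      \<Longrightarrow> finite_net e (G ` S)"
  obtains x where "x \<in> C" "G x = x"
proof -
  let ?S = "midpoint_orbit G x0"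
  have SC: "?S \<subseteq> C"
  proof
    fix x assume "x \<in> ?S" then show "x \<in> C"
    proof induction
      case (midpoint x y) then show ?case by (intro convexD[OF C(2)]) auto
    qed (use C G in auto)
  qed
  have KC: "closure ?S \<subseteq> C" using SC C(1) by (rule closure_minimal)
  have "finite_net e ?S" if e: "0 < e" for e
  proof -
    have "finite_net (e/2) (G ` ?S)"
      using net[OF countable_midpoint_orbit midpoint_orbit.start SC midpoint_orbit_subset_convex_hull] e by simp
    then have "finite_net (e/2) (insert x0 (G ` ?S))" using e by (intro finite_net_insert) auto
    then have "finite_net (e/2 + e/2) (convex hull (insert x0 (G ` ?S)))"
      using e by (intro finite_net_convex_hull) auto
    then show ?thesis by (rule finite_net_mono) (use midpoint_orbit_subset_convex_hull in auto)
  qed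
  then have "compact (closure ?S)" by (rule finite_nets_imp_compact_closure)
  moreover have "G ` closure ?S \<subseteq> closure ?S"
  proof -
    have "G ` closure ?S \<subseteq> closure (G ` ?S)"
      using continuous_on_subset[OF G(1) KC] continuous_image_closure_subset by blast
    also have "\<dots> \<subseteq> closure ?S" by (intro closure_mono) (auto intro: midpoint_orbit.image)
    finally show ?thesis .
  qed
  ultimately obtain x where "x \<in> closure ?S" "G x = x"
    using schauder_fixed_point[OF _ convex_closure_midpoint_orbit _ continuous_on_subset[OF G(1) KC]]
      midpoint_orbit.start closure_subset by (metis empty_iff subsetD)
  then show ?thesis using that KC by blast
qed

section \<open>Strong measurability\<close>

locale complete_finite_measure = finite_measure M + complete_measure M for M :: "'m measure"

lemma (in complete_measure) measurable_AE_cong: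
  assumes "f \<in> borel_measurable M" "AE x in M. f x = g x"
  shows "g \<in> borel_measurable M"
proof (rule measurableI)
  fix S :: "'b set" assume S: "S \<in> sets borel"
  have "AE x in M. x \<in> f -` S \<inter> space M \<longleftrightarrow> x \<in> g -` S \<inter> space M" using assms(2) by eventually_elim auto
  moreover have "f -` S \<inter> space M \<in> sets M" using assms(1) S by (rule measurable_sets)
  ultimately show "g -` S \<inter> space M \<in> sets M" by (rule in_sets_AE) auto
qed auto

lemma (in complete_measure) complete_measure_restrict_space:
  assumes "A \<in> sets M"
  shows "complete_measure (restrict_space M A)"
proof
  fix S T assume "S \<subseteq> T" "T \<in> null_sets (restrict_space M A)"
  then have "S \<in> sets M" "S \<subseteq> A" using assms complete[of S T] by (auto simp: null_sets_restrict_space)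
  then show "S \<in> sets (restrict_space M A)" using assms by (subst sets_restrict_space_iff) auto
qed

lemma (in complete_finite_measure) complete_finite_measure_restrict_space:
  assumes "A \<in> sets M"
  shows "complete_finite_measure (restrict_space M A)"
  unfolding complete_finite_measure_def
  using assms finite_measure_axioms complete_measure_restrict_space by (auto intro: finite_measure_restrict_space)

lemma strongly_measurable_cong_AE:
  assumes "strongly_measurable M f" "AE x in M. f x = g x"
  shows "strongly_measurable M g"
proof -
  obtain s where s: "\<forall>i::nat. simple_function M (s i)" "AE x in M. (\<lambda>i. s i x) \<longlonglongrightarrow> f x"
    using assms(1) unfolding strongly_measurable_def by blast
  have "AE x in M. (\<lambda>i. s i x) \<longlonglongrightarrow> g x" using s(2) assms(2) by eventually_elim auto
  then show ?thesis using s(1) unfolding strongly_measurable_def by blast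
qed

lemma strongly_measurable_simple_function:
  "simple_function M s \<Longrightarrow> strongly_measurable M s"
  unfolding strongly_measurable_def by (intro exI[of _ "\<lambda>_. s"]) auto

lemma (in complete_measure) strongly_measurable_norm_diff:
  fixes f :: "'a \<Rightarrow> 'b::real_normed_vector"
  assumes "strongly_measurable M f"
  shows "(\<lambda>x. norm (f x - c)) \<in> borel_measurable M"
proof -
  obtain s where s: "\<And>i::nat. simple_function M (s i)" "AE x in M. (\<lambda>i. s i x) \<longlonglongrightarrow> f x"
    using assms(1) unfolding strongly_measurable_def by blast
  have [measurable]: "(\<lambda>x. norm (s i x - c)) \<in> borel_measurable M" for i
    using simple_function_compose1[OF s(1)[of i], of "\<lambda>y. norm (y - c)"] by (rule borel_measurable_simple_function)
  have "(\<lambda>x. lim (\<lambda>i. norm (s i x - c))) \<in> borel_measurable M" by (intro borel_measurable_lim_metric) auto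
  moreover have "AE x in M. lim (\<lambda>i. norm (s i x - c)) = norm (f x - c)"
    using s(2) by eventually_elim (auto intro!: limI tendsto_intros)
  ultimately show ?thesis by (rule measurable_AE_cong)
qed

lemma (in complete_measure) strongly_measurable_norm:
  "strongly_measurable M f \<Longrightarrow> (\<lambda>x. norm (f x)) \<in> borel_measurable M"
  using strongly_measurable_norm_diff[of f 0] by simp

lemma strongly_measurable_map2:
  fixes p :: "'b::real_normed_vector \<Rightarrow> 'c::real_normed_vector \<Rightarrow> 'd::real_normed_vector"
  assumes "strongly_measurable M f" "strongly_measurable M g"
    and p: "\<And>s t y z. s \<longlonglongrightarrow> y \<Longrightarrow> t \<longlonglongrightarrow> z \<Longrightarrow> (\<lambda>i. p (s i) (t i)) \<longlonglongrightarrow> p y z"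
  shows "strongly_measurable M (\<lambda>x. p (f x) (g x))"
proof -
  obtain s where s: "\<And>i::nat. simple_function M (s i)" "AE x in M. (\<lambda>i. s i x) \<longlonglongrightarrow> f x"
    using assms(1) unfolding strongly_measurable_def by blast
  obtain t where t: "\<And>i::nat. simple_function M (t i)" "AE x in M. (\<lambda>i. t i x) \<longlonglongrightarrow> g x"
    using assms(2) unfolding strongly_measurable_def by blast
  have "simple_function M (\<lambda>x. p (s i x) (t i x))" for i
    using s(1) t(1) by (rule simple_function_compose2)
  moreover have "AE x in M. (\<lambda>i. p (s i x) (t i x)) \<longlonglongrightarrow> p (f x) (g x)"
    using s(2) t(2) by eventually_elim (rule p)
  ultimately show ?thesis unfolding strongly_measurable_def by (intro exI[of _ "\<lambda>i x. p (s i x) (t i x)"]) auto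
qed

lemma strongly_measurable_diff:
  "strongly_measurable M f \<Longrightarrow> strongly_measurable M g \<Longrightarrow> strongly_measurable M (\<lambda>x. f x - g x)"
  by (rule strongly_measurable_map2) (auto intro: tendsto_diff)

lemma strongly_measurable_restrict_spaceI:
  fixes f :: "'m \<Rightarrow> 'b::real_normed_vector"
  assumes "strongly_measurable M f" "A \<in> sets M"
  shows "strongly_measurable (restrict_space M A) f"
proof -
  obtain s where s: "\<And>i::nat. simple_function M (s i)" "AE x in M. (\<lambda>i. s i x) \<longlonglongrightarrow> f x"
    using assms(1) unfolding strongly_measurable_def by blast
  have "simple_function (restrict_space M A) (s i)" for i
    using simple_function_compose2[OF simple_function_indicator[OF assms(2)] s(1)[of i], of "(*\<^sub>R)"] assms(2)
    by (subst simple_function_restrict_space) auto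
  moreover have "AE x in restrict_space M A. (\<lambda>i. s i x) \<longlonglongrightarrow> f x"
    using s(2) assms(2) by (subst AE_restrict_space_iff) auto
  ultimately show ?thesis unfolding strongly_measurable_def by blast
qed

lemma strongly_measurable_restrict_spaceD:
  fixes f :: "'m \<Rightarrow> 'b::real_normed_vector"
  assumes "strongly_measurable (restrict_space M A) f" "A \<in> sets M"
  shows "strongly_measurable M (\<lambda>x. indicator A x *\<^sub>R f x)"
proof -
  obtain s where s: "\<And>i::nat. simple_function (restrict_space M A) (s i)"
      "AE x in restrict_space M A. (\<lambda>i. s i x) \<longlonglongrightarrow> f x"
    using assms(1) unfolding strongly_measurable_def by blast
  have "simple_function M (\<lambda>x. indicator A x *\<^sub>R s i x)" for i
    using s(1)[of i] assms(2) by (subst (asm) simple_function_restrict_space) auto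
  moreover have "AE x in M. (\<lambda>i. indicator A x *\<^sub>R s i x) \<longlonglongrightarrow> indicator A x *\<^sub>R f x"
    using s(2) assms(2) by (subst (asm) AE_restrict_space_iff) (auto elim!: eventually_mono split: split_indicator)
  ultimately show ?thesis unfolding strongly_measurable_def by (intro exI[of _ "\<lambda>i x. indicator A x *\<^sub>R s i x"]) auto
qed


text \<open>Ties are broken by the smallest index, which makes the choice measurable.\<close>

definition nearest :: "(nat \<Rightarrow> 'b::real_normed_vector) \<Rightarrow> nat \<Rightarrow> 'b \<Rightarrow> nat" where
  "nearest c i y = (LEAST j. j \<le> i \<and> (\<forall>k\<le>i. norm (y - c j) \<le> norm (y - c k)))"

lemma nearest:
  "nearest c i y \<le> i" "k \<le> i \<Longrightarrow> norm (y - c (nearest c i y)) \<le> norm (y - c k)"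
proof -
  have "\<exists>j. j \<le> i \<and> (\<forall>k\<le>i. norm (y - c j) \<le> norm (y - c k))"
    using arg_min_if_finite[of "{..i}" "\<lambda>j. norm (y - c j)"]
    by (metis atMost_iff empty_iff finite_atMost le_zero_eq not_le_imp_less order_refl)
  from LeastI_ex[OF this] show "nearest c i y \<le> i"
    "k \<le> i \<Longrightarrow> norm (y - c (nearest c i y)) \<le> norm (y - c k)" by (auto simp: nearest_def)
qed

lemma nearest_tendsto:
  assumes "y \<in> closure (range c)"
  shows "(\<lambda>i. c (nearest c i y)) \<longlonglongrightarrow> y"
proof (rule LIMSEQ_I)
  fix r :: real assume "0 < r"
  then obtain j where j: "dist (c j) y < r" using assms by (auto simp: closure_approachable)
  show "\<exists>no. \<forall>n\<ge>no. norm (c (nearest c n y) - y) < r"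
    using nearest(2)[of j _ y c] j by (intro exI[of _ j]) (force simp: dist_norm norm_minus_commute)
qed

lemma simple_function_nearest:
  assumes "\<And>j. (\<lambda>x. norm (f x - c j)) \<in> borel_measurable M"
  shows "simple_function M (\<lambda>x. nearest c i (f x))"
proof -
  note [measurable] = assms
  have "(\<lambda>x. nearest c i (f x)) \<in> measurable M (count_space UNIV)" unfolding nearest_def by measurable
  moreover have "finite ((\<lambda>x. nearest c i (f x)) ` space M)"
    by (rule finite_subset[of _ "{..i}"]) (auto simp: nearest(1))
  ultimately show ?thesis unfolding simple_function_def by (auto intro: measurable_sets)
qed

text \<open>The simple functions are obtained by rounding the values to the nearest of the first \<open>i\<close> points.
  With its converse, \<open>strongly_measurable_sequence_separable\<close> and \<open>strongly_measurable_norm_diff\<close>, this replaces the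
  definition by two conditions that visibly pass to limits almost everywhere.\<close>

lemma strongly_measurableI_separable:
  fixes c :: "nat \<Rightarrow> 'b::real_normed_vector"
  assumes "AE x in M. f x \<in> closure (range c)" "\<And>j. (\<lambda>x. norm (f x - c j)) \<in> borel_measurable M"
  shows "strongly_measurable M f"
  unfolding strongly_measurable_def
proof (intro exI conjI allI)
  show "simple_function M (\<lambda>x. c (nearest c i (f x)))" for i
    using simple_function_compose1[OF simple_function_nearest[of f c, OF assms(2)]] .
  show "AE x in M. (\<lambda>i. c (nearest c i (f x))) \<longlonglongrightarrow> f x"
    using assms(1) by eventually_elim (rule nearest_tendsto)
qed

text \<open>All values taken by the approximating simple functions form a countable set. The first member of
  the sequence is \<open>0\<close> so that rounding to a nearest member never moves a vector by more than its norm.\<close>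

lemma strongly_measurable_sequence_separable:
  fixes f :: "nat \<Rightarrow> 'm \<Rightarrow> 'b::real_normed_vector"
  assumes "\<And>n. strongly_measurable M (f n)"
  obtains c :: "nat \<Rightarrow> 'b" where "c 0 = 0" "AE x in M. \<forall>n. f n x \<in> closure (range c)"
proof -
  obtain s where s: "\<And>n i::nat. simple_function M (s n i)" "\<And>n. AE x in M. (\<lambda>i. s n i x) \<longlonglongrightarrow> f n x"
    using assms unfolding strongly_measurable_def by metis
  define C where "C = insert 0 (\<Union>n i. s n i ` space M)"
  have C: "countable C" "C \<noteq> {}" 

  proof -
    have "countable (s n i ` space M)" for n i using simple_functionD(1)[OF s(1)] by (rule countable_finite)
    then show "countable C" unfolding C_def by auto
  qed (simp add: C_def)
  define c where "c = case_nat 0 (from_nat_into C)"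
  have "range c \<supseteq> C"
  proof
    fix y assume "y \<in> C"
    then obtain k where "y = from_nat_into C k" using from_nat_into_surj[OF C(1)] by metis
    then have "y = c (Suc k)" by (simp add: c_def)
    then show "y \<in> range c" by blast
  qed
  moreover have "AE x in M. \<forall>n. f n x \<in> closure C"
    unfolding AE_all_countable
  proof
    fix n
    show "AE x in M. f n x \<in> closure C"
      using s(2)[of n] AE_space
    proof eventually_elim
      case (elim x)
      then show ?case unfolding closure_sequential by (intro exI[of _ "\<lambda>i. s n i x"]) (auto simp: C_def)
    qed
  qed
  ultimately have "AE x in M. \<forall>n. f n x \<in> closure (range c)"
    using closure_mono[of C "range c"] by (auto elim!: eventually_mono)
  then show ?thesis using that[of c] by (simp add: c_def)
qed

lemma (in complete_measure) strongly_measurable_limit: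
  fixes f :: "nat \<Rightarrow> 'a \<Rightarrow> 'b::real_normed_vector"
  assumes f: "\<And>n. strongly_measurable M (f n)" and lim: "AE x in M. (\<lambda>n. f n x) \<longlonglongrightarrow> g x"
  shows "strongly_measurable M g"
proof -
  obtain c :: "nat \<Rightarrow> 'b" where c: "AE x in M. \<forall>n. f n x \<in> closure (range c)"
    using strongly_measurable_sequence_separable[of M f, OF f] by blast
  have "AE x in M. g x \<in> closure (range c)"
    using c lim by eventually_elim (rule closed_sequentially[OF closed_closure], auto)
  moreover have "(\<lambda>x. norm (g x - c j)) \<in> borel_measurable M" for j
  proof -
    have [measurable]: "(\<lambda>x. norm (f n x - c j)) \<in> borel_measurable M" for n
      using f by (rule strongly_measurable_norm_diff)
    have "(\<lambda>x. lim (\<lambda>n. norm (f n x - c j))) \<in> borel_measurable M" by (intro borel_measurable_lim_metric) auto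
    moreover have "AE x in M. lim (\<lambda>n. norm (f n x - c j)) = norm (g x - c j)"
      using lim by eventually_elim (auto intro!: limI tendsto_intros)
    ultimately show ?thesis by (rule measurable_AE_cong)
  qed
  ultimately show ?thesis by (rule strongly_measurableI_separable)
qed

text \<open>For simple \<open>f\<close> the composition is patched together from finitely many of the functions
  \<open>\<phi>(\<cdot>, y)\<close>; the general case follows by continuity in the second argument.\<close>

lemma (in complete_measure) strongly_measurable_caratheodory:
  fixes \<phi> :: "'a \<Rightarrow> 'c::real_normed_vector \<Rightarrow> 'b::real_normed_vector"
  assumes cont: "AE x in M. continuous_on UNIV (\<phi> x)"
    and meas: "\<And>y. strongly_measurable M (\<lambda>x. \<phi> x y)" and f: "strongly_measurable M f"
  shows "strongly_measurable M (\<lambda>x. \<phi> x (f x))"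
proof -
  obtain g where g: "\<And>i::nat. simple_function M (g i)" "AE x in M. (\<lambda>i. g i x) \<longlonglongrightarrow> f x"
    using f unfolding strongly_measurable_def by blast
  obtain s where s: "\<And>y (i::nat). simple_function M (s y i)" "\<And>y. AE x in M. (\<lambda>i. s y i x) \<longlonglongrightarrow> \<phi> x y"
    using meas unfolding strongly_measurable_def by metis
  have simple: "strongly_measurable M (\<lambda>x. \<phi> x (g n x))" for n
    unfolding strongly_measurable_def
  proof (intro exI conjI allI)
    show "simple_function M (\<lambda>x. s (g n x) i x)" for i
      unfolding simple_function_def
    proof (intro conjI ballI)
      have "(\<lambda>x. s (g n x) i x) ` space M \<subseteq> (\<Union>y\<in>g n ` space M. s y i ` space M)" by auto
      then show "finite ((\<lambda>x. s (g n x) i x) ` space M)"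
        by (rule finite_subset) (intro finite_UN_I simple_functionD(1) g(1) s(1))
      fix z
      have "(\<lambda>x. s (g n x) i x) -` {z} \<inter> space M
          = (\<Union>y\<in>g n ` space M. (g n -` {y} \<inter> space M) \<inter> (s y i -` {z} \<inter> space M))" by auto
      also have "\<dots> \<in> sets M"
        using g(1) s(1) by (intro sets.finite_UN sets.Int simple_functionD) auto
      finally show "(\<lambda>x. s (g n x) i x) -` {z} \<inter> space M \<in> sets M" .
    qed
    have "AE x in M. \<forall>y\<in>g n ` space M. (\<lambda>i. s y i x) \<longlonglongrightarrow> \<phi> x y"
      using s(2) simple_functionD(1)[OF g(1)] by (intro AE_finite_allI) auto
    then show "AE x in M. (\<lambda>i. s (g n x) i x) \<longlonglongrightarrow> \<phi> x (g n x)"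
      using AE_space by eventually_elim auto
  qed
  moreover have "AE x in M. (\<lambda>n. \<phi> x (g n x)) \<longlonglongrightarrow> \<phi> x (f x)"
    using g(2) cont by eventually_elim (auto simp: continuous_on_eq_continuous_at intro: isCont_tendsto_compose)
  ultimately show ?thesis by (rule strongly_measurable_limit)
qed

lemma (in complete_measure) strongly_measurable_bounded_linear:
  assumes "bounded_linear T" "strongly_measurable M f"
  shows "strongly_measurable M (\<lambda>x. T (f x))"
proof (rule strongly_measurable_caratheodory[of "\<lambda>_. T" f])
  show "AE x in M. continuous_on UNIV T" using linear_continuous_on[OF assms(1)] by simp
  show "strongly_measurable M (\<lambda>x. T y)" for y by (intro strongly_measurable_simple_function) simp
qed (rule assms(2))

lemma (in complete_measure) strongly_measurable_continuous_on:
  fixes f :: "real \<Rightarrow> 'b::real_normed_vector"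
  assumes "(\<lambda>x. r x) \<in> borel_measurable M" "r ` space M \<subseteq> S" "continuous_on S f"
  shows "strongly_measurable M (\<lambda>x. f (r x))"
proof (cases "S = {}")
  case True
  then have "space M = {}" using assms(2) by blast
  then have "AE x in M. 0 = f (r x)" by (intro AE_I2) blast
  then show ?thesis
    by (rule strongly_measurable_cong_AE[rotated]) (intro strongly_measurable_simple_function simple_function_const)
next
  case False
  obtain T where T: "countable T" "T \<subseteq> S" "S \<subseteq> closure T" using separable[of S] by blast
  then have ne: "T \<noteq> {}" using False by auto
  have "range (\<lambda>j. f (from_nat_into T j)) = f ` T"
    using range_from_nat_into[OF ne T(1)] by (metis image_image)
  moreover have "f y \<in> closure (f ` T)" if y: "y \<in> S" for y
  proof -
    obtain t where "\<forall>n. t n \<in> T" "t \<longlonglongrightarrow> y" 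
      using subsetD[OF T(3) y] unfolding closure_sequential by blast
    then have "(\<lambda>n. f (t n)) \<longlonglongrightarrow> f y"
      using T(2) y assms(3) unfolding continuous_on_sequentially comp_def by blast
    then show ?thesis unfolding closure_sequential using \<open>\<forall>n. t n \<in> T\<close> by (intro exI[of _ "\<lambda>n. f (t n)"]) auto
  qed
  ultimately have "AE x in M. f (r x) \<in> closure (range (\<lambda>j. f (from_nat_into T j)))"
    using assms(2) by (intro AE_I2) auto
  moreover have "(\<lambda>x. norm (f (r x) - y)) \<in> borel_measurable M" for y
  proof -
    have "(\<lambda>z. norm (f z - y)) \<in> borel_measurable (restrict_space borel S)"
      by (intro borel_measurable_continuous_on_restrict continuous_intros assms(3))
    moreover have "r \<in> measurable M (restrict_space borel S)"
      using assms(1,2) by (intro measurable_restrict_space2) auto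
    ultimately show ?thesis by (rule measurable_compose[rotated])
  qed
  ultimately show ?thesis by (rule strongly_measurableI_separable)
qed

section \<open>The Bochner integral in arbitrary Banach spaces\<close>

abbreviation "simple_integrable \<equiv> Bochner_Integration.simple_bochner_integrable"
abbreviation "simple_integral_of \<equiv> Bochner_Integration.simple_bochner_integral"

lemma simple_bochner_integral_norm_le_nn_integral:
  fixes s :: "'m \<Rightarrow> 'b::real_normed_vector"
  assumes "simple_integrable M s"
  shows "ennreal (norm (simple_integral_of M s)) \<le> (\<integral>\<^sup>+x. norm (s x) \<partial>M)"
proof -
  have "ennreal (norm (simple_integral_of M s))
      \<le> ennreal (simple_integral_of M (\<lambda>x. norm (s x)))"
    by (intro ennreal_leI simple_bochner_integral_norm_bound assms)
  also have "\<dots> = (\<integral>\<^sup>+x. norm (s x) \<partial>M)"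
    using simple_bochner_integrable_compose2[of "\<lambda>x y. norm x" M s s] assms
    by (intro simple_bochner_integral_eq_nn_integral) auto
  finally show ?thesis .
qed

text \<open>By linearity this estimate contains the uniqueness of the integral.\<close>

lemma has_banach_integral_norm_le:
  fixes f :: "'m \<Rightarrow> 'b::real_normed_vector"
  assumes M: "complete_measure M" and f: "has_banach_integral M f I"
  shows "ennreal (norm I) \<le> (\<integral>\<^sup>+x. norm (f x) \<partial>M)"
proof -
  interpret complete_measure M by fact
  obtain s where s: "\<And>i::nat. simple_integrable M (s i)"
    "(\<lambda>i. \<integral>\<^sup>+x. ennreal (norm (f x - s i x)) \<partial>M) \<longlonglongrightarrow> 0"
    "(\<lambda>i. simple_integral_of M (s i)) \<longlonglongrightarrow> I" and sm: "strongly_measurable M f"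
    using f unfolding has_banach_integral_def by blast
  have si: "simple_function M (s i)" for i using s(1)[of i] by (auto elim: Bochner_Integration.simple_bochner_integrable.cases)
  have [measurable]: "(\<lambda>x. norm (f x)) \<in> borel_measurable M" using sm by (rule strongly_measurable_norm)
  have [measurable]: "(\<lambda>x. norm (f x - s i x)) \<in> borel_measurable M" for i
    by (intro strongly_measurable_norm strongly_measurable_diff sm strongly_measurable_simple_function si)
  have le: "ennreal (norm (simple_integral_of M (s i)))
      \<le> (\<integral>\<^sup>+x. norm (f x) \<partial>M) + (\<integral>\<^sup>+x. norm (f x - s i x) \<partial>M)" for i
  proof -
    have "ennreal (norm (simple_integral_of M (s i))) \<le> (\<integral>\<^sup>+x. norm (s i x) \<partial>M)"
      by (rule simple_bochner_integral_norm_le_nn_integral[OF s(1)])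
    also have "\<dots> \<le> (\<integral>\<^sup>+x. ennreal (norm (f x)) + ennreal (norm (f x - s i x)) \<partial>M)"
      by (intro nn_integral_mono) (metis ennreal_leI ennreal_plus norm_ge_zero norm_triangle_sub norm_minus_commute)
    also have "\<dots> = (\<integral>\<^sup>+x. norm (f x) \<partial>M) + (\<integral>\<^sup>+x. norm (f x - s i x) \<partial>M)"
      by (rule nn_integral_add) auto
    finally show ?thesis .
  qed
  have "(\<lambda>i. ennreal (norm (simple_integral_of M (s i)))) \<longlonglongrightarrow> ennreal (norm I)"
    by (intro tendsto_ennrealI tendsto_norm s(3))
  moreover have "(\<lambda>i. (\<integral>\<^sup>+x. norm (f x) \<partial>M) + (\<integral>\<^sup>+x. norm (f x - s i x) \<partial>M)) \<longlonglongrightarrow> (\<integral>\<^sup>+x. norm (f x) \<partial>M) + 0"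
    by (intro tendsto_add tendsto_const s(2))
  ultimately have "ennreal (norm I) \<le> (\<integral>\<^sup>+x. norm (f x) \<partial>M) + 0"
    by (rule LIMSEQ_le) (use le in blast)
  then show ?thesis by simp
qed

lemma has_banach_integral_diff:
  fixes f :: "'m \<Rightarrow> 'b::real_normed_vector"
  assumes M: "complete_measure M" and f: "has_banach_integral M f I" and g: "has_banach_integral M g J"
  shows "has_banach_integral M (\<lambda>x. f x - g x) (I - J)"
proof -
  interpret complete_measure M by fact
  obtain s where s: "\<And>i::nat. simple_integrable M (s i)"
    "(\<lambda>i. \<integral>\<^sup>+x. ennreal (norm (f x - s i x)) \<partial>M) \<longlonglongrightarrow> 0"
    "(\<lambda>i. simple_integral_of M (s i)) \<longlonglongrightarrow> I" and smf: "strongly_measurable M f"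
    using f unfolding has_banach_integral_def by blast
  obtain t where t: "\<And>i::nat. simple_integrable M (t i)"
    "(\<lambda>i. \<integral>\<^sup>+x. ennreal (norm (g x - t i x)) \<partial>M) \<longlonglongrightarrow> 0"
    "(\<lambda>i. simple_integral_of M (t i)) \<longlonglongrightarrow> J" and smg: "strongly_measurable M g"
    using g unfolding has_banach_integral_def by blast
  have si: "simple_function M (s i)" "simple_function M (t i)" for i
    using s(1)[of i] t(1)[of i] by (auto elim: Bochner_Integration.simple_bochner_integrable.cases)
  have [measurable]: "(\<lambda>x. norm (f x - s i x)) \<in> borel_measurable M" "(\<lambda>x. norm (g x - t i x)) \<in> borel_measurable M" for i
    by (intro strongly_measurable_norm strongly_measurable_diff smf smg strongly_measurable_simple_function si)+
  show ?thesis unfolding has_banach_integral_def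
  proof (intro conjI strongly_measurable_diff smf smg exI allI)
    show "simple_integrable M (\<lambda>x. s i x - t i x)" for i
      using s(1) t(1) by (intro simple_bochner_integrable_compose2[where p="(-)"]) auto
    show "(\<lambda>i. simple_integral_of M (\<lambda>x. s i x - t i x)) \<longlonglongrightarrow> I - J"
      using s t by (subst simple_bochner_integral_diff) (auto intro: tendsto_diff)
    have "(\<integral>\<^sup>+x. ennreal (norm (f x - g x - (s i x - t i x))) \<partial>M)
        \<le> (\<integral>\<^sup>+x. ennreal (norm (f x - s i x)) \<partial>M) + (\<integral>\<^sup>+x. ennreal (norm (g x - t i x)) \<partial>M)" for i
    proof -
      have "norm (f x - g x - (s i x - t i x)) \<le> norm (f x - s i x) + norm (g x - t i x)" for x
        using norm_triangle_ineq4[of "f x - s i x" "g x - t i x"] by (simp add: algebra_simps)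
      then have "(\<integral>\<^sup>+x. ennreal (norm (f x - g x - (s i x - t i x))) \<partial>M)
        \<le> (\<integral>\<^sup>+x. ennreal (norm (f x - s i x)) + ennreal (norm (g x - t i x)) \<partial>M)"
        by (intro nn_integral_mono) (metis ennreal_leI ennreal_plus norm_ge_zero)
      also have "\<dots> = (\<integral>\<^sup>+x. ennreal (norm (f x - s i x)) \<partial>M) + (\<integral>\<^sup>+x. ennreal (norm (g x - t i x)) \<partial>M)"
        by (rule nn_integral_add) auto
      finally show ?thesis .
    qed
    then have le: "\<forall>\<^sub>F i in sequentially. (\<integral>\<^sup>+x. ennreal (norm (f x - g x - (s i x - t i x))) \<partial>M)
        \<le> (\<integral>\<^sup>+x. ennreal (norm (f x - s i x)) \<partial>M) + (\<integral>\<^sup>+x. ennreal (norm (g x - t i x)) \<partial>M)"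
      by (rule always_eventually[OF allI])
    have "(\<lambda>i. (\<integral>\<^sup>+x. ennreal (norm (f x - s i x)) \<partial>M) + (\<integral>\<^sup>+x. ennreal (norm (g x - t i x)) \<partial>M)) \<longlonglongrightarrow> 0"
      using tendsto_add[OF s(2) t(2)] by simp
    then show "(\<lambda>i. \<integral>\<^sup>+x. ennreal (norm (f x - g x - (s i x - t i x))) \<partial>M) \<longlonglongrightarrow> 0"
      by (rule tendsto_sandwich[OF always_eventually[OF allI[OF zero_le]] le tendsto_const])
  qed
qed

lemma has_banach_integral_zero: "has_banach_integral M (\<lambda>x. 0::'b::real_normed_vector) 0"
  unfolding has_banach_integral_def
proof (intro conjI exI allI)
  show "strongly_measurable M (\<lambda>x. 0::'b)" by (intro strongly_measurable_simple_function) auto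
  show "simple_integrable M (\<lambda>x. 0::'b)" for i :: nat
    by (intro Bochner_Integration.simple_bochner_integrable.intros) auto
  show "(\<lambda>i::nat. simple_integral_of M (\<lambda>x. 0::'b)) \<longlonglongrightarrow> 0"
    by (simp add: Bochner_Integration.simple_bochner_integral_def image_constant_conv)
qed simp

lemma has_banach_integral_unique:
  assumes "complete_measure M" "has_banach_integral M f I" "has_banach_integral M f J"
  shows "I = J"
  using has_banach_integral_norm_le[OF assms(1) has_banach_integral_diff[OF assms]] by simp

lemma banach_integral_eqI:
  assumes "complete_measure M" "has_banach_integral M f I"
  shows "banach_integral M f = I"
proof -
  have "(THE I. has_banach_integral M f I) = I"
    using assms has_banach_integral_unique by (intro the_equality) blast+
  then show ?thesis unfolding banach_integral_def banach_integrable_def using assms(2) by auto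
qed

definition norm_integrable :: "'m measure \<Rightarrow> ('m \<Rightarrow> 'b::real_normed_vector) \<Rightarrow> bool" where
  "norm_integrable M f \<longleftrightarrow> strongly_measurable M f \<and> integrable M (\<lambda>x. norm (f x))"

text \<open>Rounding to the nearest of the first members of a sequence starting with \<open>0\<close> gives approximations dominated by
  \<open>norm (f x)\<close>, so dominated convergence applies to the real functions \<open>norm (f x - s i x)\<close>.\<close>

lemma norm_integrable_has_banach_integral:
  fixes f :: "'m \<Rightarrow> 'b::banach"
  assumes M: "complete_finite_measure M" and f: "norm_integrable M f"
  shows "has_banach_integral M f (banach_integral M f)"
proof -
  interpret complete_finite_measure M by fact
  have sm: "strongly_measurable M f" and int: "integrable M (\<lambda>x. norm (f x))"
    using f by (auto simp: norm_integrable_def)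
  obtain c :: "nat \<Rightarrow> 'b" where c: "c 0 = 0" "AE x in M. f x \<in> closure (range c)"
    using strongly_measurable_sequence_separable[of M "\<lambda>_. f"] sm by auto
  define s where "s i x = c (nearest c i (f x))" for i x
  have nd: "(\<lambda>x. norm (f x - c j)) \<in> borel_measurable M" for j by (rule strongly_measurable_norm_diff[OF sm])
  have simple: "simple_function M (s i)" for i
    using simple_function_compose1[OF simple_function_nearest[of f c, OF nd]] unfolding s_def .
  have sbi: "simple_integrable M (s i)" for i
    using simple by (intro Bochner_Integration.simple_bochner_integrable.intros) (auto simp: emeasure_eq_measure)
  have [measurable]: "(\<lambda>x. norm (f x - s i x)) \<in> borel_measurable M" for i
    by (intro strongly_measurable_norm strongly_measurable_diff sm strongly_measurable_simple_function simple)
  have lim: "(\<lambda>i. \<integral>\<^sup>+x. ennreal (norm (f x - s i x)) \<partial>M) \<longlonglongrightarrow> 0"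
  proof -
    have "(\<lambda>i. \<integral>\<^sup>+x. ennreal (norm (f x - s i x)) \<partial>M) \<longlonglongrightarrow> (\<integral>\<^sup>+x. 0 \<partial>M)"
    proof (rule nn_integral_dominated_convergence[where w = "\<lambda>x. ennreal (norm (f x))"])
      show "AE x in M. ennreal (norm (f x - s i x)) \<le> ennreal (norm (f x))" for i
        using nearest(2)[of 0 i _ c] c(1) by (intro AE_I2 ennreal_leI) (simp add: s_def)
      show "(\<integral>\<^sup>+x. ennreal (norm (f x)) \<partial>M) < \<infinity>" using int by (simp add: integrable_iff_bounded)
      show "AE x in M. (\<lambda>i. ennreal (norm (f x - s i x))) \<longlonglongrightarrow> 0"
        using c(2)
      proof eventually_elim
        case (elim x)
        have "(\<lambda>i. norm (f x - s i x)) \<longlonglongrightarrow> norm (f x - f x)"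
          unfolding s_def by (intro tendsto_intros nearest_tendsto elim)
        then show ?case by (simp flip: ennreal_0)
      qed
    qed (use int in auto)
    then show ?thesis by simp
  qed
  have "Cauchy (\<lambda>i. simple_integral_of M (s i))"
  proof (rule metric_CauchyI)
    fix e :: real assume e: "0 < e"
    then have "\<forall>\<^sub>F i in sequentially. (\<integral>\<^sup>+x. ennreal (norm (f x - s i x)) \<partial>M) < ennreal (e/2)"
      using order_tendstoD(2)[OF lim, of "ennreal (e/2)"] by simp
    then obtain N where N: "\<And>i. i \<ge> N \<Longrightarrow> (\<integral>\<^sup>+x. ennreal (norm (f x - s i x)) \<partial>M) < ennreal (e/2)"
      unfolding eventually_sequentially by blast
    show "\<exists>N. \<forall>i\<ge>N. \<forall>j\<ge>N. dist (simple_integral_of M (s i)) (simple_integral_of M (s j)) < e"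
    proof (intro exI[of _ N] allI impI)
      fix i j assume ij: "N \<le> i" "N \<le> j"
      have "ennreal (norm (simple_integral_of M (s i) - simple_integral_of M (s j)))
          = ennreal (norm (simple_integral_of M (\<lambda>x. s i x - s j x)))"
        by (subst simple_bochner_integral_diff[OF sbi sbi]) auto
      also have "\<dots> \<le> (\<integral>\<^sup>+x. norm (s i x - s j x) \<partial>M)"
        by (intro simple_bochner_integral_norm_le_nn_integral simple_bochner_integrable_compose2[where p="(-)"] sbi) auto
      also have "\<dots> \<le> (\<integral>\<^sup>+x. ennreal (norm (f x - s i x)) + ennreal (norm (f x - s j x)) \<partial>M)"
      proof (intro nn_integral_mono)
        fix x
        have "norm (s i x - s j x) \<le> norm (f x - s i x) + norm (f x - s j x)"
          using norm_triangle_ineq4[of "f x - s j x" "f x - s i x"] by simp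
        then show "ennreal (norm (s i x - s j x)) \<le> ennreal (norm (f x - s i x)) + ennreal (norm (f x - s j x))"
          by (metis ennreal_leI ennreal_plus norm_ge_zero)
      qed
      also have "\<dots> = (\<integral>\<^sup>+x. ennreal (norm (f x - s i x)) \<partial>M) + (\<integral>\<^sup>+x. ennreal (norm (f x - s j x)) \<partial>M)"
        by (rule nn_integral_add) auto
      also have "\<dots> < ennreal (e/2) + ennreal (e/2)" by (intro add_strict_mono N ij)
      also have "\<dots> = ennreal e" using e by (simp flip: ennreal_plus)
      finally show "dist (simple_integral_of M (s i)) (simple_integral_of M (s j)) < e"
        using e by (simp add: dist_norm ennreal_less_iff)
    qed
  qed
  then obtain I where "(\<lambda>i. simple_integral_of M (s i)) \<longlonglongrightarrow> I"
    using convergent_eq_Cauchy by blast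
  then have I: "has_banach_integral M f I"
    unfolding has_banach_integral_def using sm sbi lim by blast
  then show ?thesis using banach_integral_eqI[OF complete_measure_axioms I] by simp
qed

lemma norm_integrable_banach_integrable:
  fixes f :: "'m \<Rightarrow> 'b::banach"
  shows "complete_finite_measure M \<Longrightarrow> norm_integrable M f \<Longrightarrow> banach_integrable M f"
  using norm_integrable_has_banach_integral unfolding banach_integrable_def by blast

lemma complete_finite_measureD: "complete_finite_measure M \<Longrightarrow> complete_measure M"
  by (simp add: complete_finite_measure_def)

lemma norm_banach_integral_le:
  fixes f :: "'m \<Rightarrow> 'b::banach"
  assumes M: "complete_finite_measure M" and f: "norm_integrable M f"
  shows "norm (banach_integral M f) \<le> (\<integral>x. norm (f x) \<partial>M)"
proof -
  have "ennreal (norm (banach_integral M f)) \<le> (\<integral>\<^sup>+x. norm (f x) \<partial>M)"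
    using norm_integrable_has_banach_integral[OF M f] complete_finite_measureD[OF M]
    by (rule has_banach_integral_norm_le[rotated])
  also have "\<dots> = ennreal (\<integral>x. norm (f x) \<partial>M)"
    using f by (intro nn_integral_eq_integral) (auto simp: norm_integrable_def)
  finally show ?thesis by (simp add: ennreal_le_iff)
qed

lemma norm_integrable_dominated:
  fixes f :: "'m \<Rightarrow> 'b::real_normed_vector"
  assumes "complete_measure M" "strongly_measurable M f" "integrable M \<phi>" "AE x in M. norm (f x) \<le> \<phi> x"
  shows "norm_integrable M f"
proof -
  interpret complete_measure M by fact
  show ?thesis unfolding norm_integrable_def using assms(2,4) strongly_measurable_norm
    by (auto intro!: Bochner_Integration.integrable_bound[OF assms(3)])
qed

lemma norm_integrable_diff:
  fixes f :: "'m \<Rightarrow> 'b::real_normed_vector"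
  assumes "complete_measure M" "norm_integrable M f" "norm_integrable M g"
  shows "norm_integrable M (\<lambda>x. f x - g x)"
  using assms unfolding norm_integrable_def
  by (intro norm_integrable_dominated[unfolded norm_integrable_def, where \<phi> = "\<lambda>x. norm (f x) + norm (g x)"])
     (auto intro: strongly_measurable_diff norm_triangle_ineq4)

lemma banach_integral_diff:
  fixes f :: "'m \<Rightarrow> 'b::banach"
  assumes "complete_finite_measure M" "norm_integrable M f" "norm_integrable M g"
  shows "banach_integral M (\<lambda>x. f x - g x) = banach_integral M f - banach_integral M g"
  using assms by (intro banach_integral_eqI has_banach_integral_diff norm_integrable_has_banach_integral complete_finite_measureD)

lemma banach_integral_diff_le:
  fixes f :: "'m \<Rightarrow> 'b::banach"
  assumes M: "complete_finite_measure M" "norm_integrable M f" "norm_integrable M g"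
    and le: "integrable M \<phi>" "AE x in M. norm (f x - g x) \<le> \<phi> x"
  shows "norm (banach_integral M f - banach_integral M g) \<le> (\<integral>x. \<phi> x \<partial>M)"
proof -
  have d: "norm_integrable M (\<lambda>x. f x - g x)" using M complete_finite_measureD by (intro norm_integrable_diff) auto
  have "norm (banach_integral M f - banach_integral M g) \<le> (\<integral>x. norm (f x - g x) \<partial>M)"
    using norm_banach_integral_le[OF M(1) d] banach_integral_diff[OF M] by simp
  also have "\<dots> \<le> (\<integral>x. \<phi> x \<partial>M)"
    using d le by (intro integral_mono_AE) (auto simp: norm_integrable_def)
  finally show ?thesis .
qed

lemma banach_integral_restrict_space:
  fixes f :: "'m \<Rightarrow> 'b::banach"
  assumes M: "complete_finite_measure M" and A: "A \<in> sets M"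
  shows "norm_integrable (restrict_space M A) f \<longleftrightarrow> norm_integrable M (\<lambda>x. indicator A x *\<^sub>R f x)"
    and "norm_integrable (restrict_space M A) f \<Longrightarrow>
      banach_integral (restrict_space M A) f = banach_integral M (\<lambda>x. indicator A x *\<^sub>R f x)"
proof -
  interpret complete_finite_measure M by fact
  interpret R: complete_finite_measure "restrict_space M A"
    using A by (rule complete_finite_measure_restrict_space)
  have eqn: "norm (indicator A x *\<^sub>R f x) = indicator A x *\<^sub>R norm (f x)" for x by (simp split: split_indicator)
  show iff: "norm_integrable (restrict_space M A) f \<longleftrightarrow> norm_integrable M (\<lambda>x. indicator A x *\<^sub>R f x)"
  proof -
    have "strongly_measurable (restrict_space M A) f \<longleftrightarrow> strongly_measurable M (\<lambda>x. indicator A x *\<^sub>R f x)"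
    proof
      assume "strongly_measurable M (\<lambda>x. indicator A x *\<^sub>R f x)"
      then have "strongly_measurable (restrict_space M A) (\<lambda>x. indicator A x *\<^sub>R f x)"
        using A by (rule strongly_measurable_restrict_spaceI)
      then show "strongly_measurable (restrict_space M A) f"
        by (rule strongly_measurable_cong_AE) (use A in \<open>auto intro!: AE_I2\<close>)
    qed (rule strongly_measurable_restrict_spaceD[OF _ A])
    then show ?thesis unfolding norm_integrable_def eqn using A by (subst integrable_restrict_space) auto
  qed
  assume f: "norm_integrable (restrict_space M A) f"
  obtain s where s: "\<And>i::nat. simple_integrable (restrict_space M A) (s i)"
    "(\<lambda>i. \<integral>\<^sup>+x. ennreal (norm (f x - s i x)) \<partial>restrict_space M A) \<longlonglongrightarrow> 0"
    "(\<lambda>i. simple_integral_of (restrict_space M A) (s i)) \<longlonglongrightarrow> banach_integral (restrict_space M A) f"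
    using norm_integrable_has_banach_integral[OF R.complete_finite_measure_axioms f] unfolding has_banach_integral_def by blast
  have I: "has_banach_integral M (\<lambda>x. indicator A x *\<^sub>R f x) (banach_integral (restrict_space M A) f)"
    unfolding has_banach_integral_def
  proof (intro conjI exI allI)
    show "strongly_measurable M (\<lambda>x. indicator A x *\<^sub>R f x)" using f iff unfolding norm_integrable_def by blast
    show "simple_integrable M (\<lambda>x. indicator A x *\<^sub>R s i x)" for i
      using s(1)[of i] A by (subst (asm) simple_bochner_integrable_restrict_space) auto
    have "(\<integral>\<^sup>+x. ennreal (norm (indicator A x *\<^sub>R f x - indicator A x *\<^sub>R s i x)) \<partial>M)
        = (\<integral>\<^sup>+x. ennreal (norm (f x - s i x)) \<partial>restrict_space M A)" for i
      using A by (subst nn_integral_restrict_space) (auto intro!: nn_integral_cong split: split_indicator)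
    then show "(\<lambda>i. \<integral>\<^sup>+x. ennreal (norm (indicator A x *\<^sub>R f x - indicator A x *\<^sub>R s i x)) \<partial>M) \<longlonglongrightarrow> 0"
      using s(2) by simp
    have "simple_integral_of M (\<lambda>x. indicator A x *\<^sub>R s i x)
       = simple_integral_of (restrict_space M A) (s i)" for i
      using s(1)[of i] A by (subst simple_bochner_integral_restrict_space) auto
    then show "(\<lambda>i. simple_integral_of M (\<lambda>x. indicator A x *\<^sub>R s i x))
        \<longlonglongrightarrow> banach_integral (restrict_space M A) f" using s(3) by simp
  qed
  show "banach_integral (restrict_space M A) f = banach_integral M (\<lambda>x. indicator A x *\<^sub>R f x)"
    using banach_integral_eqI[OF complete_measure_axioms I] by simp
qed

lemma simple_function_norm_integrable:
  fixes f :: "'m \<Rightarrow> 'b::real_normed_vector"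
  assumes M: "complete_finite_measure M" and f: "simple_function M f"
  shows "norm_integrable M f"
proof -
  interpret complete_finite_measure M by fact
  have "bounded (f ` space M)" using f by (intro finite_imp_bounded simple_functionD(1))
  then obtain B where "\<And>x. x \<in> space M \<Longrightarrow> norm (f x) \<le> B"
    unfolding bounded_iff by blast
  then have "AE x in M. norm (f x) \<le> B" by (intro AE_I2)
  then show ?thesis using f
    by (intro norm_integrable_dominated[where \<phi> = "\<lambda>_. B"] complete_measure_axioms strongly_measurable_simple_function) auto
qed

text \<open>The integral is the sum of the values weighted by the masses of the level sets, and these
  masses add up to the total mass.\<close>

lemma banach_integral_simple_mem_convex_hull:
  fixes f :: "'m \<Rightarrow> 'b::banach"
  assumes M: "complete_finite_measure M" and f: "simple_function M f" "f ` space M \<subseteq> P" "P \<noteq> {}"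
  shows "banach_integral M f \<in> (\<lambda>x. measure M (space M) *\<^sub>R x) ` (convex hull P)"
proof -
  interpret complete_finite_measure M by fact
  let ?\<mu> = "measure M (space M)" and ?m = "\<lambda>y. measure M {x \<in> space M. f x = y}"
  have sbi: "simple_integrable M f"
    using f by (intro Bochner_Integration.simple_bochner_integrable.intros) (auto simp: emeasure_eq_measure)
  have I: "has_banach_integral M f (simple_integral_of M f)"
    unfolding has_banach_integral_def using sbi strongly_measurable_simple_function[OF f(1)]
    by (intro conjI exI[of _ "\<lambda>_. f"]) auto
  have eq: "banach_integral M f = (\<Sum>y\<in>f ` space M. ?m y *\<^sub>R y)"
    using banach_integral_eqI[OF complete_measure_axioms I] unfolding Bochner_Integration.simple_bochner_integral_def .
  have fin: "finite (f ` space M)" using f(1) by (rule simple_functionD)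
  have meas: "{x \<in> space M. f x = y} \<in> sets M" for y
  proof -
    have "{x \<in> space M. f x = y} = f -` {y} \<inter> space M" by auto
    then show ?thesis using simple_functionD(2)[OF f(1), of "{y}"] by simp
  qed
  have sum: "(\<Sum>y\<in>f ` space M. ?m y) = ?\<mu>"
  proof -
    have "?\<mu> = measure M (\<Union>y\<in>f ` space M. {x \<in> space M. f x = y})" by (intro arg_cong[where f = "measure M"]) auto
    also have "\<dots> = (\<Sum>y\<in>f ` space M. ?m y)"
      using fin meas by (intro finite_measure_finite_Union) (auto simp: disjoint_family_on_def)
    finally show ?thesis by simp
  qed
  show ?thesis
  proof (cases "?\<mu> = 0")
    case True
    then have "?m y = 0" for y using bounded_measure[of "{x \<in> space M. f x = y}"] by (simp add: measure_le_0_iff)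
    moreover obtain p where "p \<in> convex hull P" using f(3) by (metis ex_in_conv hull_inc)
    ultimately show ?thesis using True eq by (intro image_eqI[of _ _ p]) auto
  next
    case False
    then have pos: "?\<mu> > 0" by (simp add: zero_less_measure_iff measure_nonneg less_le)
    have "(\<Sum>y\<in>f ` space M. (?m y / ?\<mu>) *\<^sub>R y) \<in> convex hull P"
    proof (rule convex_sum[OF fin convex_convex_hull])
      show "(\<Sum>y\<in>f ` space M. ?m y / ?\<mu>) = 1" using sum pos by (simp flip: sum_divide_distrib)
      show "\<And>y. y \<in> f ` space M \<Longrightarrow> y \<in> convex hull P" using f(2) by (auto intro: hull_inc)
    qed simp
    moreover have "banach_integral M f = ?\<mu> *\<^sub>R (\<Sum>y\<in>f ` space M. (?m y / ?\<mu>) *\<^sub>R y)"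
      using pos by (simp add: eq scaleR_sum_right)
    ultimately show ?thesis by blast
  qed
qed

section \<open>Integrals of countable families\<close>

text \<open>Domination by an integrable function up to sets that contribute little to all integrals. Bounded
  sequences of square integrable controls have this property without having an integrable majorant.\<close>

definition nearly_dominated :: "'m measure \<Rightarrow> (nat \<Rightarrow> 'm \<Rightarrow> 'b::real_normed_vector) \<Rightarrow> bool" where
  "nearly_dominated M f \<longleftrightarrow> (\<forall>\<epsilon>>0. \<exists>A\<in>sets M. \<exists>\<phi>. integrable M \<phi> \<and>
     (\<forall>n. AE x in M. x \<in> A \<longrightarrow> norm (f n x) \<le> \<phi> x) \<and>
     (\<forall>n. (\<integral>x. indicator (space M - A) x * norm (f n x) \<partial>M) \<le> \<epsilon>))"

lemma nearly_dominatedI_dominated: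
  assumes "integrable M \<phi>" "\<And>n. AE x in M. norm (f n x) \<le> \<phi> x"
  shows "nearly_dominated M f"
  unfolding nearly_dominated_def
  using assms by (intro allI impI bexI[of _ "space M"] exI[of _ \<phi>]) auto

text \<open>Each ball of the net that contains some \<open>y n\<close> also has a member of the sequence near that point,
  hence within \<open>r + e\<close> of its centre; finitely many members thus serve all \<open>y n\<close> at the price of a second
  radius.\<close>

lemma nearest_uniformly_close:
  fixes c :: "nat \<Rightarrow> 'b::real_normed_vector"
  assumes Y: "\<And>n::nat. y n \<in> closure (range c)" and net: "finite_net r (range y)" and e: "0 < e"
  shows "\<exists>i. \<forall>n. norm (y n - c (nearest c i (y n))) \<le> 2 * r + e"
proof -
  obtain F where F: "finite F" "\<And>n. \<exists>x\<in>F. norm (y n - x) \<le> r"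
    using net unfolding finite_net_def by auto
  have "\<exists>j. (\<exists>n. norm (y n - x) \<le> r) \<longrightarrow> norm (x - c j) \<le> r + e" for x
  proof (cases "\<exists>n. norm (y n - x) \<le> r")
    case True
    then obtain n where n: "norm (y n - x) \<le> r" by blast
    obtain j where "norm (y n - c j) < e"
      using Y[of n] e unfolding closure_approachable by (auto simp: dist_norm norm_minus_commute)
    then have "norm (x - c j) \<le> r + e"
      using norm_triangle_ineq[of "x - y n" "y n - c j"] n by (simp add: norm_minus_commute)
    then show ?thesis by blast
  qed auto
  then obtain j where j: "\<And>x n. norm (y n - x) \<le> r \<Longrightarrow> norm (x - c (j x)) \<le> r + e" by metis
  have "norm (y n - c (nearest c (\<Sum>x\<in>F. j x) (y n))) \<le> 2 * r + e" for n
  proof -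
    obtain x where x: "x \<in> F" "norm (y n - x) \<le> r" using F(2) by blast
    have "norm (y n - c (nearest c (\<Sum>x\<in>F. j x) (y n))) \<le> norm (y n - c (j x))"
      by (rule nearest(2)) (use F(1) x(1) in \<open>auto intro: member_le_sum\<close>)
    also have "\<dots> \<le> norm (y n - x) + norm (x - c (j x))"
      using norm_triangle_ineq[of "y n - x" "x - c (j x)"] by simp
    also have "\<dots> \<le> 2 * r + e" using x(2) j[OF x(2)] by simp
    finally show ?thesis .
  qed
  then show ?thesis by blast
qed

text \<open>On the set with a majorant, the worst rounding error \<open>e i x = sup\<^sub>n norm (f n x - c (nearest c i (f n x)))\<close> decreases with \<open>i\<close>, and its limit is
  at most \<open>2 \<psi> x\<close>. Monotone convergence turns this into a statement about integrals. Elsewhere the approximations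
  are \<open>0\<close>.\<close>

theorem finite_valued_approximation:
  fixes f :: "nat \<Rightarrow> 'm \<Rightarrow> 'b::banach"
  assumes M: "complete_finite_measure M" and f: "\<And>n. norm_integrable M (f n)" and nd: "nearly_dominated M f"
    and \<psi>: "integrable M \<psi>" "AE x in M. 0 \<le> \<psi> x"
    and net: "AE x in M. \<forall>r>\<psi> x. finite_net r (range (\<lambda>n. f n x))" and \<epsilon>: "0 < \<epsilon>"
  obtains P g where "finite P" "P \<noteq> {}" "\<And>n. simple_function M (g n)" "\<And>n. g n ` space M \<subseteq> P"
    "\<And>n. (\<integral>x. norm (f n x - g n x) \<partial>M) \<le> 2 * (\<integral>x. \<psi> x \<partial>M) + \<epsilon>"
proof -
  interpret complete_finite_measure M by fact
  have sm: "strongly_measurable M (f n)" for n using f by (auto simp: norm_integrable_def)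
  obtain A \<phi> where A[measurable]: "A \<in> sets M" and \<phi>: "integrable M \<phi>"
      "\<And>n. AE x in M. x \<in> A \<longrightarrow> norm (f n x) \<le> \<phi> x"
      "\<And>n. (\<integral>x. indicator (space M - A) x * norm (f n x) \<partial>M) \<le> \<epsilon>/2"
    using nd[unfolded nearly_dominated_def, rule_format, of "\<epsilon>/2"] \<epsilon> by auto
  obtain c :: "nat \<Rightarrow> 'b" where c: "c 0 = 0" "AE x in M. \<forall>n. f n x \<in> closure (range c)"
    using strongly_measurable_sequence_separable[of M f] sm by auto
  define s where "s i n x = c (nearest c i (f n x))" for i n x
  have simple: "simple_function M (s i n)" for i n
    unfolding s_def by (intro simple_function_compose1[OF simple_function_nearest] strongly_measurable_norm_diff sm)
  define d where "d i n x = indicator A x * norm (f n x - s i n x)" for i n x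
  have [measurable]: "(\<lambda>x. norm (f n x - s i n x)) \<in> borel_measurable M" for i n
    by (intro strongly_measurable_norm strongly_measurable_diff sm strongly_measurable_simple_function simple)
  have d_nonneg: "0 \<le> d i n x" for i n x by (simp add: d_def)
  have d_meas[measurable]: "d i n \<in> borel_measurable M" for i n unfolding d_def by measurable
  define e where "e i x = (SUP n. ennreal (d i n x))" for i x
  have e_meas[measurable]: "e i \<in> borel_measurable M" for i unfolding e_def by measurable
  have s_le: "norm (f n x - s i n x) \<le> norm (f n x)" for i n x
    using nearest(2)[of 0 i "f n x" c] c(1) by (simp add: s_def)
  have dec: "e (Suc i) x \<le> e i x" for i x
    unfolding e_def
  proof (intro SUP_mono bexI UNIV_I ennreal_leI)
    fix n
    have "nearest c i (f n x) \<le> Suc i" using nearest(1)[of c i "f n x"] by simp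
    from nearest(2)[OF this] show "d (Suc i) n x \<le> d i n x"
      unfolding d_def s_def by (intro mult_left_mono) auto
  qed
  \<comment> \<open>At index \<open>0\<close> everything is rounded to \<open>c 0 = 0\<close>, so \<open>e 0\<close> is bounded by the majorant.\<close>
  have "AE x in M. \<forall>n. x \<in> A \<longrightarrow> norm (f n x) \<le> \<phi> x" unfolding AE_all_countable using \<phi>(2) by blast
  then have e0: "AE x in M. e 0 x \<le> ennreal (norm (\<phi> x))"
  proof eventually_elim
    case (elim x)
    have "d 0 n x \<le> norm (\<phi> x)" for n
      using elim[rule_format, of n] s_le[of n x 0] by (auto simp: d_def split: split_indicator)
    then show ?case unfolding e_def by (intro SUP_least ennreal_leI)
  qed
  have fin: "(\<integral>\<^sup>+x. e 0 x \<partial>M) < \<infinity>"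
  proof -
    have "(\<integral>\<^sup>+x. e 0 x \<partial>M) \<le> (\<integral>\<^sup>+x. ennreal (norm (\<phi> x)) \<partial>M)" using e0 by (rule nn_integral_mono_AE)
    also have "\<dots> < \<infinity>" using \<phi>(1) by (simp add: integrable_iff_bounded)
    finally show ?thesis .
  qed
  have lim: "AE x in M. (INF i. e i x) \<le> ennreal (2 * \<psi> x)"
    using c(2) net \<psi>(2)
  proof eventually_elim
    case (elim x)
    show ?case
    proof (rule ennreal_le_epsilon)
      fix \<eta> :: real assume \<eta>: "0 < \<eta>"
      obtain i where i: "\<And>n. norm (f n x - c (nearest c i (f n x))) \<le> 2 * (\<psi> x + \<eta>/4) + \<eta>/2"
        using nearest_uniformly_close[of "\<lambda>n. f n x" c "\<psi> x + \<eta>/4" "\<eta>/2"] elim \<eta> by auto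
      have "d i n x \<le> 2 * \<psi> x + \<eta>" for n
        using i[of n] elim(3) \<eta> by (auto simp: d_def s_def algebra_simps split: split_indicator)
      then have "e i x \<le> ennreal (2 * \<psi> x + \<eta>)" unfolding e_def by (intro SUP_least ennreal_leI)
      also have "\<dots> = ennreal (2 * \<psi> x) + ennreal \<eta>" using elim(3) \<eta> by (intro ennreal_plus) auto
      finally show "(INF i. e i x) \<le> ennreal (2 * \<psi> x) + ennreal \<eta>" by (rule INF_lower2[OF UNIV_I])
    qed
  qed
  have \<psi>0: "0 \<le> (\<integral>x. \<psi> x \<partial>M)" using \<psi>(2) by (rule integral_nonneg_AE)
  have "(INF i. \<integral>\<^sup>+x. e i x \<partial>M) = (\<integral>\<^sup>+x. (INF i. e i x) \<partial>M)"
    using dec fin by (intro nn_integral_monotone_convergence_INF_AE'[symmetric]) auto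
  also have "\<dots> \<le> (\<integral>\<^sup>+x. ennreal (2 * \<psi> x) \<partial>M)" using lim by (rule nn_integral_mono_AE)
  also have "\<dots> = ennreal (2 * (\<integral>x. \<psi> x \<partial>M))"
    using \<psi> by (subst nn_integral_eq_integral) auto
  also have "\<dots> < ennreal (2 * (\<integral>x. \<psi> x \<partial>M) + \<epsilon>/2)" using \<psi>0 \<epsilon> by (intro ennreal_lessI) auto
  finally obtain i where i: "(\<integral>\<^sup>+x. e i x \<partial>M) < ennreal (2 * (\<integral>x. \<psi> x \<partial>M) + \<epsilon>/2)"
    unfolding INF_less_iff by blast
  define g where "g n x = indicator A x *\<^sub>R s i n x" for n x
  show ?thesis
  proof (rule that[of "insert 0 (c ` {..i})" g])
    show "simple_function M (g n)" for n
      unfolding g_def by (rule simple_function_compose2[OF simple_function_indicator[OF A] simple])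
    show "g n ` space M \<subseteq> insert 0 (c ` {..i})" for n
      using nearest(1)[of c i] by (auto simp: g_def s_def split: split_indicator)
    fix n
    have fint: "integrable M (\<lambda>x. norm (f n x))" using f by (auto simp: norm_integrable_def)
    have dint: "integrable M (d i n)"
      using s_le by (intro Bochner_Integration.integrable_bound[OF fint d_meas] AE_I2) (auto simp: d_def split: split_indicator)
    have "ennreal (\<integral>x. d i n x \<partial>M) = (\<integral>\<^sup>+x. ennreal (d i n x) \<partial>M)"
      by (intro nn_integral_eq_integral[symmetric] dint) (auto simp: d_def)
    also have "\<dots> \<le> (\<integral>\<^sup>+x. e i x \<partial>M)" by (intro nn_integral_mono) (auto simp: e_def intro: SUP_upper)
    also note i
    finally have 1: "(\<integral>x. d i n x \<partial>M) < 2 * (\<integral>x. \<psi> x \<partial>M) + \<epsilon>/2"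
      using ennreal_less_iff[OF Bochner_Integration.integral_nonneg[of M "d i n", OF d_nonneg]] by blast
    have oint: "integrable M (\<lambda>x. indicator (space M - A) x * norm (f n x))"
      using integrable_mult_indicator[OF _ fint, of "space M - A"] by simp
    have "(\<integral>x. norm (f n x - g n x) \<partial>M) = (\<integral>x. d i n x + indicator (space M - A) x * norm (f n x) \<partial>M)"
      by (intro Bochner_Integration.integral_cong) (auto simp: g_def d_def split: split_indicator)
    also have "\<dots> = (\<integral>x. d i n x \<partial>M) + (\<integral>x. indicator (space M - A) x * norm (f n x) \<partial>M)"
      by (rule Bochner_Integration.integral_add[OF dint oint])
    also have "\<dots> \<le> 2 * (\<integral>x. \<psi> x \<partial>M) + \<epsilon>" using 1 \<phi>(3)[of n] by simp
    finally show "(\<integral>x. norm (f n x - g n x) \<partial>M) \<le> 2 * (\<integral>x. \<psi> x \<partial>M) + \<epsilon>" .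
  qed auto
qed

text \<open>The finitely valued approximations have integrals in a fixed multiple of the convex hull of a
  finite set, which is compact.\<close>

theorem finite_net_banach_integrals:
  fixes f :: "nat \<Rightarrow> 'm \<Rightarrow> 'b::banach"
  assumes M: "complete_finite_measure M" and f: "\<And>n. norm_integrable M (f n)" and nd: "nearly_dominated M f"
    and \<psi>: "integrable M \<psi>" "AE x in M. 0 \<le> \<psi> x"
    and net: "AE x in M. \<forall>r>\<psi> x. finite_net r (range (\<lambda>n. f n x))" and \<epsilon>: "0 < \<epsilon>"
  shows "finite_net (2 * (\<integral>x. \<psi> x \<partial>M) + \<epsilon>) (range (\<lambda>n. banach_integral M (f n)))"
proof -
  interpret complete_finite_measure M by fact
  from \<epsilon> have \<epsilon>2: "0 < \<epsilon>/2" by simp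
  obtain P g where P: "finite P" "P \<noteq> {}" and g: "\<And>n. simple_function M (g n)" "\<And>n. g n ` space M \<subseteq> P"
    "\<And>n. (\<integral>x. norm (f n x - g n x) \<partial>M) \<le> 2 * (\<integral>x. \<psi> x \<partial>M) + \<epsilon>/2"
    by (rule finite_valued_approximation[OF M f nd \<psi> net \<epsilon>2]) blast
  have gi: "norm_integrable M (g n)" for n using g(1) by (rule simple_function_norm_integrable[OF M])
  have "compact ((\<lambda>x. measure M (space M) *\<^sub>R x) ` (convex hull P))"
    using P(1) by (intro compact_continuous_image continuous_intros finite_imp_compact_convex_hull)
  then have "finite_net (\<epsilon>/2) (range (\<lambda>n. banach_integral M (g n)))"
    by (rule compact_imp_finite_net) (use banach_integral_simple_mem_convex_hull[OF M g(1,2) P(2)] \<epsilon> in auto)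
  moreover have "norm (banach_integral M (f n) - banach_integral M (g n)) \<le> 2 * (\<integral>x. \<psi> x \<partial>M) + \<epsilon>/2" for n
  proof -
    have "integrable M (\<lambda>x. norm (f n x - g n x))"
      using norm_integrable_diff[OF complete_measure_axioms f gi] by (auto simp: norm_integrable_def)
    from banach_integral_diff_le[OF M f gi this] g(3)[of n] show ?thesis by (meson AE_I2 order_refl order_trans)
  qed
  ultimately have "finite_net (\<epsilon>/2 + (2 * (\<integral>x. \<psi> x \<partial>M) + \<epsilon>/2)) (range (\<lambda>n. banach_integral M (f n)))"
    by (rule finite_net_perturb)
  then show ?thesis by (simp add: algebra_simps)
qed


section \<open>Integrals with an operator kernel and variable domain\<close>

text \<open>Equicontinuity with respect to the pseudometric \<open>\<bar>p t - p t'\<bar>\<close>; jumps are allowed where \<open>p\<close> jumps.\<close>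

definition equicontrolled :: "real \<Rightarrow> (real \<Rightarrow> real) \<Rightarrow> (real \<Rightarrow> 'b::real_normed_vector) set \<Rightarrow> bool" where
  "equicontrolled a p F \<longleftrightarrow> (\<forall>e>0. \<exists>\<eta>>0. \<forall>f\<in>F. \<forall>t\<in>{0..a}. \<forall>t'\<in>{0..a}.
     \<bar>p t - p t'\<bar> < \<eta> \<longrightarrow> norm (f t - f t') \<le> e)"

text \<open>Covers both integrals of the mild solution formula: \<open>E t = {0..t}\<close> with Lebesgue measure
  and \<open>E t = {0..<t}\<close> with the Lebesgue--Stieltjes measure. The function \<open>p\<close> measures the growth of the domains and the
  passing of time simultaneously.\<close>

locale volterra_kernel =
  fixes a :: real and M :: "real measure" and E :: "real \<Rightarrow> real set"
    and K :: "real \<Rightarrow> real \<Rightarrow> 'x::banach \<Rightarrow>\<^sub>L 'x" and L :: real and p :: "real \<Rightarrow> real"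
  assumes cfm: "complete_finite_measure M" and ident: "(\<lambda>x. x) \<in> borel_measurable M"
    and E: "\<And>t. t \<in> {0..a} \<Longrightarrow> E t \<in> sets M" "\<And>t. t \<in> {0..a} \<Longrightarrow> E t \<subseteq> {0..t}"
      "\<And>t t'. 0 \<le> t \<Longrightarrow> t \<le> t' \<Longrightarrow> t' \<le> a \<Longrightarrow> E t \<subseteq> E t'"
    and p: "\<And>t t'. 0 \<le> t \<Longrightarrow> t \<le> t' \<Longrightarrow> t' \<le> a \<Longrightarrow> measure M (E t' - E t) \<le> p t' - p t"
      "\<And>t t'. 0 \<le> t \<Longrightarrow> t \<le> t' \<Longrightarrow> t' \<le> a \<Longrightarrow> t' - t \<le> p t' - p t"
    and K: "\<And>x. continuous_on {(t, s). 0 \<le> s \<and> s \<le> t \<and> t \<le> a} (\<lambda>(t, s). K t s x)"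
      "\<And>t s. 0 \<le> s \<Longrightarrow> s \<le> t \<Longrightarrow> t \<le> a \<Longrightarrow> norm (K t s) \<le> L" and L: "0 < L"
begin

sublocale complete_finite_measure M by (rule cfm)

abbreviation Mt :: "real \<Rightarrow> real measure" where "Mt t \<equiv> restrict_space M (E t)"

definition volterra :: "real \<Rightarrow> (real \<Rightarrow> 'x) \<Rightarrow> 'x" where
  "volterra t f = banach_integral (Mt t) (\<lambda>s. K t s (f s))"

lemma cfm_Mt: "t \<in> {0..a} \<Longrightarrow> complete_finite_measure (Mt t)"
  using E(1) by (rule complete_finite_measure_restrict_space)

lemma norm_K_le: "t \<in> {0..a} \<Longrightarrow> s \<in> E t \<Longrightarrow> norm (K t s x) \<le> L * norm x"
  using E(2)[of t] K(2)[of s t] by (intro order_trans[OF norm_blinfun] mult_right_mono) auto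

lemma strongly_measurable_K:
  assumes t: "t \<in> {0..a}" and f: "strongly_measurable M f"
  shows "strongly_measurable (Mt t) (\<lambda>s. K t s (f s))"
proof -
  interpret T: complete_finite_measure "Mt t" using t by (rule cfm_Mt)
  show ?thesis
  proof (rule T.strongly_measurable_caratheodory[where \<phi> = "\<lambda>s. blinfun_apply (K t s)"])
    show "AE s in Mt t. continuous_on UNIV (blinfun_apply (K t s))"
      by (intro AE_I2 linear_continuous_on blinfun.bounded_linear_right)
    fix y
    have "continuous_on {0..t} (\<lambda>s. (\<lambda>(t, s). K t s y) (t, s))"
      using t by (intro continuous_on_compose2[OF K(1)] continuous_intros) auto
    then show "strongly_measurable (Mt t) (\<lambda>s. K t s y)"
      using t E[of t] by (intro T.strongly_measurable_continuous_on[where S = "{0..t}"])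
        (auto intro: measurable_restrict_space1 ident)
  next
    show "strongly_measurable (Mt t) f" using f E(1)[OF t] by (rule strongly_measurable_restrict_spaceI)
  qed
qed

lemma integrable_restrict_norm:
  fixes \<phi> :: "real \<Rightarrow> real"
  assumes t: "t \<in> {0..a}" and \<phi>: "integrable M \<phi>"
  shows "integrable (Mt t) \<phi>"
  using \<phi> E(1)[OF t] by (subst integrable_restrict_space) (auto intro: integrable_mult_indicator[where 'b = real, simplified])

lemma integral_restrict_le:
  fixes \<phi> :: "real \<Rightarrow> real"
  assumes t: "t \<in> {0..a}" and \<phi>: "integrable M \<phi>" "AE s in M. 0 \<le> \<phi> s"
  shows "(\<integral>s. \<phi> s \<partial>Mt t) \<le> (\<integral>s. \<phi> s \<partial>M)"
proof -
  have "(\<integral>s. \<phi> s \<partial>Mt t) = (\<integral>s. indicator (E t) s *\<^sub>R \<phi> s \<partial>M)"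
    using E(1)[OF t] by (intro integral_restrict_space) auto
  also have "\<dots> \<le> (\<integral>s. \<phi> s \<partial>M)"
    using \<phi> E(1)[OF t] by (intro integral_mono_AE integrable_mult_indicator) (auto elim!: eventually_mono split: split_indicator)
  finally show ?thesis .
qed

lemma AE_Mt: "t \<in> {0..a} \<Longrightarrow> AE s in M. P s \<Longrightarrow> AE s in Mt t. s \<in> E t \<and> P s"
  using E(1)[of t] by (subst AE_restrict_space_iff) auto

lemma norm_integrable_K:
  assumes t: "t \<in> {0..a}" and f: "norm_integrable M f"
  shows "norm_integrable (Mt t) (\<lambda>s. K t s (f s))"
proof (rule norm_integrable_dominated)
  show "complete_measure (Mt t)" using cfm_Mt[OF t] by (rule complete_finite_measureD)
  show "strongly_measurable (Mt t) (\<lambda>s. K t s (f s))"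
    using f by (intro strongly_measurable_K t) (auto simp: norm_integrable_def)
  show "integrable (Mt t) (\<lambda>s. L * norm (f s))"
    using f by (intro integrable_restrict_norm t) (auto simp: norm_integrable_def)
  show "AE s in Mt t. norm (K t s (f s)) \<le> L * norm (f s)"
    using AE_Mt[OF t, of "\<lambda>_. True"] by (auto elim!: eventually_mono intro: norm_K_le t)
qed

lemma volterra_integrable: "t \<in> {0..a} \<Longrightarrow> norm_integrable M f \<Longrightarrow> banach_integrable (Mt t) (\<lambda>s. K t s (f s))"
  by (intro norm_integrable_banach_integrable cfm_Mt norm_integrable_K)

lemma volterra_diff_le:
  assumes t: "t \<in> {0..a}" and f: "norm_integrable M f" "norm_integrable M g"
  shows "norm (volterra t f - volterra t g) \<le> L * (\<integral>s. norm (f s - g s) \<partial>M)"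
proof -
  have d: "integrable M (\<lambda>s. norm (f s - g s))"
    using norm_integrable_diff[OF complete_measure_axioms f] by (simp add: norm_integrable_def)
  have "norm (volterra t f - volterra t g) \<le> (\<integral>s. L * norm (f s - g s) \<partial>Mt t)"
    unfolding volterra_def
  proof (rule banach_integral_diff_le[OF cfm_Mt[OF t] norm_integrable_K[OF t f(1)] norm_integrable_K[OF t f(2)]])
    show "integrable (Mt t) (\<lambda>s. L * norm (f s - g s))" using d by (intro integrable_restrict_norm t) auto
    show "AE s in Mt t. norm (K t s (f s) - K t s (g s)) \<le> L * norm (f s - g s)"
      using AE_Mt[OF t, of "\<lambda>_. True"]
      by (auto elim!: eventually_mono intro: norm_K_le t simp flip: blinfun.diff_right)
  qed
  also have "\<dots> \<le> (\<integral>s. L * norm (f s - g s) \<partial>M)" using d L by (intro integral_restrict_le t) auto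
  finally show ?thesis by simp
qed

lemma volterra_zero: "volterra t (\<lambda>_. 0) = 0" if "t \<in> {0..a}"
  unfolding volterra_def using banach_integral_eqI[OF complete_finite_measureD[OF cfm_Mt[OF that]] has_banach_integral_zero]
  by (simp add: blinfun.zero_right)

lemma norm_volterra_le:
  assumes t: "t \<in> {0..a}" and f: "norm_integrable M f"
  shows "norm (volterra t f) \<le> L * (\<integral>s. norm (f s) \<partial>M)"
proof -
  have "norm_integrable M (\<lambda>_. 0 :: 'x)" using cfm by (rule simple_function_norm_integrable) simp
  from volterra_diff_le[OF t f this] show ?thesis using volterra_zero[OF t] by simp
qed

lemma volterra_finite_net:
  assumes t: "t \<in> {0..a}" and f: "\<And>n. norm_integrable M (f n)" "nearly_dominated M f"
    and \<psi>: "integrable M \<psi>" "AE s in M. 0 \<le> \<psi> s"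
    and net: "AE s in M. \<forall>r>\<psi> s. finite_net r (range (\<lambda>n. f n s))" and e: "0 < e"
  shows "finite_net (2 * L * (\<integral>s. \<psi> s \<partial>M) + e) (range (\<lambda>n. volterra t (f n)))"
proof -
  have "nearly_dominated (Mt t) (\<lambda>n s. K t s (f n s))"
    unfolding nearly_dominated_def
  proof (intro allI impI)
    fix \<epsilon> :: real assume \<epsilon>: "0 < \<epsilon>"
    then have "0 < \<epsilon> / L" using L by simp
    then obtain A \<phi> where A: "A \<in> sets M" and \<phi>: "integrable M \<phi>"
      "\<And>n. AE x in M. x \<in> A \<longrightarrow> norm (f n x) \<le> \<phi> x"
      "\<And>n. (\<integral>x. indicator (space M - A) x * norm (f n x) \<partial>M) \<le> \<epsilon> / L"
      using f(2)[unfolded nearly_dominated_def, rule_format, OF \<open>0 < \<epsilon> / L\<close>] by auto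
    show "\<exists>A\<in>sets (Mt t). \<exists>\<phi>. integrable (Mt t) \<phi> \<and>
     (\<forall>n. AE x in Mt t. x \<in> A \<longrightarrow> norm (K t x (f n x)) \<le> \<phi> x) \<and>
     (\<forall>n. (\<integral>x. indicator (space (Mt t) - A) x * norm (K t x (f n x)) \<partial>Mt t) \<le> \<epsilon>)"
    proof (intro bexI exI conjI allI)
      show "E t \<inter> A \<in> sets (Mt t)" using A E(1)[OF t] by (auto simp: sets_restrict_space_iff)
      show "integrable (Mt t) (\<lambda>s. L * \<phi> s)" using \<phi> by (intro integrable_restrict_norm t) auto
      show "AE x in Mt t. x \<in> E t \<inter> A \<longrightarrow> norm (K t x (f n x)) \<le> L * \<phi> x" for n
        using AE_Mt[OF t \<phi>(2)[of n]]
      proof eventually_elim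
        case (elim x)
        then show ?case using norm_K_le[OF t, of x "f n x"] L by (auto intro: order_trans mult_left_mono)
      qed
      fix n
      have i1: "integrable M (\<lambda>x. indicator (space M - A) x * norm (f n x))"
        using f(1)[of n] A integrable_mult_indicator[of "space M - A" M "\<lambda>x. norm (f n x)"] by (simp add: norm_integrable_def sets.Diff)
      have "(\<integral>x. indicator (space (Mt t) - (E t \<inter> A)) x * norm (K t x (f n x)) \<partial>Mt t)
         \<le> (\<integral>x. L * (indicator (space M - A) x * norm (f n x)) \<partial>Mt t)"
      proof (rule integral_mono_AE')
        show "integrable (Mt t) (\<lambda>x. L * (indicator (space M - A) x * norm (f n x)))"
          using i1 by (intro integrable_restrict_norm t) auto
        show "AE x in Mt t. indicator (space (Mt t) - E t \<inter> A) x * norm (K t x (f n x)) \<le> L * (indicator (space M - A) x * norm (f n x))"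
          using AE_Mt[OF t AE_space] by eventually_elim (use E(1)[OF t] L in \<open>auto intro: norm_K_le t split: split_indicator\<close>)
        show "AE x in Mt t. 0 \<le> L * (indicator (space M - A) x * norm (f n x))" using L by auto
      qed
      also have "\<dots> \<le> (\<integral>x. L * (indicator (space M - A) x * norm (f n x)) \<partial>M)"
        using i1 L by (intro integral_restrict_le t) auto
      also have "\<dots> = L * (\<integral>x. indicator (space M - A) x * norm (f n x) \<partial>M)" by simp
      also have "\<dots> \<le> L * (\<epsilon> / L)" using \<phi>(3)[of n] L by (intro mult_left_mono) auto
      finally show "(\<integral>x. indicator (space (Mt t) - (E t \<inter> A)) x * norm (K t x (f n x)) \<partial>Mt t) \<le> \<epsilon>"
        using L by simp
    qed
  qed
  moreover have "AE s in Mt t. \<forall>r>L * \<psi> s. finite_net r (range (\<lambda>n. K t s (f n s)))"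
    using AE_Mt[OF t net]
  proof eventually_elim
    case (elim s)
    show ?case
    proof (intro allI impI)
      fix r assume "L * \<psi> s < r"
      then have "finite_net (r / L) (range (\<lambda>n. f n s))" using elim L by (simp add: field_simps)
      then have "finite_net (L * (r / L)) (K t s ` range (\<lambda>n. f n s))"
        using L norm_K_le[OF t, of s] elim by (intro finite_net_lipschitz_image) (auto simp flip: blinfun.diff_right)
      then show "finite_net r (range (\<lambda>n. K t s (f n s)))" using L by (simp add: image_image)
    qed
  qed
  moreover have "integrable (Mt t) (\<lambda>s. L * \<psi> s)" using \<psi>(1) by (intro integrable_restrict_norm t) auto
  moreover have "AE s in Mt t. 0 \<le> L * \<psi> s" 
    using AE_Mt[OF t \<psi>(2)] by eventually_elim (use L in auto)
  ultimately have "finite_net (2 * (\<integral>s. L * \<psi> s \<partial>Mt t) + e) (range (\<lambda>n. banach_integral (Mt t) (\<lambda>s. K t s (f n s))))"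
    using norm_integrable_K[OF t f(1)] e by (intro finite_net_banach_integrals cfm_Mt t) auto
  moreover have "(\<integral>s. L * \<psi> s \<partial>Mt t) \<le> (\<integral>s. L * \<psi> s \<partial>M)"
    using \<psi> L by (intro integral_restrict_le t) (auto elim!: eventually_mono)
  ultimately show ?thesis unfolding volterra_def by (elim finite_net_mono) auto
qed

text \<open>Between \<open>t\<close> and \<open>t'\<close> the integral changes through the part \<open>E t' - E t\<close> of the domain, which has small
  measure, and through the change of \<open>K t s x\<close> for the finitely many \<open>x\<close> in \<open>P\<close>, which is uniformly small in
  \<open>s\<close> because the orbits are uniformly continuous on the compact triangle.\<close>

lemma volterra_simple_modulus:
  assumes P: "finite P" and e: "0 < e"
  shows "\<exists>\<eta>>0. \<forall>g t t'. simple_function M g \<longrightarrow> g ` space M \<subseteq> P \<longrightarrow> 0 \<le> t \<longrightarrow> t \<le> t' \<longrightarrow> t' \<le> a \<longrightarrow> p t' - p t < \<eta>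
    \<longrightarrow> norm (volterra t' g - volterra t g) \<le> e"
proof -
  let ?T = "{(t, s). 0 \<le> s \<and> s \<le> t \<and> t \<le> a}" and ?\<mu> = "measure M (space M)"
  define \<epsilon> where "\<epsilon> = e / (2 * (?\<mu> + 1))"
  have \<epsilon>: "0 < \<epsilon>" "\<epsilon> * ?\<mu> \<le> e/2" using e by (auto simp: \<epsilon>_def field_simps add_pos_nonneg)
  have "compact ?T"
  proof -
    have "?T = ({0..a} \<times> {0..a}) \<inter> {z. snd z \<le> fst z}" by auto
    moreover have "closed {z :: real \<times> real. snd z \<le> fst z}" by (intro closed_Collect_le continuous_intros)
    ultimately show ?thesis by (simp add: compact_Int_closed compact_Times)
  qed
  then have uc: "uniformly_continuous_on ?T (\<lambda>(t, s). K t s x)" for x using K(1) compact_uniformly_continuous by blast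
  have "\<exists>d>0. \<forall>t t' s. 0 \<le> s \<longrightarrow> s \<le> t \<longrightarrow> t \<le> t' \<longrightarrow> t' \<le> a \<longrightarrow> t' - t < d \<longrightarrow> norm (K t' s x - K t s x) \<le> \<epsilon>" for x
  proof -
    obtain d where d: "d > 0" "\<forall>z\<in>?T. \<forall>z'\<in>?T. dist z' z < d \<longrightarrow> dist ((\<lambda>(t, s). K t s x) z') ((\<lambda>(t, s). K t s x) z) < \<epsilon>"
      using uc[of x] \<epsilon>(1) unfolding uniformly_continuous_on_def by blast
    have "norm (K t' s x - K t s x) \<le> \<epsilon>" if "0 \<le> s" "s \<le> t" "t \<le> t'" "t' \<le> a" "t' - t < d" for t t' s
    proof -
      have "(t, s) \<in> ?T" "(t', s) \<in> ?T" "dist (t', s) (t, s) < d" using that by (auto simp: dist_Pair_Pair dist_real_def)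
      with d(2) show ?thesis by (fastforce simp: dist_norm)
    qed
    then show ?thesis using d(1) by blast
  qed
  then obtain d where d: "\<And>x. 0 < d x" "\<And>x t t' s. 0 \<le> s \<Longrightarrow> s \<le> t \<Longrightarrow> t \<le> t' \<Longrightarrow> t' \<le> a \<Longrightarrow> t' - t < d x \<Longrightarrow> norm (K t' s x - K t s x) \<le> \<epsilon>"
    by metis
  define B where "B = (\<Sum>x\<in>P. norm x) + 1"
  have B: "0 < B" "\<And>x. x \<in> P \<Longrightarrow> norm x \<le> B"
    using P member_le_sum[of _ P norm] by (fastforce simp: B_def intro: add_nonneg_pos sum_nonneg)+
  define \<eta> where "\<eta> = Min (insert (e / (2 * L * B)) (d ` P))"
  have \<eta>: "0 < \<eta>" "\<eta> \<le> e / (2 * L * B)" "\<And>x. x \<in> P \<Longrightarrow> \<eta> \<le> d x"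
    using P e L B d(1) by (auto simp: \<eta>_def)
  have "norm (volterra t' g - volterra t g) \<le> e"
    if g: "simple_function M g" "g ` space M \<subseteq> P" and t: "0 \<le> t" "t \<le> t'" "t' \<le> a" "p t' - p t < \<eta>" for g t t'
  proof -
    have tt: "t \<in> {0..a}" "t' \<in> {0..a}" using t by auto
    have gi: "norm_integrable M g" using cfm g(1) by (rule simple_function_norm_integrable)
    let ?f = "\<lambda>t s. indicator (E t) s *\<^sub>R K t s (g s)"
    have eq: "volterra \<tau> g = banach_integral M (?f \<tau>)" and int: "norm_integrable M (?f \<tau>)" if "\<tau> \<in> {0..a}" for \<tau>
      using banach_integral_restrict_space(1)[OF cfm E(1)[OF that], THEN iffD1, OF norm_integrable_K[OF that gi]]
        banach_integral_restrict_space(2)[OF cfm E(1)[OF that] norm_integrable_K[OF that gi]]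
      by (auto simp: volterra_def)
    have Em: "E t' - E t \<in> sets M" using E(1)[OF tt(1)] E(1)[OF tt(2)] by auto
    have "norm (volterra t' g - volterra t g) \<le> (\<integral>s. (L * B) * indicator (E t' - E t) s + \<epsilon> \<partial>M)"
      unfolding eq[OF tt(1)] eq[OF tt(2)]
    proof (rule banach_integral_diff_le[OF cfm int[OF tt(2)] int[OF tt(1)]])
      show "integrable M (\<lambda>s. (L * B) * indicator (E t' - E t) s + \<epsilon>)" using Em by (auto simp: emeasure_eq_measure)
      show "AE s in M. norm (?f t' s - ?f t s) \<le> (L * B) * indicator (E t' - E t) s + \<epsilon>"
      proof (rule AE_I2)
        fix s assume s: "s \<in> space M"
        then have gs: "g s \<in> P" using g(2) by auto
        consider "s \<in> E t" "s \<in> E t'" | "s \<in> E t' - E t" | "s \<notin> E t" "s \<notin> E t'" using E(3)[of t t'] t by blast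
        then show "norm (?f t' s - ?f t s) \<le> (L * B) * indicator (E t' - E t) s + \<epsilon>"
        proof cases
          case 1
          have "t' - t < d (g s)" using p(2)[OF t(1-3)] t(4) \<eta>(3)[OF gs] by linarith
          then have "norm (K t' s (g s) - K t s (g s)) \<le> \<epsilon>" using 1 E(2)[OF tt(1)] t by (intro d(2)) auto
          then show ?thesis using 1 by simp
        next
          case 2
          have "norm (K t' s (g s)) \<le> L * norm (g s)" using 2 by (intro norm_K_le tt) auto
          also have "\<dots> \<le> L * B" using B(2)[OF gs] L by simp
          finally show ?thesis using 2 \<epsilon>(1) by simp
        next
          case 3 then show ?thesis using \<epsilon>(1) by simp
        qed
      qed
    qed
    also have "\<dots> = L * B * measure M (E t' - E t) + \<epsilon> * ?\<mu>"
      using Em by (subst Bochner_Integration.integral_add) (auto simp: emeasure_eq_measure mult.commute)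
    also have "\<dots> \<le> L * B * (e / (2 * L * B)) + e/2"
      using p(1)[OF t(1-3)] t(4) \<eta>(2) L B \<epsilon>(2) by (intro add_mono mult_left_mono) auto
    also have "\<dots> = e" using L B by simp
    finally show ?thesis .
  qed
  then show ?thesis using \<eta>(1) by blast
qed

text \<open>When the values form totally bounded sets, rounding them to a finite set changes the integrals
  by an arbitrarily small amount.\<close>

lemma volterra_equi_modulus:
  assumes f: "\<And>n. norm_integrable M (f n)" "nearly_dominated M f"
    and net: "AE s in M. \<forall>r>0. finite_net r (range (\<lambda>n. f n s))"
  shows "equicontrolled a p (range (\<lambda>n t. volterra t (f n)))"
  unfolding equicontrolled_def
proof (intro allI impI)
  fix e :: real assume e: "0 < e"
  have e1: "0 < e / (3 * L)" and e2: "0 < e/3" using e L by auto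
  obtain P g where P: "finite P" "P \<noteq> {}" and g: "\<And>n. simple_function M (g n)" "\<And>n. g n ` space M \<subseteq> P"
    "\<And>n. (\<integral>x. norm (f n x - g n x) \<partial>M) \<le> 2 * (\<integral>x. 0 \<partial>M) + e / (3 * L)"
    by (rule finite_valued_approximation[OF cfm f, of "\<lambda>_. 0", OF _ _ net e1]) auto
  obtain \<eta> where \<eta>: "0 < \<eta>" "\<And>g t t'. simple_function M g \<Longrightarrow> g ` space M \<subseteq> P \<Longrightarrow> 0 \<le> t \<Longrightarrow> t \<le> t' \<Longrightarrow> t' \<le> a \<Longrightarrow> p t' - p t < \<eta>
    \<Longrightarrow> norm (volterra t' g - volterra t g) \<le> e/3"
    using volterra_simple_modulus[OF P(1) e2] by blast
  have near: "norm (volterra t (f n) - volterra t (g n)) \<le> e/3" if "t \<in> {0..a}" for t n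
  proof -
    have "norm (volterra t (f n) - volterra t (g n)) \<le> L * (\<integral>s. norm (f n s - g n s) \<partial>M)"
      by (intro volterra_diff_le that f(1) simple_function_norm_integrable[OF cfm g(1)])
    also have "\<dots> \<le> L * (e / (3 * L))" using g(3)[of n] L by (intro mult_left_mono) auto
    finally show ?thesis using L by simp
  qed
  have le: "norm (volterra t (f n) - volterra t' (f n)) \<le> e" if "t \<in> {0..a}" "t' \<in> {0..a}" "t \<le> t'" "\<bar>p t - p t'\<bar> < \<eta>" for n t t'
  proof -
    have "norm (volterra t' (g n) - volterra t (g n)) \<le> e/3" using that by (intro \<eta>(2) g) auto
    then show ?thesis using near[OF that(1), of n] near[OF that(2), of n]
      norm_triangle_ineq[of "volterra t (f n) - volterra t (g n)" "volterra t (g n) - volterra t' (f n)"]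
      norm_triangle_ineq[of "volterra t (g n) - volterra t' (g n)" "volterra t' (g n) - volterra t' (f n)"]
      by (simp add: norm_minus_commute)
  qed
  have "norm (volterra t (f n) - volterra t' (f n)) \<le> e" if "t \<in> {0..a}" "t' \<in> {0..a}" "\<bar>p t - p t'\<bar> < \<eta>" for n t t'
    using le[of t t' n] le[of t' t n] that by (cases "t \<le> t'") (auto simp: norm_minus_commute abs_minus_commute)
  then show "\<exists>\<eta>>0. \<forall>F\<in>range (\<lambda>n t. volterra t (f n)). \<forall>t\<in>{0..a}. \<forall>t'\<in>{0..a}.
      \<bar>p t - p t'\<bar> < \<eta> \<longrightarrow> norm (F t - F t') \<le> e"
    using \<eta>(1) by auto
qed

end

section \<open>Functions controlled by a monotone function\<close>

lemma equicontrolledE: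
  assumes "equicontrolled a p F" "0 < e"
  obtains \<eta> where "0 < \<eta>" "\<And>f t t'. f \<in> F \<Longrightarrow> t \<in> {0..a} \<Longrightarrow> t' \<in> {0..a} \<Longrightarrow> \<bar>p t - p t'\<bar> < \<eta> \<Longrightarrow> norm (f t - f t') \<le> e"
  using assms(1)[unfolded equicontrolled_def, rule_format, OF assms(2)] that by metis

lemma controlledE:
  assumes "equicontrolled a p {f}" "0 < e"
  obtains \<eta> where "0 < \<eta>" "\<And>t t'. t \<in> {0..a} \<Longrightarrow> t' \<in> {0..a} \<Longrightarrow> \<bar>p t - p t'\<bar> < \<eta> \<Longrightarrow> norm (f t - f t') \<le> e"
proof (rule equicontrolledE[OF assms])
  fix \<eta> assume \<eta>: "0 < \<eta>" "\<And>h t t'. h \<in> {f} \<Longrightarrow> t \<in> {0..a} \<Longrightarrow> t' \<in> {0..a} \<Longrightarrow> \<bar>p t - p t'\<bar> < \<eta> \<Longrightarrow> norm (h t - h t') \<le> e"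
  show thesis by (rule that[OF \<eta>(1) \<eta>(2)[OF singletonI]])
qed

lemma controlledI:
  assumes "\<And>e. 0 < e \<Longrightarrow> \<exists>\<eta>>0. \<forall>t\<in>{0..a}. \<forall>t'\<in>{0..a}. \<bar>p t - p t'\<bar> < \<eta> \<longrightarrow> norm (f t - f t') \<le> e"
  shows "equicontrolled a p {f}"
  unfolding equicontrolled_def ball_simps(1) using assms by (simp del: atLeastAtMost_iff)

text \<open>On a discrete space every bounded function is continuous, so this is the Banach space of all
  bounded functions on the real line with the supremum norm.\<close>

type_synonym 'x bfun = "real discrete \<Rightarrow>\<^sub>C 'x"

definition val :: "'x::real_normed_vector bfun \<Rightarrow> real \<Rightarrow> 'x" where
  "val F t = apply_bcontfun F (discrete t)"

definition bfun_of :: "(real \<Rightarrow> 'x::real_normed_vector) \<Rightarrow> 'x bfun" where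
  "bfun_of f = Bcontfun (\<lambda>z. f (of_discrete z))"

lemma continuous_on_discrete: "continuous_on (S :: 'd discrete set) f"
  by (rule continuous_on_subset[of UNIV]) (simp_all add: continuous_on_open_vimage open_discrete)

lemma val_bfun_of:
  assumes "\<And>t. norm (f t) \<le> B"
  shows "val (bfun_of f) = f"
proof
  fix t
  have "(\<lambda>z. f (of_discrete z)) \<in> bcontfun"
    using assms by (intro bcontfun_normI[of _ B] continuous_on_discrete)
  then show "val (bfun_of f) t = f t"
    unfolding val_def bfun_of_def by (simp add: Bcontfun_inverse discrete_inverse)
qed

lemma val_simps [simp]:
  "val 0 t = 0" "val (F + G) t = val F t + val G t" "val (F - G) t = val F t - val G t" "val (r *\<^sub>R F) t = r *\<^sub>R val F t"
  by (simp_all add: val_def)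

lemma norm_val_le: "norm (val F t) \<le> norm F"
  unfolding val_def by (rule norm_bounded)

lemma norm_bfun_le:
  assumes "\<And>t. norm (val F t) \<le> b"
  shows "norm F \<le> b"
proof (rule norm_bound)
  fix z
  show "norm (apply_bcontfun F z) \<le> b" using assms[of "of_discrete z"] by (simp add: val_def of_discrete_inverse)
qed

instance bcontfun :: (metric_space, banach) banach ..

lemma bounded_linear_val: "bounded_linear (\<lambda>F. val F t)"
  by (rule bounded_linear_intro[of _ 1]) (simp_all add: norm_val_le)

text \<open>The values of \<open>p\<close> lie in a bounded interval, so rounding \<open>p\<close> to a grid of width \<open>\<eta>\<close> cuts \<open>[0, a]\<close> into finitely
  many cells on which all members are nearly constant. Two members that are close at one point of each
  cell are close everywhere.\<close>

theorem finite_net_of_equicontrolled: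
  fixes F :: "nat \<Rightarrow> 'x::real_normed_vector bfun"
  assumes p: "\<And>t. t \<in> {0..a} \<Longrightarrow> \<bar>p t\<bar> \<le> b"
    and supp: "\<And>n t. t \<notin> {0..a} \<Longrightarrow> val (F n) t = 0"
    and equi: "equicontrolled a p (range (\<lambda>n. val (F n)))"
    and pointwise: "\<And>t e. t \<in> {0..a} \<Longrightarrow> 0 < e \<Longrightarrow> finite_net e (range (\<lambda>n. val (F n) t))"
    and e: "0 < e"
  shows "finite_net e (range F)"
proof -
  from e have e4: "0 < e/4" by simp
  obtain \<eta> where \<eta>: "0 < \<eta>" "\<And>n t t'. t \<in> {0..a} \<Longrightarrow> t' \<in> {0..a} \<Longrightarrow> \<bar>p t - p t'\<bar> < \<eta> \<Longrightarrow> norm (val (F n) t - val (F n) t') \<le> e/4"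
    by (rule equicontrolledE[OF equi e4]) blast
  define k where "k t = \<lfloor>p t / \<eta>\<rfloor>" for t
  have close: "\<bar>p t - p t'\<bar> < \<eta>" if "k t = k t'" for t t'
  proof -
    have "\<bar>p t / \<eta> - p t' / \<eta>\<bar> < 1" using that unfolding k_def by linarith
    then show ?thesis using \<eta>(1) by (simp add: diff_divide_distrib[symmetric] abs_divide divide_less_eq)
  qed
  define r where "r z = (SOME t. t \<in> {0..a} \<and> k t = z)" for z
  have r: "r (k t) \<in> {0..a} \<and> k (r (k t)) = k t" if "t \<in> {0..a}" for t
    unfolding r_def by (rule someI[where P = "\<lambda>s. s \<in> {0..a} \<and> k s = k t"]) (use that in auto)
  define T where "T = r ` k ` {0..a}"
  have "k ` {0..a} \<subseteq> {\<lfloor>- b / \<eta>\<rfloor>..\<lfloor>b / \<eta>\<rfloor>}"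
  proof
    fix z assume "z \<in> k ` {0..a}"
    then obtain t where t: "t \<in> {0..a}" "z = k t" by blast
    then have "- b \<le> p t" "p t \<le> b" using p[OF t(1)] by auto
    then show "z \<in> {\<lfloor>- b / \<eta>\<rfloor>..\<lfloor>b / \<eta>\<rfloor>}"
      unfolding t(2) k_def atLeastAtMost_iff using \<eta>(1) by (intro conjI floor_mono divide_right_mono) auto
  qed
  then have T: "finite T" "T \<subseteq> {0..a}" using r unfolding T_def by (auto intro: finite_subset)
  have "\<forall>t\<in>T. \<exists>X. finite X \<and> (\<forall>n. \<exists>x\<in>X. norm (val (F n) t - x) \<le> e/4)"
  proof
    fix t assume "t \<in> T"
    then have "finite_net (e/4) (range (\<lambda>n. val (F n) t))" using pointwise[OF _ e4] T(2) by blast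
    then show "\<exists>X. finite X \<and> (\<forall>n. \<exists>x\<in>X. norm (val (F n) t - x) \<le> e/4)" unfolding finite_net_def by auto
  qed
  then obtain X where X: "\<And>t. t \<in> T \<Longrightarrow> finite (X t)" "\<And>t n. t \<in> T \<Longrightarrow> \<exists>x\<in>X t. norm (val (F n) t - x) \<le> e/4"
    by metis
  define \<sigma> where "\<sigma> n t = (SOME x. x \<in> X t \<and> norm (val (F n) t - x) \<le> e/4)" for n t
  have \<sigma>: "\<sigma> n t \<in> X t \<and> norm (val (F n) t - \<sigma> n t) \<le> e/4" if "t \<in> T" for t n
    unfolding \<sigma>_def by (rule someI_ex) (use X(2)[OF that] in blast)
  \<comment> \<open>Only finitely many tuples of net points occur; one member for each of them forms the net.\<close>
  define \<Sigma> where "\<Sigma> n = restrict (\<sigma> n) T" for n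
  have "range \<Sigma> \<subseteq> (\<Pi>\<^sub>E t\<in>T. X t)" using \<sigma> by (auto simp: \<Sigma>_def)
  then have fin: "finite (range \<Sigma>)" using T(1) X(1) by (meson finite_PiE finite_subset)
  define m where "m s = (SOME n. \<Sigma> n = s)" for s
  have near: "norm (F n - F (m (\<Sigma> n))) \<le> e" for n
  proof (rule norm_bfun_le)
    fix t
    let ?m = "m (\<Sigma> n)"
    have "\<Sigma> ?m = \<Sigma> n" unfolding m_def by (rule someI[of _ n]) simp
    then have eq: "\<sigma> ?m s = \<sigma> n s" if "s \<in> T" for s using that unfolding \<Sigma>_def by (metis restrict_apply')
    show "norm (val (F n - F ?m) t) \<le> e"
    proof (cases "t \<in> {0..a}")
      case False then show ?thesis using e by (simp add: supp)
    next
      case True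
      define s where "s = r (k t)"
      have s: "s \<in> T" "s \<in> {0..a}" "\<bar>p t - p s\<bar> < \<eta>" using True r[OF True] close[of t s] by (auto simp: s_def T_def)
      have "val (F n) t - val (F ?m) t = (val (F n) t - val (F n) s) + (val (F n) s - \<sigma> n s)
          - (val (F ?m) s - \<sigma> ?m s) - (val (F ?m) t - val (F ?m) s)" using eq[OF s(1)] by simp
      also have "norm \<dots> \<le> norm (val (F n) t - val (F n) s) + norm (val (F n) s - \<sigma> n s)
          + norm (val (F ?m) s - \<sigma> ?m s) + norm (val (F ?m) t - val (F ?m) s)"
        by (intro order_trans[OF norm_triangle_ineq4] add_mono norm_triangle_ineq order_refl)
      also have "\<dots> \<le> e/4 + e/4 + e/4 + e/4"
        using \<sigma>[OF s(1), of n] \<sigma>[OF s(1), of ?m] by (intro add_mono \<eta>(2) True s) auto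
      finally show ?thesis by simp
    qed
  qed
  show ?thesis unfolding finite_net_def
  proof (intro exI conjI ballI)
    show "finite (F ` m ` range \<Sigma>)" by (rule finite_imageI[OF finite_imageI[OF fin]])
    fix G assume "G \<in> range F"
    then obtain n where "G = F n" by (rule rangeE)
    then show "\<exists>H\<in>F ` m ` range \<Sigma>. norm (G - H) \<le> e"
      using near[of n] by (intro bexI[of _ "F (m (\<Sigma> n))"] imageI rangeI) simp
  qed
qed

lemma mono_on_tendsto_left:
  fixes p :: "real \<Rightarrow> real"
  assumes p: "mono_on {0..a} p" and t: "t \<in> {0<..a}"
  shows "(p \<longlongrightarrow> Sup (p ` {0..<t})) (at_left t)"
proof -
  have bdd: "bdd_above (p ` {0..<t})" 
  proof (rule bdd_aboveI[of _ "p a"])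
    fix y assume "y \<in> p ` {0..<t}"
    then obtain x where "y = p x" "x \<in> {0..<t}" by (rule imageE)
    then show "y \<le> p a" using t mono_onD[OF p, of x a] by simp
  qed
  have ne: "p ` {0..<t} \<noteq> {}" using t by auto
  show ?thesis
  proof (rule order_tendstoI)
    fix y assume "y < Sup (p ` {0..<t})"
    then obtain u where u: "0 \<le> u" "u < t" "y < p u" using less_cSup_iff[OF ne bdd] by auto
    then show "\<forall>\<^sub>F x in at_left t. y < p x"
      unfolding eventually_at_left_field
      by (intro exI[of _ u] conjI allI impI less_le_trans[OF u(3)] mono_onD[OF p]) (use t in auto)
  next
    fix y assume y: "Sup (p ` {0..<t}) < y"
    have "p x < y" if "0 < x" "x < t" for x
      using cSup_upper[OF _ bdd, of "p x"] that y by force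
    then show "\<forall>\<^sub>F x in at_left t. p x < y"
      unfolding eventually_at_left_field by (intro exI[of _ 0]) (use t in auto)
  qed
qed

lemma mono_on_tendsto_right:
  fixes p :: "real \<Rightarrow> real"
  assumes p: "mono_on {0..a} p" and t: "t \<in> {0..<a}"
  shows "(p \<longlongrightarrow> Inf (p ` {t<..a})) (at_right t)"
proof -
  have bdd: "bdd_below (p ` {t<..a})" 
  proof (rule bdd_belowI[of _ "p 0"])
    fix y assume "y \<in> p ` {t<..a}"
    then obtain x where "y = p x" "x \<in> {t<..a}" by (rule imageE)
    then show "p 0 \<le> y" using t mono_onD[OF p, of 0 x] by simp
  qed
  have ne: "p ` {t<..a} \<noteq> {}" using t by auto
  show ?thesis
  proof (rule order_tendstoI)
    fix y assume "Inf (p ` {t<..a}) < y"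
    then obtain u where u: "t < u" "u \<le> a" "p u < y" using cInf_less_iff[OF ne bdd] by auto
    then show "\<forall>\<^sub>F x in at_right t. p x < y"
      unfolding eventually_at_right_field
      by (intro exI[of _ u] conjI allI impI le_less_trans[OF _ u(3)] mono_onD[OF p]) (use t in auto)
  next
    fix y assume y: "y < Inf (p ` {t<..a})"
    have "y < p x" if "t < x" "x < a" for x
      using cInf_lower[OF _ bdd, of "p x"] that y by force
    then show "\<forall>\<^sub>F x in at_right t. y < p x"
      unfolding eventually_at_right_field by (intro exI[of _ a]) (use t in auto)
  qed
qed

text \<open>Where \<open>p\<close> converges, a function controlled by \<open>p\<close> is Cauchy.\<close>

lemma controlled_tendsto:
  fixes f :: "real \<Rightarrow> 'x::banach"
  assumes f: "equicontrolled a p {f}" and p: "(p \<longlongrightarrow> l) F" and F: "F \<noteq> bot" "\<forall>\<^sub>F t in F. t \<in> {0..a}"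
  shows "\<exists>l. (f \<longlongrightarrow> l) F"
proof -
  have cf: "cauchy_filter (filtermap f F)"
    unfolding cauchy_filter_metric_filtermap
  proof (intro allI impI)
    fix e :: real assume e: "0 < e"
    then have e2: "0 < e/2" by simp
    obtain \<eta> where \<eta>: "0 < \<eta>" "\<And>t t'. t \<in> {0..a} \<Longrightarrow> t' \<in> {0..a} \<Longrightarrow> \<bar>p t - p t'\<bar> < \<eta> \<Longrightarrow> norm (f t - f t') \<le> e/2"
      by (rule controlledE[OF f e2]) blast
    have ev: "\<forall>\<^sub>F t in F. dist (p t) l < \<eta>/2" using p \<eta>(1) by (intro tendstoD) auto
    show "\<exists>P. eventually P F \<and> (\<forall>x y. P x \<and> P y \<longrightarrow> dist (f x) (f y) < e)"
    proof (intro exI conjI allI impI)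
      show "\<forall>\<^sub>F t in F. t \<in> {0..a} \<and> dist (p t) l < \<eta>/2" using F(2) ev by eventually_elim auto
      fix x y assume xy: "(x \<in> {0..a} \<and> dist (p x) l < \<eta>/2) \<and> (y \<in> {0..a} \<and> dist (p y) l < \<eta>/2)"
      then have "\<bar>p x - p y\<bar> < \<eta>" unfolding dist_real_def by linarith
      then have "norm (f x - f y) \<le> e/2" using xy by (intro \<eta>(2)) auto
      then show "dist (f x) (f y) < e" using e by (simp add: dist_norm)
    qed
  qed
  have nb: "filtermap f F \<noteq> bot" using F(1) by (simp add: filtermap_bot_iff)
  have "filtermap f F \<le> principal UNIV" by simp
  from cauchy_filter_complete_converges[OF cf complete_UNIV this nb]
  obtain l where "filtermap f F \<le> nhds l" by (rule exE)
  then show ?thesis unfolding filterlim_def by (rule exI)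
qed

lemma equicontrolled_restrict:
  assumes "equicontrolled a p {f}"
  shows "equicontrolled a p {restrict f {0..a}}"
proof (rule controlledI)
  fix e :: real assume "0 < e"
  with assms obtain \<eta> where \<eta>: "0 < \<eta>" "\<And>t t'. t \<in> {0..a} \<Longrightarrow> t' \<in> {0..a} \<Longrightarrow> \<bar>p t - p t'\<bar> < \<eta> \<Longrightarrow> norm (f t - f t') \<le> e"
    by (rule controlledE) blast
  show "\<exists>\<eta>>0. \<forall>t\<in>{0..a}. \<forall>t'\<in>{0..a}. \<bar>p t - p t'\<bar> < \<eta> \<longrightarrow> norm (restrict f {0..a} t - restrict f {0..a} t') \<le> e"
    using \<eta>(1) by (intro exI[of _ \<eta>] conjI ballI impI) (simp_all only: restrict_apply' \<eta>(2))
qed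

lemma controlled_regulated:
  fixes f :: "real \<Rightarrow> 'x::banach"
  assumes p: "mono_on {0..a} p" and f: "equicontrolled a p {f}"
  shows "restrict f {0..a} \<in> regulated a"
  unfolding regulated_def
proof (intro CollectI conjI ballI)
  fix t assume t: "t \<in> {0<..a}"
  have "\<forall>\<^sub>F s in at_left t. s \<in> {0..a}"
    unfolding eventually_at_left_field using t by (intro exI[of _ 0]) auto
  then show "\<exists>l. (restrict f {0..a} \<longlongrightarrow> l) (at_left t)"
    by (intro controlled_tendsto[OF equicontrolled_restrict[OF f] mono_on_tendsto_left[OF p t]]) auto
next
  fix t assume t: "t \<in> {0..<a}"
  have "\<forall>\<^sub>F s in at_right t. s \<in> {0..a}"
    unfolding eventually_at_right_field using t by (intro exI[of _ a]) auto
  then show "\<exists>l. (restrict f {0..a} \<longlongrightarrow> l) (at_right t)"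
    by (intro controlled_tendsto[OF equicontrolled_restrict[OF f] mono_on_tendsto_right[OF p t]]) auto
qed auto

text \<open>Replacing \<open>t\<close> by a fixed representative of its cell of the grid of \<open>p\<close> gives simple functions converging
  uniformly.\<close>

lemma controlled_strongly_measurable:
  fixes f :: "real \<Rightarrow> 'x::real_normed_vector"
  assumes p: "mono_on {0..a} p" "0 \<le> a" and f: "equicontrolled a p {f}"
    and M: "(\<lambda>x. x) \<in> borel_measurable M" "space M \<subseteq> {0..a}"
  shows "strongly_measurable M f"
proof -
  have "\<forall>m::nat. \<exists>\<eta>>0. \<forall>t\<in>{0..a}. \<forall>t'\<in>{0..a}. \<bar>p t - p t'\<bar> < \<eta> \<longrightarrow> norm (f t - f t') \<le> 1 / Suc m"
  proof
    fix m :: nat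
    have "0 < 1 / real (Suc m)" by simp
    with f obtain \<eta> where "0 < \<eta>" "\<And>t t'. t \<in> {0..a} \<Longrightarrow> t' \<in> {0..a} \<Longrightarrow> \<bar>p t - p t'\<bar> < \<eta> \<Longrightarrow> norm (f t - f t') \<le> 1 / Suc m"
      by (rule controlledE) blast
    then show "\<exists>\<eta>>0. \<forall>t\<in>{0..a}. \<forall>t'\<in>{0..a}. \<bar>p t - p t'\<bar> < \<eta> \<longrightarrow> norm (f t - f t') \<le> 1 / Suc m" by blast
  qed
  then obtain \<eta> where \<eta>: "\<And>m. 0 < \<eta> m"
    "\<And>m t t'. t \<in> {0..a} \<Longrightarrow> t' \<in> {0..a} \<Longrightarrow> \<bar>p t - p t'\<bar> < \<eta> m \<Longrightarrow> norm (f t - f t') \<le> 1 / Suc m" by metis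
  define k where "k m t = \<lfloor>p t / \<eta> m\<rfloor>" for m t
  have close: "\<bar>p t - p t'\<bar> < \<eta> m" if "k m t = k m t'" for m t t'
  proof -
    have "\<bar>p t / \<eta> m - p t' / \<eta> m\<bar> < 1" using that unfolding k_def by linarith
    then show ?thesis using \<eta>(1)[of m] by (simp add: diff_divide_distrib[symmetric] abs_divide divide_less_eq)
  qed
  define r where "r m z = (SOME t. t \<in> {0..a} \<and> k m t = z)" for m z
  have r: "r m (k m t) \<in> {0..a} \<and> k m (r m (k m t)) = k m t" if "t \<in> {0..a}" for m t
    unfolding r_def by (rule someI[where P = "\<lambda>s. s \<in> {0..a} \<and> k m s = k m t"]) (use that in auto)
  have simple: "simple_function M (k m)" for m
  proof -
    have "p \<in> borel_measurable (restrict_space borel {0..a})" using p(1) by (rule borel_measurable_mono_on_fnc)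
    moreover have "(\<lambda>x. x) \<in> measurable M (restrict_space borel {0..a})"
      using M by (intro measurable_restrict_space2) auto
    ultimately have [measurable]: "p \<in> borel_measurable M" by (rule measurable_compose[rotated])
    have "k m \<in> measurable M (count_space UNIV)" unfolding k_def by measurable
    moreover have "k m ` space M \<subseteq> {k m 0..k m a}"
    proof
      fix z assume "z \<in> k m ` space M"
      then obtain t where t: "t \<in> {0..a}" "z = k m t" using M(2) by auto
      then have "p 0 \<le> p t" "p t \<le> p a" using mono_onD[OF p(1), of 0 t] mono_onD[OF p(1), of t a] by auto
      then show "z \<in> {k m 0..k m a}" using t \<eta>(1)[of m] by (auto simp: k_def intro!: floor_mono divide_right_mono)
    qed
    ultimately show ?thesis unfolding simple_function_def
      by (auto intro: measurable_sets finite_subset)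
  qed
  show ?thesis unfolding strongly_measurable_def
  proof (intro exI conjI allI)
    show "simple_function M (\<lambda>t. f (r m (k m t)))" for m
      using simple_function_compose1[OF simple, of "\<lambda>z. f (r m z)"] .
    show "AE t in M. (\<lambda>m. f (r m (k m t))) \<longlonglongrightarrow> f t"
    proof (rule AE_I2)
      fix t assume "t \<in> space M"
      then have t: "t \<in> {0..a}" using M(2) by auto
      have "norm (f (r m (k m t)) - f t) \<le> 1 / Suc m" for m
        using r[OF t, of m] t by (intro \<eta>(2) close) auto
      then show "(\<lambda>m. f (r m (k m t))) \<longlonglongrightarrow> f t"
        by (intro LIM_zero_cancel[of _ "f t"] Lim_null_comparison[OF _ LIMSEQ_inverse_real_of_nat])
          (auto simp: inverse_eq_divide)
    qed
  qed
qed

lemma equicontrolled_add: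
  assumes "equicontrolled a p (range f)" "equicontrolled a p (range g)"
  shows "equicontrolled a p (range (\<lambda>n t. f n t + g n t))"
  unfolding equicontrolled_def
proof (intro allI impI)
  fix e :: real assume "0 < e"
  then have e: "0 < e/2" by simp
  obtain \<eta>1 where 1: "0 < \<eta>1" "\<forall>h\<in>range f. \<forall>t\<in>{0..a}. \<forall>t'\<in>{0..a}. \<bar>p t - p t'\<bar> < \<eta>1 \<longrightarrow> norm (h t - h t') \<le> e/2"
    using assms(1) e unfolding equicontrolled_def by blast
  obtain \<eta>2 where 2: "0 < \<eta>2" "\<forall>h\<in>range g. \<forall>t\<in>{0..a}. \<forall>t'\<in>{0..a}. \<bar>p t - p t'\<bar> < \<eta>2 \<longrightarrow> norm (h t - h t') \<le> e/2"
    using assms(2) e unfolding equicontrolled_def by blast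
  have "norm (f n t + g n t - (f n t' + g n t')) \<le> e"
    if "t \<in> {0..a}" "t' \<in> {0..a}" "\<bar>p t - p t'\<bar> < min \<eta>1 \<eta>2" for n t t'
  proof -
    have "norm (f n t - f n t') \<le> e/2" "norm (g n t - g n t') \<le> e/2" using 1 2 that by auto
    then show ?thesis using norm_triangle_ineq[of "f n t - f n t'" "g n t - g n t'"] by (simp add: algebra_simps)
  qed
  then show "\<exists>\<eta>>0. \<forall>h\<in>range (\<lambda>n t. f n t + g n t). \<forall>t\<in>{0..a}. \<forall>t'\<in>{0..a}. \<bar>p t - p t'\<bar> < \<eta> \<longrightarrow> norm (h t - h t') \<le> e"
    using 1(1) 2(1) by (intro exI[of _ "min \<eta>1 \<eta>2"]) auto
qed

lemma closed_controlled: "closed {F :: 'x::real_normed_vector bfun. equicontrolled a p {val F}}"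
  unfolding closed_sequential_limits
proof (intro allI impI)
  fix G :: "nat \<Rightarrow> 'x bfun" and F
  assume G: "(\<forall>n. G n \<in> {F. equicontrolled a p {val F}}) \<and> G \<longlonglongrightarrow> F"
  show "F \<in> {F. equicontrolled a p {val F}}"
  proof (intro CollectI controlledI)
    fix e :: real assume "0 < e"
    then have e: "0 < e/3" by simp
    then obtain n where n: "norm (G n - F) < e/3" using G LIMSEQ_D[of G F "e/3"] by blast
    obtain \<eta> where \<eta>: "0 < \<eta>" "\<And>t t'. t \<in> {0..a} \<Longrightarrow> t' \<in> {0..a} \<Longrightarrow> \<bar>p t - p t'\<bar> < \<eta> \<Longrightarrow> norm (val (G n) t - val (G n) t') \<le> e/3"
      by (rule controlledE[OF _ e, of a p "val (G n)"]) (use G in blast)+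
    have d: "norm (val (G n) t - val F t) \<le> e/3" for t using norm_val_le[of "G n - F" t] n by simp
    have "norm (val F t - val F t') \<le> e" if "t \<in> {0..a}" "t' \<in> {0..a}" "\<bar>p t - p t'\<bar> < \<eta>" for t t'
      using \<eta>(2)[OF that] d[of t] d[of t'] norm_triangle_ineq[of "val F t - val (G n) t" "val (G n) t - val (G n) t'"]
        norm_triangle_ineq[of "val F t - val (G n) t'" "val (G n) t' - val F t'"] by (simp add: norm_minus_commute)
    then show "\<exists>\<eta>>0. \<forall>t\<in>{0..a}. \<forall>t'\<in>{0..a}. \<bar>p t - p t'\<bar> < \<eta> \<longrightarrow> norm (val F t - val F t') \<le> e"
      using \<eta>(1) by blast
  qed
qed

lemma convex_controlled: "convex {F :: 'x::real_normed_vector bfun. equicontrolled a p {val F}}"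
proof (rule convexI)
  fix F G :: "'x bfun" and u v :: real
  assume FG: "F \<in> {F. equicontrolled a p {val F}}" "G \<in> {F. equicontrolled a p {val F}}" and uv: "0 \<le> u" "0 \<le> v" "u + v = 1"
  show "u *\<^sub>R F + v *\<^sub>R G \<in> {F. equicontrolled a p {val F}}"
  proof (intro CollectI controlledI)
    fix e :: real assume e: "0 < e"
    obtain \<eta>1 where 1: "0 < \<eta>1" "\<And>t t'. t \<in> {0..a} \<Longrightarrow> t' \<in> {0..a} \<Longrightarrow> \<bar>p t - p t'\<bar> < \<eta>1 \<Longrightarrow> norm (val F t - val F t') \<le> e"
      by (rule controlledE[OF _ e, of a p "val F"]) (use FG in blast)+
    obtain \<eta>2 where 2: "0 < \<eta>2" "\<And>t t'. t \<in> {0..a} \<Longrightarrow> t' \<in> {0..a} \<Longrightarrow> \<bar>p t - p t'\<bar> < \<eta>2 \<Longrightarrow> norm (val G t - val G t') \<le> e"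
      by (rule controlledE[OF _ e, of a p "val G"]) (use FG in blast)+
    have "norm (val (u *\<^sub>R F + v *\<^sub>R G) t - val (u *\<^sub>R F + v *\<^sub>R G) t') \<le> e"
      if t: "t \<in> {0..a}" "t' \<in> {0..a}" "\<bar>p t - p t'\<bar> < min \<eta>1 \<eta>2" for t t'
    proof -
      have "val (u *\<^sub>R F + v *\<^sub>R G) t - val (u *\<^sub>R F + v *\<^sub>R G) t' = u *\<^sub>R (val F t - val F t') + v *\<^sub>R (val G t - val G t')"
        by (simp add: algebra_simps)
      also have "norm \<dots> \<le> u * norm (val F t - val F t') + v * norm (val G t - val G t')"
        using uv norm_triangle_ineq[of "u *\<^sub>R (val F t - val F t')" "v *\<^sub>R (val G t - val G t')"] by simp
      also have "\<dots> \<le> u * e + v * e" using t uv by (intro add_mono mult_left_mono 1 2) auto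
      also have "\<dots> = e" using uv by (simp flip: distrib_right)
      finally show ?thesis .
    qed
    then show "\<exists>\<eta>>0. \<forall>t\<in>{0..a}. \<forall>t'\<in>{0..a}. \<bar>p t - p t'\<bar> < \<eta> \<longrightarrow> norm (val (u *\<^sub>R F + v *\<^sub>R G) t - val (u *\<^sub>R F + v *\<^sub>R G) t') \<le> e"
      using 1(1) 2(1) by (intro exI[of _ "min \<eta>1 \<eta>2"]) auto
  qed
qed

lemma regulated_norm_le:
  assumes "0 \<le> a" "\<And>t. t \<in> {0..a} \<Longrightarrow> norm (f t) \<le> b"
  shows "regulated_norm a f \<le> b"
  unfolding regulated_norm_def using assms by (intro cSUP_least) auto

lemma equicontrolledI:
  assumes "\<And>e. 0 < e \<Longrightarrow> \<exists>\<eta>>0. \<forall>f\<in>F. \<forall>t\<in>{0..a}. \<forall>t'\<in>{0..a}. \<bar>p t - p t'\<bar> < \<eta> \<longrightarrow> norm (f t - f t') \<le> e"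
  shows "equicontrolled a p F"
  unfolding equicontrolled_def by (intro allI impI assms)

lemma equicontrolled_mem:
  assumes "equicontrolled a p F" "f \<in> F"
  shows "equicontrolled a p {f}"
proof (rule controlledI)
  fix e :: real assume "0 < e"
  from equicontrolledE[OF assms(1) this] obtain \<eta> where "0 < \<eta>"
    "\<forall>f\<in>F. \<forall>t\<in>{0..a}. \<forall>t'\<in>{0..a}. \<bar>p t - p t'\<bar> < \<eta> \<longrightarrow> norm (f t - f t') \<le> e" by metis
  with assms(2) show "\<exists>\<eta>>0. \<forall>t\<in>{0..a}. \<forall>t'\<in>{0..a}. \<bar>p t - p t'\<bar> < \<eta> \<longrightarrow> norm (f t - f t') \<le> e" by blast
qed

lemma equicontrolled_cong:
  assumes "equicontrolled a p (range f)" "\<And>n t. t \<in> {0..a} \<Longrightarrow> f n t = g n t"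
  shows "equicontrolled a p (range g)"
proof (rule equicontrolledI)
  fix e :: real assume "0 < e"
  with assms(1) obtain \<eta> where \<eta>: "0 < \<eta>" "\<And>h t t'. h \<in> range f \<Longrightarrow> t \<in> {0..a} \<Longrightarrow> t' \<in> {0..a} \<Longrightarrow> \<bar>p t - p t'\<bar> < \<eta> \<Longrightarrow> norm (h t - h t') \<le> e"
    by (rule equicontrolledE) blast
  have "norm (g n t - g n t') \<le> e" if "t \<in> {0..a}" "t' \<in> {0..a}" "\<bar>p t - p t'\<bar> < \<eta>" for n t t'
    using \<eta>(2)[OF rangeI[of f n] that] assms(2)[OF that(1)] assms(2)[OF that(2)] by simp
  then show "\<exists>\<eta>>0. \<forall>h\<in>range g. \<forall>t\<in>{0..a}. \<forall>t'\<in>{0..a}. \<bar>p t - p t'\<bar> < \<eta> \<longrightarrow> norm (h t - h t') \<le> e"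
    using \<eta>(1) by (intro exI[of _ \<eta>]) (simp del: atLeastAtMost_iff)
qed

text \<open>The operators are uniformly bounded, so only the orbits of a finite net of the initial values
  matter, and each of them is uniformly continuous on the compact interval.\<close>

lemma equicontrolled_orbits:
  fixes S :: "real \<Rightarrow> 'x::banach \<Rightarrow>\<^sub>L 'x"
  assumes S: "\<And>x. continuous_on {0..a} (\<lambda>t. S t x)" "\<And>t. t \<in> {0..a} \<Longrightarrow> norm (S t) \<le> L" "0 < L"
    and p: "\<And>t t'. t \<in> {0..a} \<Longrightarrow> t' \<in> {0..a} \<Longrightarrow> \<bar>t - t'\<bar> \<le> \<bar>p t - p t'\<bar>"
    and net: "\<And>e. 0 < e \<Longrightarrow> finite_net e (range x)"
  shows "equicontrolled a p (range (\<lambda>n t. S t (x n)))"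
proof (rule equicontrolledI)
  fix e :: real assume e: "0 < e"
  then have e3: "0 < e/3" and "0 < e / (3 * L)" using S(3) by auto
  then obtain Y where Y: "finite Y" "\<And>n. \<exists>y\<in>Y. norm (x n - y) \<le> e / (3 * L)"
    using net[of "e / (3 * L)"] unfolding finite_net_def by auto
  have "\<exists>\<eta>>0. \<forall>t\<in>{0..a}. \<forall>t'\<in>{0..a}. \<bar>t' - t\<bar> < \<eta> \<longrightarrow> norm (S t' y - S t y) < e/3" for y
    using compact_uniformly_continuous[OF S(1)[of y] compact_Icc] e3
    unfolding uniformly_continuous_on_def dist_norm real_norm_def by blast
  then obtain \<eta> where \<eta>: "\<And>y. 0 < \<eta> y"
    "\<And>y t t'. t \<in> {0..a} \<Longrightarrow> t' \<in> {0..a} \<Longrightarrow> \<bar>t' - t\<bar> < \<eta> y \<Longrightarrow> norm (S t' y - S t y) < e/3" by metis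
  define m where "m = Min (insert 1 (\<eta> ` Y))"
  have m: "0 < m" "\<And>y. y \<in> Y \<Longrightarrow> m \<le> \<eta> y" using Y(1) \<eta>(1) by (auto simp: m_def)
  have "norm (S t (x n) - S t' (x n)) \<le> e"
    if t: "t \<in> {0..a}" "t' \<in> {0..a}" "\<bar>p t - p t'\<bar> < m" for n t t'
  proof -
    obtain y where y: "y \<in> Y" "norm (x n - y) \<le> e / (3 * L)" using Y(2) by blast
    have near: "norm (S s (x n) - S s y) \<le> e/3" if "s \<in> {0..a}" for s
    proof -
      have "norm (S s (x n) - S s y) \<le> norm (S s) * norm (x n - y)"
        using norm_blinfun[of "S s" "x n - y"] by (simp add: blinfun.diff_right)
      also have "\<dots> \<le> L * (e / (3 * L))" using S(2)[OF that] y(2) S(3) by (intro mult_mono) auto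
      finally show ?thesis using S(3) by simp
    qed
    have "norm (S t y - S t' y) < e/3" using p[OF t(1,2)] t(3) m(2)[OF y(1)] by (intro \<eta>(2) t) auto
    then show ?thesis using near[OF t(1)] near[OF t(2)]
        norm_triangle_ineq[of "S t (x n) - S t y" "S t y - S t' (x n)"]
        norm_triangle_ineq[of "S t y - S t' y" "S t' y - S t' (x n)"] by (simp add: norm_minus_commute)
  qed
  then show "\<exists>\<eta>>0. \<forall>f\<in>range (\<lambda>n t. S t (x n)). \<forall>t\<in>{0..a}. \<forall>t'\<in>{0..a}. \<bar>p t - p t'\<bar> < \<eta> \<longrightarrow> norm (f t - f t') \<le> e"
    using m(1) by (intro exI[of _ m]) auto
qed


section \<open>The Lebesgue and Lebesgue--Stieltjes measures and square integrable controls\<close>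

lemma complete_finite_measureI:
  "complete_measure M \<Longrightarrow> emeasure M (space M) \<noteq> \<infinity> \<Longrightarrow> complete_finite_measure M"
  unfolding complete_finite_measure_def by (simp add: finite_measureI)

lemma sets_ls_measure:
  assumes "B \<in> sets borel" "B \<subseteq> {0..a}"
  shows "B \<in> sets (ls_measure a h)"
  unfolding ls_measure_def using assms by (subst sets_restrict_space_iff) (auto intro: sets_completionI_sets)

lemma space_ls_measure: "space (ls_measure a h) = {0..a}"
  unfolding ls_measure_def by (simp add: space_restrict_space)

lemma Int_space_ls_measure:
  assumes "t \<le> a"
  shows "{0..<t} \<inter> space (ls_measure a h) \<in> sets (ls_measure a h)"
proof -
  have "{0..<t} \<inter> space (ls_measure a h) = {0..<t}" using assms by (auto simp: space_ls_measure)
  moreover have "{0..<t} \<in> sets (ls_measure a h)" using assms by (intro sets_ls_measure) auto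
  ultimately show ?thesis by simp
qed

lemma complete_measure_ls_measure: "complete_measure (ls_measure a h)"
  unfolding ls_measure_def
  by (intro complete_measure.complete_measure_restrict_space completion.complete_measure_axioms)
     (auto intro: sets_completionI_sets)

lemma measurable_ident_ls_measure: "(\<lambda>x. x) \<in> borel_measurable (ls_measure a h)"
  unfolding ls_measure_def by (intro measurable_restrict_space1 measurable_completion) auto

lemma space_ls_upto:
  assumes "t \<le> a"
  shows "space (ls_upto a h t) = {0..<t}"
  using assms by (auto simp: ls_upto_def space_restrict_space space_ls_measure)

lemma complete_finite_measure_ls_upto:
  assumes a: "0 \<le> a" and h: "mono_on {0..a} h" "\<forall>t\<in>{0<..a}. (h \<longlongrightarrow> h t) (at_left t)"
  shows "complete_finite_measure (ls_upto a h a)"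
proof (rule complete_finite_measureI)
  have s: "{0..<a} \<in> sets (ls_measure a h)" by (rule sets_ls_measure) auto
  then show "complete_measure (ls_upto a h a)"
    unfolding ls_upto_def by (intro complete_measure.complete_measure_restrict_space complete_measure_ls_measure)
  have "emeasure (ls_upto a h a) {0..<a} = emeasure (ls_measure a h) {0..<a}"
    unfolding ls_upto_def by (intro emeasure_restrict_space Int_space_ls_measure) auto
  also have "\<dots> = ennreal (h a - h 0)" using a h by (intro emeasure_ls_measure) auto
  finally show "emeasure (ls_upto a h a) (space (ls_upto a h a)) \<noteq> \<infinity>" by (simp add: space_ls_upto)
qed

lemma sets_ls_upto:
  assumes "B \<in> sets borel" "B \<subseteq> {0..<a}"
  shows "B \<in> sets (ls_upto a h a)"
proof -
  have "{0..<a} \<inter> space (ls_measure a h) \<in> sets (ls_measure a h)" by (rule Int_space_ls_measure) simp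
  moreover have "B \<in> sets (ls_measure a h)" using assms by (intro sets_ls_measure) auto
  ultimately show ?thesis unfolding ls_upto_def using assms(2) by (simp add: sets_restrict_space_iff)
qed

lemma measure_ls_upto:
  assumes h: "mono_on {0..a} h" "\<forall>t\<in>{0<..a}. (h \<longlongrightarrow> h t) (at_left t)" and t: "0 \<le> s" "s \<le> t" "t \<le> a"
  shows "measure (ls_upto a h a) {s..<t} = h t - h s"
proof -
  have sub: "{0..<a} \<inter> space (ls_measure a h) \<in> sets (ls_measure a h)" by (rule Int_space_ls_measure) simp
  have "emeasure (ls_upto a h a) {s..<t} = emeasure (ls_measure a h) {s..<t}"
    unfolding ls_upto_def using t by (intro emeasure_restrict_space sub) auto
  also have "\<dots> = ennreal (h t - h s)" using h t by (intro emeasure_ls_measure) auto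
  finally show ?thesis using t mono_onD[OF h(1), of s t] by (simp add: measure_def)
qed

lemma ls_upto_restrict:
  assumes "t \<le> a"
  shows "restrict_space (ls_upto a h a) {0..<t} = ls_upto a h t"
proof -
  have "{0..<a} \<inter> space (ls_measure a h) \<in> sets (ls_measure a h)"
    "{0..<t} \<inter> space (ls_measure a h) \<in> sets (ls_measure a h)"
    using assms by (auto intro: Int_space_ls_measure)
  then have "restrict_space (restrict_space (ls_measure a h) {0..<a}) {0..<t} = restrict_space (ls_measure a h) ({0..<a} \<inter> {0..<t})"
    by (rule restrict_restrict_space)
  moreover have "{0..<a} \<inter> {0..<t} = {0..<t}" using assms by auto
  ultimately show ?thesis unfolding ls_upto_def by simp
qed

lemma AE_ls_upto:
  assumes "AE t in ls_measure a h. P t"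
  shows "AE t in ls_upto a h a. P t"
proof -
  have "{0..<a} \<inter> space (ls_measure a h) \<in> sets (ls_measure a h)" by (rule Int_space_ls_measure) simp
  then show ?thesis unfolding ls_upto_def using assms by (subst AE_restrict_space_iff) auto
qed

lemma integrable_ls_upto:
  fixes f :: "real \<Rightarrow> real"
  assumes "integrable (ls_measure a h) f"
  shows "integrable (ls_upto a h a) f"
proof -
  have s: "{0..<a} \<in> sets (ls_measure a h)" by (rule sets_ls_measure) auto
  have "{0..<a} \<inter> space (ls_measure a h) \<in> sets (ls_measure a h)" by (rule Int_space_ls_measure) simp
  then show ?thesis unfolding ls_upto_def using integrable_mult_indicator[OF s assms] by (subst integrable_restrict_space) auto
qed

lemma volterra_kernel_ls_upto:
  fixes K :: "real \<Rightarrow> real \<Rightarrow> 'x::banach \<Rightarrow>\<^sub>L 'x"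
  assumes a: "0 \<le> a" and h: "mono_on {0..a} h" "\<forall>t\<in>{0<..a}. (h \<longlongrightarrow> h t) (at_left t)"
    and K: "\<And>x. continuous_on {(t, s). 0 \<le> s \<and> s \<le> t \<and> t \<le> a} (\<lambda>(t, s). K t s x)"
      "\<And>t s. 0 \<le> s \<Longrightarrow> s \<le> t \<Longrightarrow> t \<le> a \<Longrightarrow> norm (K t s) \<le> L" and L: "0 < L"
  shows "volterra_kernel a (ls_upto a h a) (\<lambda>t. {0..<t}) K L (\<lambda>t. t + h t)"
proof (rule volterra_kernel.intro)
  show "complete_finite_measure (ls_upto a h a)" using a h by (rule complete_finite_measure_ls_upto)
  show "(\<lambda>x. x) \<in> borel_measurable (ls_upto a h a)"
    unfolding ls_upto_def by (intro measurable_restrict_space1 measurable_ident_ls_measure)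
  show "{0..<t} \<in> sets (ls_upto a h a)" if "t \<in> {0..a}" for t using that by (intro sets_ls_upto) auto
next
  fix t t' assume t: "0 \<le> t" "t \<le> t'" "t' \<le> (a::real)"
  have "{0..<t'} - {0..<t} = {t..<t'}" using t by auto
  then show "measure (ls_upto a h a) ({0..<t'} - {0..<t}) \<le> (t' + h t') - (t + h t)"
    using measure_ls_upto[OF h t] t by simp
  show "t' - t \<le> (t' + h t') - (t + h t)" using mono_onD[OF h(1), of t t'] t by simp
qed (use K L in auto)

lemma complete_finite_measure_lebesgue_on: "complete_finite_measure (lebesgue_on {0..a::real})"
proof (rule complete_finite_measureI)
  show "complete_measure (lebesgue_on {0..a})"
    by (intro complete_measure.complete_measure_restrict_space completion.complete_measure_axioms) auto
  show "emeasure (lebesgue_on {0..a}) (space (lebesgue_on {0..a})) \<noteq> \<infinity>"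
    using emeasure_bounded_finite[of "{0..a}"] by (simp add: emeasure_restrict_space)
qed

lemma lebesgue_on_restrict:
  assumes "t \<le> a"
  shows "restrict_space (lebesgue_on {0..a}) {0..t} = lebesgue_on {0..t::real}"
proof -
  have "{0..a} \<inter> {0..t} = {0..t}" using assms by auto
  then show ?thesis by (subst restrict_restrict_space) auto
qed

lemma volterra_kernel_lebesgue:
  fixes K :: "real \<Rightarrow> real \<Rightarrow> 'x::banach \<Rightarrow>\<^sub>L 'x"
  assumes h: "mono_on {0..a} h"
    and K: "\<And>x. continuous_on {(t, s). 0 \<le> s \<and> s \<le> t \<and> t \<le> a} (\<lambda>(t, s). K t s x)"
      "\<And>t s. 0 \<le> s \<Longrightarrow> s \<le> t \<Longrightarrow> t \<le> a \<Longrightarrow> norm (K t s) \<le> L" and L: "0 < L"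
  shows "volterra_kernel a (lebesgue_on {0..a}) (\<lambda>t. {0..t}) K L (\<lambda>t. t + h t)"
proof (rule volterra_kernel.intro)
  show "complete_finite_measure (lebesgue_on {0..a})" by (rule complete_finite_measure_lebesgue_on)
  show "(\<lambda>x. x) \<in> borel_measurable (lebesgue_on {0..a})"
    by (intro measurable_restrict_space1 measurable_completion) auto
  show "{0..t} \<in> sets (lebesgue_on {0..a})" if "t \<in> {0..a}" for t
    using that by (subst sets_restrict_space_iff) auto
next
  fix t t' assume t: "0 \<le> t" "t \<le> t'" "t' \<le> (a::real)"
  have e: "{0..t'} - {0..t} = {t<..t'}" using t by auto
  have "measure (lebesgue_on {0..a}) {t<..t'} = t' - t"
    using t by (subst measure_restrict_space) auto
  then show "measure (lebesgue_on {0..a}) ({0..t'} - {0..t}) \<le> (t' + h t') - (t + h t)"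
    unfolding e using mono_onD[OF h(1), of t t'] t by simp
  show "t' - t \<le> (t' + h t') - (t + h t)" using mono_onD[OF h(1), of t t'] t by simp
qed (use K L in auto)

text \<open>The Cauchy--Schwarz inequality for \<open>w\<close> and an indicator function, from
  \<open>0 \<le> \<integral>(w - \<tau> 1\<^sub>A)\<^sup>2\<close> for all \<open>\<tau>\<close>.\<close>

lemma (in finite_measure) integral_indicator_le_sqrt:
  fixes w :: "'a \<Rightarrow> real"
  assumes w: "w \<in> borel_measurable M" "integrable M (\<lambda>x. (w x)\<^sup>2)" "\<And>x. 0 \<le> w x" and A: "A \<in> sets M"
  shows "integrable M w" "(\<integral>x. indicator A x * w x \<partial>M) \<le> sqrt (measure M A) * sqrt (\<integral>x. (w x)\<^sup>2 \<partial>M)"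
proof -
  have "w x \<le> 1 + (w x)\<^sup>2" for x using sum_squares_ge_zero[of "w x - 1" 0] w(3)[of x]
    by (simp add: power2_eq_square algebra_simps)
  then show wi: "integrable M w"
    using w by (intro Bochner_Integration.integrable_bound[of M "\<lambda>x. 1 + (w x)\<^sup>2" w]) auto
  define m W where "m = (\<integral>x. indicator A x * w x \<partial>M)" "W = (\<integral>x. (w x)\<^sup>2 \<partial>M)"
  have iw: "integrable M (\<lambda>x. indicator A x * w x)" using integrable_mult_indicator[OF A wi] by simp
  have ii: "integrable M (indicator A :: 'a \<Rightarrow> real)" using A by (auto simp: emeasure_eq_measure)
  have m0: "0 \<le> m" unfolding m_W_def using w(3) by (intro Bochner_Integration.integral_nonneg) auto
  have W0: "0 \<le> W" unfolding m_W_def by (intro Bochner_Integration.integral_nonneg) auto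
  have q: "2 * \<tau> * m \<le> W + \<tau>\<^sup>2 * measure M A" for \<tau>
  proof -
    have "2 * \<tau> * m = (\<integral>x. 2 * \<tau> * (indicator A x * w x) \<partial>M)" by (simp add: m_W_def)
    also have "\<dots> \<le> (\<integral>x. (w x)\<^sup>2 + \<tau>\<^sup>2 * indicator A x \<partial>M)"
    proof (rule integral_mono)
      show "integrable M (\<lambda>x. 2 * \<tau> * (indicator A x * w x))" using iw by simp
      show "integrable M (\<lambda>x. (w x)\<^sup>2 + \<tau>\<^sup>2 * indicator A x)" using w(2) ii by simp
      fix x
      show "2 * \<tau> * (indicator A x * w x) \<le> (w x)\<^sup>2 + \<tau>\<^sup>2 * indicator A x"
        using zero_le_power2[of "w x - \<tau>"] by (simp add: power2_eq_square algebra_simps split: split_indicator)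
    qed
    also have "\<dots> = W + \<tau>\<^sup>2 * measure M A"
      using w(2) ii A by (subst Bochner_Integration.integral_add) (auto simp: m_W_def)
    finally show ?thesis .
  qed
  have "m\<^sup>2 \<le> measure M A * W"
  proof (cases "measure M A = 0")
    case True
    have "m = 0"
    proof (rule ccontr)
      assume "m \<noteq> 0"
      then have "2 * ((W + 1) / m) * m = 2 * (W + 1)" by simp
      then show False using q[of "(W + 1) / m"] True W0 by simp
    qed
    then show ?thesis using True by simp
  next
    case False
    then have pos: "0 < measure M A" by (simp add: less_le)
    have "2 * (m / measure M A) * m \<le> W + (m / measure M A)\<^sup>2 * measure M A" by (rule q)
    then have "m\<^sup>2 / measure M A \<le> W" using pos by (simp add: power2_eq_square field_simps)
    then show ?thesis using pos by (simp add: field_simps)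
  qed
  then have "m \<le> sqrt (measure M A * W)" by (rule real_le_rsqrt)
  then show "(\<integral>x. indicator A x * w x \<partial>M) \<le> sqrt (measure M A) * sqrt (\<integral>x. (w x)\<^sup>2 \<partial>M)"
    by (simp add: m_W_def real_sqrt_mult)
qed

lemma L2_integrable:
  assumes a: "0 \<le> a" and u: "u \<in> L2 a"
  shows "norm_integrable (lebesgue_on {0..a}) u"
    and "A \<in> sets (lebesgue_on {0..a}) \<Longrightarrow>
      (\<integral>t. indicator A t * norm (u t) \<partial>lebesgue_on {0..a}) \<le> sqrt (measure (lebesgue_on {0..a}) A) * L2_norm a u"
    and "(\<integral>t. norm (u t) \<partial>lebesgue_on {0..a}) \<le> sqrt a * L2_norm a u"
proof -
  interpret complete_finite_measure "lebesgue_on {0..a}" by (rule complete_finite_measure_lebesgue_on)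
  have sm: "strongly_measurable (lebesgue_on {0..a}) u" and sq: "integrable (lebesgue_on {0..a}) (\<lambda>t. (norm (u t))\<^sup>2)"
    using u by (auto simp: L2_def)
  note * = integral_indicator_le_sqrt[OF strongly_measurable_norm[OF sm] sq norm_ge_zero]
  show "norm_integrable (lebesgue_on {0..a}) u" unfolding norm_integrable_def using sm *(1)[of "{}"] by auto
  show le: "(\<integral>t. indicator A t * norm (u t) \<partial>lebesgue_on {0..a}) \<le> sqrt (measure (lebesgue_on {0..a}) A) * L2_norm a u"
    if "A \<in> sets (lebesgue_on {0..a})" for A using *(2)[OF that] by (simp add: L2_norm_def)
  have "(\<integral>t. norm (u t) \<partial>lebesgue_on {0..a}) = (\<integral>t. indicator {0..a} t * norm (u t) \<partial>lebesgue_on {0..a})"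
    by (intro Bochner_Integration.integral_cong) auto
  also have "\<dots> \<le> sqrt (measure (lebesgue_on {0..a}) {0..a}) * L2_norm a u"
    by (intro le) (auto simp: sets_restrict_space_iff)
  also have "measure (lebesgue_on {0..a}) {0..a} = a" using a by (subst measure_restrict_space) auto
  finally show "(\<integral>t. norm (u t) \<partial>lebesgue_on {0..a}) \<le> sqrt a * L2_norm a u" .
qed

text \<open>The set where all \<open>u n\<close> are bounded by \<open>m\<close> exhausts the interval as \<open>m\<close> grows, and by the
  Cauchy--Schwarz inequality the integrals over its complement are small uniformly in \<open>n\<close>.\<close>

lemma nearly_dominated_L2:
  fixes u :: "nat \<Rightarrow> real \<Rightarrow> 'k::banach" and V :: "'k \<Rightarrow>\<^sub>L 'x::banach"
  assumes a: "0 \<le> a" and u: "\<And>n. u n \<in> L2 a" "\<And>n. L2_norm a (u n) \<le> B"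
    and bdd: "AE t in lebesgue_on {0..a}. \<exists>b. \<forall>n. norm (u n t) \<le> b"
  shows "nearly_dominated (lebesgue_on {0..a}) (\<lambda>n t. V (u n t))"
  unfolding nearly_dominated_def
proof (intro allI impI)
  fix \<epsilon> :: real assume \<epsilon>: "0 < \<epsilon>"
  let ?M = "lebesgue_on {0..a}"
  interpret complete_finite_measure ?M by (rule complete_finite_measure_lebesgue_on)
  have sm: "strongly_measurable ?M (u n)" for n using u(1) by (auto simp: L2_def)
  have [measurable]: "(\<lambda>t. norm (u n t)) \<in> borel_measurable ?M" for n by (rule strongly_measurable_norm[OF sm])
  define S where "S m = {t \<in> space ?M. \<forall>n. norm (u n t) \<le> real m}" for m :: nat
  have S[measurable]: "S m \<in> sets ?M" for m unfolding S_def by measurable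
  have lim: "(\<lambda>m. measure ?M (space ?M - S m)) \<longlonglongrightarrow> measure ?M (\<Inter>m. space ?M - S m)"
  proof (rule finite_Lim_measure_decseq)
    show "range (\<lambda>m. space ?M - S m) \<subseteq> sets ?M" using S by auto
    show "decseq (\<lambda>m. space ?M - S m)"
      by (rule antimonoI) (auto simp: S_def intro: order_trans)
  qed
  have "measure ?M (\<Inter>m. space ?M - S m) = 0"
  proof -
    have "AE t in ?M. t \<notin> (\<Inter>m. space ?M - S m)"
      using bdd AE_space
    proof eventually_elim
      case (elim t)
      then obtain b where b: "\<And>n. norm (u n t) \<le> b" by blast
      obtain m :: nat where "b \<le> real m" using real_arch_simple by blast
      then have "t \<in> S m" using elim(2) b by (auto simp: S_def intro: order_trans)
      then show ?case by blast
    qed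
    then have "(\<Inter>m. space ?M - S m) \<in> null_sets ?M" unfolding null_sets_iff_AE by blast
    then show ?thesis by (rule measure_eq_0_null_sets)
  qed
  then have lim0: "(\<lambda>m. measure ?M (space ?M - S m)) \<longlonglongrightarrow> 0" using lim by simp
  have "(\<lambda>m. norm V * (sqrt (measure ?M (space ?M - S m)) * \<bar>B\<bar>)) \<longlonglongrightarrow> norm V * (sqrt 0 * \<bar>B\<bar>)"
    by (intro tendsto_intros lim0)
  then have "\<forall>\<^sub>F m in sequentially. norm V * (sqrt (measure ?M (space ?M - S m)) * \<bar>B\<bar>) < \<epsilon>"
    using \<epsilon> by (intro order_tendstoD(2)[where y = "norm V * (sqrt 0 * \<bar>B\<bar>)"]) auto
  then obtain m where m: "norm V * (sqrt (measure ?M (space ?M - S m)) * \<bar>B\<bar>) < \<epsilon>"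
    by (auto simp: eventually_sequentially)
  show "\<exists>A\<in>sets ?M. \<exists>\<phi>. integrable ?M \<phi> \<and> (\<forall>n. AE x in ?M. x \<in> A \<longrightarrow> norm (V (u n x)) \<le> \<phi> x) \<and>
     (\<forall>n. (\<integral>x. indicator (space ?M - A) x * norm (V (u n x)) \<partial>?M) \<le> \<epsilon>)"
  proof (intro bexI exI conjI allI)
    show "S m \<in> sets ?M" by (rule S)
    show "integrable ?M (\<lambda>_. norm V * real m)" by simp
    show "AE x in ?M. x \<in> S m \<longrightarrow> norm (V (u n x)) \<le> norm V * real m" for n
      by (intro AE_I2 impI order_trans[OF norm_blinfun] mult_left_mono) (auto simp: S_def)
    fix n
    have i: "integrable ?M (\<lambda>x. indicator (space ?M - S m) x * norm (u n x))"
      using integrable_mult_indicator[of "space ?M - S m" ?M "\<lambda>x. norm (u n x)"] S L2_integrable(1)[OF a u(1)[of n]]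
      by (simp add: norm_integrable_def sets.Diff)
    have "(\<integral>x. indicator (space ?M - S m) x * norm (V (u n x)) \<partial>?M)
        \<le> (\<integral>x. norm V * (indicator (space ?M - S m) x * norm (u n x)) \<partial>?M)"
      using i by (intro integral_mono_AE') (auto intro!: AE_I2 norm_blinfun split: split_indicator)
    also have "\<dots> = norm V * (\<integral>x. indicator (space ?M - S m) x * norm (u n x) \<partial>?M)" by simp
    also have "\<dots> \<le> norm V * (sqrt (measure ?M (space ?M - S m)) * L2_norm a (u n))"
      using S by (intro mult_left_mono L2_integrable(2)[OF a u(1)]) auto
    also have "\<dots> \<le> norm V * (sqrt (measure ?M (space ?M - S m)) * \<bar>B\<bar>)"
      using u(2)[of n] by (intro mult_left_mono) auto
    also have "\<dots> \<le> \<epsilon>" using m by simp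
    finally show "(\<integral>x. indicator (space ?M - S m) x * norm (V (u n x)) \<partial>?M) \<le> \<epsilon>" .
  qed
qed

section \<open>The steering map\<close>

text \<open>The initial and the terminal state are parameters because the steering map depends on them.\<close>

locale nonlocal_control =
  fixes a :: real and h :: "real \<Rightarrow> real" and R :: "real \<Rightarrow> real \<Rightarrow> 'x::complex_banach \<Rightarrow>\<^sub>L 'x"
    and V :: "'k::banach \<Rightarrow>\<^sub>L 'x" and \<delta> :: "real \<Rightarrow> 'x \<Rightarrow> 'x" and g :: "(real \<Rightarrow> 'x) \<Rightarrow> 'x"
    and n U P\<^sub>Z \<omega> :: "real \<Rightarrow> real" and Zinv :: "'x \<Rightarrow> real \<Rightarrow> 'k" and c d L\<^sub>1 L\<^sub>2 L\<^sub>3 :: real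
    and \<zeta>0 \<zeta>1 :: 'x
  assumes a_pos: "0 < a" and h_mono: "mono_on {0..a} h"
    and h_left: "\<forall>t\<in>{0<..a}. (h \<longlongrightarrow> h t) (at_left t)"
    and R_cont: "\<And>x. continuous_on {(t, s). 0 \<le> s \<and> s \<le> t \<and> t \<le> a} (\<lambda>(t, s). R t s x)"
    and L1: "0 < L\<^sub>1" and R_bound: "\<And>t s. 0 \<le> s \<Longrightarrow> s \<le> t \<Longrightarrow> t \<le> a \<Longrightarrow> norm (R t s) \<le> L\<^sub>1"
    and \<delta>_cont: "AE t in ls_upto a h a. continuous_on UNIV (\<delta> t)"
    and \<delta>_meas: "\<And>x. strongly_measurable (ls_upto a h a) (\<lambda>t. \<delta> t x)"
    and n: "\<And>t. t \<in> {0..a} \<Longrightarrow> 0 \<le> n t" "integrable (ls_upto a h a) n"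
    and \<omega>: "\<And>r. 0 \<le> r \<Longrightarrow> 0 \<le> \<omega> r" "mono_on {0..} \<omega>"
    and \<delta>_growth: "AE t in ls_upto a h a. \<forall>x. norm (\<delta> t x) \<le> n t * \<omega> (norm x)"
    and U: "\<And>t. t \<in> {0..a} \<Longrightarrow> 0 \<le> U t" "integrable (ls_upto a h a) U"
    and \<delta>_mnc: "AE t in ls_upto a h a. \<forall>B. bounded B \<longrightarrow> hausdorff_mnc (\<delta> t ` B) \<le> ennreal (U t) * hausdorff_mnc B"
    and g_cont: "regulated_continuous a g" and g_compact: "regulated_compact a g"
    and cd: "0 < c" "0 < d" and g_growth: "\<And>\<zeta>. \<zeta> \<in> regulated a \<Longrightarrow> norm (g \<zeta>) \<le> c * regulated_norm a \<zeta> + d"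
    and Zinv: "control_inverse a (control_op a R V) Zinv"
    and L2: "0 < L\<^sub>2" "norm V \<le> L\<^sub>2" and L3: "0 < L\<^sub>3" "\<And>q. L2_norm a (Zinv q) \<le> L\<^sub>3 * norm q"
    and PZ: "\<And>t. t \<in> {0..a} \<Longrightarrow> 0 \<le> P\<^sub>Z t" "integrable (lebesgue_on {0..a}) P\<^sub>Z"
    and Zinv_mnc: "AE t in lebesgue_on {0..a}. \<forall>Q. bounded Q \<longrightarrow>
      hausdorff_mnc ((\<lambda>q. Zinv q t) ` Q) \<le> ennreal (P\<^sub>Z t) * hausdorff_mnc Q"
begin

abbreviation "M\<^sub>h \<equiv> ls_upto a h a"
abbreviation "M\<^sub>L \<equiv> lebesgue_on {0..a}"
abbreviation p :: "real \<Rightarrow> real" where "p \<equiv> \<lambda>t. t + h t"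
abbreviation "IN \<equiv> integral\<^sup>L M\<^sub>h n"
abbreviation "IU \<equiv> integral\<^sup>L M\<^sub>h U"
abbreviation "IP \<equiv> integral\<^sup>L M\<^sub>L P\<^sub>Z"

sublocale H: volterra_kernel a "ls_upto a h a" "\<lambda>t. {0..<t}" R L\<^sub>1 "\<lambda>t. t + h t"
  using a_pos h_mono h_left R_cont R_bound L1 by (intro volterra_kernel_ls_upto) auto

sublocale Leb: volterra_kernel a "lebesgue_on {0..a}" "\<lambda>t. {0..t}" R L\<^sub>1 "\<lambda>t. t + h t"
  using h_mono R_cont R_bound L1 by (intro volterra_kernel_lebesgue) auto

text \<open>The values in \<open>[0, a]\<close> in the extensional form expected by \<open>g\<close>.\<close>

definition res :: "'x bfun \<Rightarrow> real \<Rightarrow> 'x" where "res F = restrict (val F) {0..a}"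

text \<open>Members vanish outside \<open>[0, a]\<close>, so that the norm of the ambient space is the norm on \<open>[0, a]\<close>.\<close>

definition admissible :: "real \<Rightarrow> 'x bfun set" where
  "admissible k = {F. equicontrolled a p {val F}} \<inter> {F. norm F \<le> k} \<inter> (\<Inter>t\<in>- {0..a}. {F. val F t = 0})"

definition forcing :: "'x bfun \<Rightarrow> real \<Rightarrow> 'x" where "forcing F s = \<delta> s (res F s)"

text \<open>What remains to be contributed by the control at time \<open>a\<close> to arrive at \<open>\<zeta>1 - g F\<close>.\<close>

definition target :: "'x bfun \<Rightarrow> 'x" where
  "target F = \<zeta>1 - g (res F) - R a 0 (\<zeta>0 - g (res F)) - H.volterra a (forcing F)"

definition control :: "'x bfun \<Rightarrow> real \<Rightarrow> 'k" where "control F = Zinv (target F)"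

definition steered :: "'x bfun \<Rightarrow> real \<Rightarrow> 'x" where
  "steered F t = (if t \<in> {0..a} then
     R t 0 (\<zeta>0 - g (res F)) + Leb.volterra t (\<lambda>s. V (control F s)) + H.volterra t (forcing F) else 0)"

definition steer :: "'x bfun \<Rightarrow> 'x bfun" where "steer F = bfun_of (steered F)"

lemma space_MH: "space M\<^sub>h = {0..<a}" by (simp add: space_ls_upto)

lemma mono_p: "mono_on {0..a} p"
  using h_mono by (auto simp: mono_on_def intro: add_mono)

lemma p_dist:
  assumes "t \<in> {0..a}" "t' \<in> {0..a}"
  shows "\<bar>t - t'\<bar> \<le> \<bar>p t - p t'\<bar>"
  using assms mono_onD[OF h_mono, of t t'] mono_onD[OF h_mono, of t' t] by (cases "t \<le> t'") auto

lemma admissibleD: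
  assumes "F \<in> admissible k"
  shows "equicontrolled a p {val F}" "norm F \<le> k" "t \<notin> {0..a} \<Longrightarrow> val F t = 0"
    "norm (val F t) \<le> k" "t \<in> {0..a} \<Longrightarrow> norm (res F t) \<le> k" "res F \<in> regulated a" "0 \<le> k"
proof -
  show F: "equicontrolled a p {val F}" "norm F \<le> k" "t \<notin> {0..a} \<Longrightarrow> val F t = 0"
    using assms by (auto simp: admissible_def)
  show le: "norm (val F t) \<le> k" for t using norm_val_le[of F t] F(2) by simp
  show "norm (res F t) \<le> k" if "t \<in> {0..a}" using le[of t] that by (simp add: res_def)
  show "res F \<in> regulated a" unfolding res_def using mono_p F(1) by (rule controlled_regulated)
  show "0 \<le> k" using F(2) norm_ge_zero[of F] by linarith
qed

lemma closed_admissible: "closed (admissible k)"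
proof -
  have "closed {F :: 'x bfun. val F t = 0}" for t
    by (intro closed_Collect_eq linear_continuous_on bounded_linear_val continuous_on_const)
  moreover have "closed {F :: 'x bfun. norm F \<le> k}" by (intro closed_Collect_le continuous_intros)
  ultimately show ?thesis unfolding admissible_def by (intro closed_Int closed_INT closed_controlled ballI) auto
qed

lemma convex_admissible: "convex (admissible k)"
proof -
  have "convex {F :: 'x bfun. val F t = 0}" for t by (rule convexI) auto
  moreover have "convex {F :: 'x bfun. norm F \<le> k}"
    using convex_cball[of "0 :: 'x bfun" k] by (simp add: cball_def)
  ultimately show ?thesis unfolding admissible_def by (intro convex_Int convex_INT convex_controlled) auto
qed

lemma zero_admissible: "0 \<le> k \<Longrightarrow> 0 \<in> admissible k"
  by (auto simp: admissible_def intro!: controlledI exI[of _ 1])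

lemma g_bound:
  assumes "F \<in> admissible k"
  shows "norm (g (res F)) \<le> c * k + d"
proof -
  have "regulated_norm a (res F) \<le> k" using a_pos admissibleD(5)[OF assms] by (intro regulated_norm_le) auto
  then have "c * regulated_norm a (res F) + d \<le> c * k + d" using cd by simp
  then show ?thesis using g_growth[OF admissibleD(6)[OF assms]] by linarith
qed

lemma forcing:
  assumes F: "F \<in> admissible k"
  shows "strongly_measurable M\<^sub>h (forcing F)" "AE s in M\<^sub>h. norm (forcing F s) \<le> n s * \<omega> k"
    "norm_integrable M\<^sub>h (forcing F)" "(\<integral>s. norm (forcing F s) \<partial>M\<^sub>h) \<le> IN * \<omega> k"
proof -
  have "strongly_measurable M\<^sub>h (res F)"
    unfolding res_def using mono_p a_pos equicontrolled_restrict[OF admissibleD(1)[OF F]] H.ident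
    by (intro controlled_strongly_measurable[of a p]) (auto simp: space_MH)
  then show sm: "strongly_measurable M\<^sub>h (forcing F)"
    unfolding forcing_def by (rule H.strongly_measurable_caratheodory[where \<phi> = \<delta>, OF \<delta>_cont \<delta>_meas])
  show le: "AE s in M\<^sub>h. norm (forcing F s) \<le> n s * \<omega> k"
    using \<delta>_growth AE_space
  proof eventually_elim
    case (elim s)
    then have s: "s \<in> {0..a}" by (auto simp: space_MH)
    have "norm (forcing F s) \<le> n s * \<omega> (norm (res F s))" using elim(1) by (simp add: forcing_def)
    also have "\<dots> \<le> n s * \<omega> k"
      using admissibleD(5)[OF F, of s] admissibleD(7)[OF F] s n(1)[OF s] by (intro mult_left_mono mono_onD[OF \<omega>(2)]) auto
    finally show ?case .
  qed
  have i: "integrable M\<^sub>h (\<lambda>s. n s * \<omega> k)" using n(2) by simp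
  show ni: "norm_integrable M\<^sub>h (forcing F)"
    by (rule norm_integrable_dominated[OF H.complete_measure_axioms sm i le])
  have "(\<integral>s. norm (forcing F s) \<partial>M\<^sub>h) \<le> (\<integral>s. n s * \<omega> k \<partial>M\<^sub>h)"
    using ni i le by (intro integral_mono_AE) (auto simp: norm_integrable_def)
  then show "(\<integral>s. norm (forcing F s) \<partial>M\<^sub>h) \<le> IN * \<omega> k" by simp
qed

lemma norm_R0: "t \<in> {0..a} \<Longrightarrow> norm (R t 0 x) \<le> L\<^sub>1 * norm x"
  using R_bound[of 0 t] by (intro order_trans[OF norm_blinfun] mult_right_mono) auto

lemma target_bound:
  assumes F: "F \<in> admissible k"
  shows "norm (target F) \<le> norm \<zeta>1 + (c * k + d) + L\<^sub>1 * (norm \<zeta>0 + (c * k + d)) + L\<^sub>1 * (IN * \<omega> k)"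
proof -
  have at: "a \<in> {0..a}" using a_pos by simp
  have 1: "norm (\<zeta>0 - g (res F)) \<le> norm \<zeta>0 + (c * k + d)"
    using norm_triangle_ineq4[of \<zeta>0 "g (res F)"] g_bound[OF F] by linarith
  have 2: "norm (R a 0 (\<zeta>0 - g (res F))) \<le> L\<^sub>1 * (norm \<zeta>0 + (c * k + d))"
    by (rule order_trans[OF norm_R0[OF at]]) (use 1 L1 in simp)
  have 3: "norm (H.volterra a (forcing F)) \<le> L\<^sub>1 * (IN * \<omega> k)"
    by (rule order_trans[OF H.norm_volterra_le[OF at forcing(3)[OF F]]]) (use forcing(4)[OF F] L1 in simp)
  show ?thesis unfolding target_def
    using norm_triangle_ineq4[of "\<zeta>1 - g (res F) - R a 0 (\<zeta>0 - g (res F))" "H.volterra a (forcing F)"]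
      norm_triangle_ineq4[of "\<zeta>1 - g (res F)" "R a 0 (\<zeta>0 - g (res F))"] norm_triangle_ineq4[of \<zeta>1 "g (res F)"]
      2 3 g_bound[OF F] by linarith
qed

lemma control_L2: "Zinv q \<in> L2 a"
  using Zinv by (simp add: control_inverse_def)

lemma V_integrable:
  assumes w: "norm_integrable M\<^sub>L w"
  shows "norm_integrable M\<^sub>L (\<lambda>s. V (w s))" "(\<integral>s. norm (V (w s)) \<partial>M\<^sub>L) \<le> L\<^sub>2 * (\<integral>s. norm (w s) \<partial>M\<^sub>L)"
proof -
  have le: "norm (V (w s)) \<le> L\<^sub>2 * norm (w s)" for s
    using norm_blinfun[of V "w s"] L2(2) by (meson mult_right_mono norm_ge_zero order_trans)
  have i: "integrable M\<^sub>L (\<lambda>s. L\<^sub>2 * norm (w s))" using w by (simp add: norm_integrable_def)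
  show ni: "norm_integrable M\<^sub>L (\<lambda>s. V (w s))"
  proof (rule norm_integrable_dominated[OF Leb.complete_measure_axioms _ i])
    show "strongly_measurable M\<^sub>L (\<lambda>s. V (w s))"
      using w unfolding norm_integrable_def
      by (intro Leb.strongly_measurable_bounded_linear[OF blinfun.bounded_linear_right]) (rule conjunct1)
    show "AE s in M\<^sub>L. norm (V (w s)) \<le> L\<^sub>2 * norm (w s)" using le by (intro AE_I2)
  qed
  have "(\<integral>s. norm (V (w s)) \<partial>M\<^sub>L) \<le> (\<integral>s. L\<^sub>2 * norm (w s) \<partial>M\<^sub>L)"
    using ni i le by (intro integral_mono) (auto simp: norm_integrable_def)
  then show "(\<integral>s. norm (V (w s)) \<partial>M\<^sub>L) \<le> L\<^sub>2 * (\<integral>s. norm (w s) \<partial>M\<^sub>L)" by simp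
qed

lemma control_integrable: "norm_integrable M\<^sub>L (\<lambda>s. V (Zinv q s))"
  by (intro V_integrable(1) L2_integrable(1) control_L2) (use a_pos in simp)

lemma control_integral_le: "(\<integral>s. norm (V (Zinv q s)) \<partial>M\<^sub>L) \<le> L\<^sub>2 * (sqrt a * (L\<^sub>3 * norm q))"
proof -
  have a0: "0 \<le> a" using a_pos by simp
  have "(\<integral>s. norm (V (Zinv q s)) \<partial>M\<^sub>L) \<le> L\<^sub>2 * (\<integral>s. norm (Zinv q s) \<partial>M\<^sub>L)"
    by (intro V_integrable(2) L2_integrable(1) control_L2 a0)
  also have "\<dots> \<le> L\<^sub>2 * (sqrt a * L2_norm a (Zinv q))"
    using L2(1) L2_integrable(3)[OF a0 control_L2] by (intro mult_left_mono) auto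
  also have "\<dots> \<le> L\<^sub>2 * (sqrt a * (L\<^sub>3 * norm q))"
    using L2(1) L3(2)[of q] a0 by (intro mult_left_mono) auto
  finally show ?thesis .
qed

text \<open>The difference of the controls for \<open>q\<close> and \<open>q'\<close> is almost everywhere the control for \<open>q - q'\<close>.\<close>

lemma control_difference_le:
  "(\<integral>s. norm (V (Zinv q s) - V (Zinv q' s)) \<partial>M\<^sub>L) \<le> L\<^sub>2 * (sqrt a * (L\<^sub>3 * norm (q - q')))"
proof -
  have "AE s in M\<^sub>L. Zinv ((q - q') + q') s = Zinv (q - q') s + Zinv q' s"
    using Zinv unfolding control_inverse_def by blast
  then have eq: "AE s in M\<^sub>L. norm (V (Zinv q s) - V (Zinv q' s)) = norm (V (Zinv (q - q') s))"
    by eventually_elim (simp add: blinfun.add_right)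
  have "(\<integral>s. norm (V (Zinv q s) - V (Zinv q' s)) \<partial>M\<^sub>L) = (\<integral>s. norm (V (Zinv (q - q') s)) \<partial>M\<^sub>L)"
    using eq norm_integrable_diff[OF Leb.complete_measure_axioms control_integrable control_integrable] control_integrable
    by (intro integral_cong_AE) (auto simp: norm_integrable_def)
  then show ?thesis using control_integral_le[of "q - q'"] by simp
qed

definition growth :: "real \<Rightarrow> real" where
  "growth k = L\<^sub>1 * (norm \<zeta>0 + (c * k + d)) + L\<^sub>1 * (L\<^sub>2 * (sqrt a * (L\<^sub>3 *
     (norm \<zeta>1 + (c * k + d) + L\<^sub>1 * (norm \<zeta>0 + (c * k + d)) + L\<^sub>1 * (IN * \<omega> k))))) + L\<^sub>1 * (IN * \<omega> k)"

lemma steered_bound: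
  assumes F: "F \<in> admissible k" and t: "t \<in> {0..a}"
  shows "norm (steered F t) \<le> growth k"
proof -
  have "norm (\<zeta>0 - g (res F)) \<le> norm \<zeta>0 + (c * k + d)"
    using norm_triangle_ineq4[of \<zeta>0 "g (res F)"] g_bound[OF F] by linarith
  then have 1: "norm (R t 0 (\<zeta>0 - g (res F))) \<le> L\<^sub>1 * (norm \<zeta>0 + (c * k + d))"
    using L1 by (intro order_trans[OF norm_R0[OF t]] mult_left_mono) auto
  have "norm (Leb.volterra t (\<lambda>s. V (control F s))) \<le> L\<^sub>1 * (L\<^sub>2 * (sqrt a * (L\<^sub>3 * norm (target F))))"
    unfolding control_def using L1
    by (intro order_trans[OF Leb.norm_volterra_le[OF t control_integrable]] mult_left_mono control_integral_le) auto
  also have "\<dots> \<le> L\<^sub>1 * (L\<^sub>2 * (sqrt a * (L\<^sub>3 *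
     (norm \<zeta>1 + (c * k + d) + L\<^sub>1 * (norm \<zeta>0 + (c * k + d)) + L\<^sub>1 * (IN * \<omega> k)))))"
    using L1 L2(1) L3(1) a_pos by (intro mult_left_mono target_bound F) auto
  finally have 2: "norm (Leb.volterra t (\<lambda>s. V (control F s))) \<le> \<dots>" .
  have 3: "norm (H.volterra t (forcing F)) \<le> L\<^sub>1 * (IN * \<omega> k)"
    using L1 forcing(4)[OF F] by (intro order_trans[OF H.norm_volterra_le[OF t forcing(3)[OF F]]] mult_left_mono) auto
  have "norm (steered F t) \<le> norm (R t 0 (\<zeta>0 - g (res F))) + norm (Leb.volterra t (\<lambda>s. V (control F s))) + norm (H.volterra t (forcing F))"
    unfolding steered_def using t by (auto intro!: order_trans[OF norm_triangle_ineq] add_mono norm_triangle_ineq)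
  then show ?thesis using 1 2 3 unfolding growth_def by linarith
qed

lemma val_steer:
  assumes F: "F \<in> admissible k"
  shows "val (steer F) = steered F"
  unfolding steer_def
proof (rule val_bfun_of)
  fix t show "norm (steered F t) \<le> max 0 (growth k)"
    using steered_bound[OF F, of t] by (cases "t \<in> {0..a}") (auto simp: steered_def)
qed

text \<open>The two terms on which everything depends are the change of \<open>g\<close> and the mean change of the impulses; the
  change of the control is estimated through that of the target.\<close>

lemma steer_diff_le:
  assumes F: "F \<in> admissible k" and G: "G \<in> admissible k"
  defines "dg \<equiv> norm (g (res F) - g (res G))" and "D \<equiv> \<integral>s. norm (forcing F s - forcing G s) \<partial>M\<^sub>h"
  shows "norm (steer F - steer G) \<le> L\<^sub>1 * dg + L\<^sub>1 * (L\<^sub>2 * (sqrt a * (L\<^sub>3 * (dg + L\<^sub>1 * dg + L\<^sub>1 * D)))) + L\<^sub>1 * D"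
    (is "_ \<le> ?b")
proof (rule norm_bfun_le)
  have D0: "0 \<le> D" "0 \<le> dg" 
    unfolding D_def dg_def by (rule Bochner_Integration.integral_nonneg, simp, simp)
  have R0: "norm (R t 0 (\<zeta>0 - g (res F)) - R t 0 (\<zeta>0 - g (res G))) \<le> L\<^sub>1 * dg" if "t \<in> {0..a}" for t
    using norm_R0[OF that, of "g (res G) - g (res F)"] unfolding dg_def
    by (simp add: blinfun.diff_right algebra_simps norm_minus_commute)
  have Hd: "norm (H.volterra t (forcing F) - H.volterra t (forcing G)) \<le> L\<^sub>1 * D" if "t \<in> {0..a}" for t
    unfolding D_def using that by (intro H.volterra_diff_le forcing[OF F] forcing[OF G])
  have at: "a \<in> {0..a}" using a_pos by simp
  have T: "norm (target F - target G) \<le> dg + L\<^sub>1 * dg + L\<^sub>1 * D"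
  proof -
    define x y z where "x = g (res F) - g (res G)" "y = R a 0 (\<zeta>0 - g (res F)) - R a 0 (\<zeta>0 - g (res G))"
      "z = H.volterra a (forcing F) - H.volterra a (forcing G)"
    have "target F - target G = - x - y - z" by (simp add: target_def x_y_z_def)
    moreover have "norm (- x - y - z) \<le> norm x + norm y + norm z"
      using norm_triangle_ineq4[of "- x - y" z] norm_triangle_ineq4[of "- x" y] by simp
    moreover have "norm x = dg" "norm y \<le> L\<^sub>1 * dg" "norm z \<le> L\<^sub>1 * D"
      using R0[OF at] Hd[OF at] by (simp_all add: x_y_z_def dg_def)
    ultimately show ?thesis by simp
  qed
  fix t
  show "norm (val (steer F - steer G) t) \<le> ?b"
  proof (cases "t \<in> {0..a}")
    case False
    have "0 \<le> ?b" using D0 L1 L2(1) L3(1) a_pos by (intro add_nonneg_nonneg mult_nonneg_nonneg) auto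
    then show ?thesis using False by (simp add: val_steer[OF F] val_steer[OF G] steered_def del: atLeastAtMost_iff)
  next
    case t: True
    have "norm (Leb.volterra t (\<lambda>s. V (control F s)) - Leb.volterra t (\<lambda>s. V (control G s)))
        \<le> L\<^sub>1 * (\<integral>s. norm (V (control F s) - V (control G s)) \<partial>M\<^sub>L)"
      unfolding control_def by (intro Leb.volterra_diff_le t control_integrable)
    also have "\<dots> \<le> L\<^sub>1 * (L\<^sub>2 * (sqrt a * (L\<^sub>3 * norm (target F - target G))))"
      unfolding control_def using L1 by (intro mult_left_mono control_difference_le) auto
    also have "\<dots> \<le> L\<^sub>1 * (L\<^sub>2 * (sqrt a * (L\<^sub>3 * (dg + L\<^sub>1 * dg + L\<^sub>1 * D))))"
      using L1 L2(1) L3(1) a_pos by (intro mult_left_mono T) auto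
    finally have C: "norm (Leb.volterra t (\<lambda>s. V (control F s)) - Leb.volterra t (\<lambda>s. V (control G s))) \<le> \<dots>" .
    have "val (steer F - steer G) t = (R t 0 (\<zeta>0 - g (res F)) - R t 0 (\<zeta>0 - g (res G)))
        + (Leb.volterra t (\<lambda>s. V (control F s)) - Leb.volterra t (\<lambda>s. V (control G s)))
        + (H.volterra t (forcing F) - H.volterra t (forcing G))"
      using t by (simp add: val_steer[OF F] val_steer[OF G] steered_def)
    also have "norm \<dots> \<le> ?b"
      by (rule order_trans[OF norm_triangle_ineq
            add_mono[OF order_trans[OF norm_triangle_ineq add_mono[OF R0[OF t] C]] Hd[OF t]]])
    finally show ?thesis .
  qed
qed

text \<open>The mean change of the impulses tends to zero by dominated convergence.\<close>

lemma continuous_on_steer: "continuous_on (admissible k) steer"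
  unfolding continuous_on_sequentially
proof (intro allI ballI impI)
  fix X F assume F: "F \<in> admissible k" and "(\<forall>j. X j \<in> admissible k) \<and> X \<longlonglongrightarrow> F"
  then have X: "\<And>j. X j \<in> admissible k" and lim: "X \<longlonglongrightarrow> F" by auto
  define dg where "dg j = norm (g (res (X j)) - g (res F))" for j
  define D where "D j = (\<integral>s. norm (forcing (X j) s - forcing F s) \<partial>M\<^sub>h)" for j
  have dg: "dg \<longlonglongrightarrow> 0"
  proof (rule LIMSEQ_I)
    fix e :: real assume "0 < e"
    then obtain r where r: "r > 0" "\<And>f'. f' \<in> regulated a \<Longrightarrow> regulated_norm a (\<lambda>t. f' t - res F t) < r \<Longrightarrow> norm (g f' - g (res F)) < e"
      using g_cont admissibleD(6)[OF F] unfolding regulated_continuous_def by blast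
    obtain N where N: "\<And>j. j \<ge> N \<Longrightarrow> norm (X j - F) < r" using LIMSEQ_D[OF lim r(1)] by blast
    have "norm (dg j - 0) < e" if "j \<ge> N" for j
    proof -
      have "regulated_norm a (\<lambda>t. res (X j) t - res F t) \<le> norm (X j - F)"
      proof (rule regulated_norm_le)
        fix t assume t: "t \<in> {0..a}"
        show "norm (res (X j) t - res F t) \<le> norm (X j - F)"
          using t norm_val_le[of "X j - F" t] by (simp add: res_def)
      qed (use a_pos in simp)
      then have "norm (g (res (X j)) - g (res F)) < e"
        using N[OF that] by (intro r(2) admissibleD(6)[OF X]) simp
      then show ?thesis by (simp add: dg_def)
    qed
    then show "\<exists>N. \<forall>j\<ge>N. norm (dg j - 0) < e" by blast
  qed
  have D: "D \<longlonglongrightarrow> 0"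
  proof -
    have "D \<longlonglongrightarrow> (\<integral>s. 0 \<partial>M\<^sub>h)"
      unfolding D_def
    proof (rule integral_dominated_convergence[where w = "\<lambda>s. 2 * (n s * \<omega> k)"])
      show "(\<lambda>s. norm (forcing (X j) s - forcing F s)) \<in> borel_measurable M\<^sub>h" for j
        by (intro H.strongly_measurable_norm strongly_measurable_diff forcing(1)[OF X] forcing(1)[OF F])
      show "integrable M\<^sub>h (\<lambda>s. 2 * (n s * \<omega> k))" using n(2) by simp
      show "AE s in M\<^sub>h. norm (norm (forcing (X j) s - forcing F s)) \<le> 2 * (n s * \<omega> k)" for j
        using forcing(2)[OF X[of j]] forcing(2)[OF F]
      proof eventually_elim
        case (elim s)
        then show ?case using norm_triangle_ineq4[of "forcing (X j) s" "forcing F s"] by simp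
      qed
      show "AE s in M\<^sub>h. (\<lambda>j. norm (forcing (X j) s - forcing F s)) \<longlonglongrightarrow> 0"
        using \<delta>_cont AE_space
      proof eventually_elim
        case (elim s)
        then have s: "s \<in> {0..a}" by (auto simp: space_MH)
        have "(\<lambda>j. val (X j) s) \<longlonglongrightarrow> val F s" by (rule bounded_linear.tendsto[OF bounded_linear_val lim])
        then have "(\<lambda>j. res (X j) s) \<longlonglongrightarrow> res F s" using s by (simp add: res_def)
        moreover have "isCont (\<delta> s) (res F s)" using elim(1) by (simp add: continuous_on_eq_continuous_at)
        ultimately have "(\<lambda>j. forcing (X j) s) \<longlonglongrightarrow> forcing F s"
          unfolding forcing_def by (rule isCont_tendsto_compose[rotated])
        then have "(\<lambda>j. norm (forcing (X j) s - forcing F s)) \<longlonglongrightarrow> norm (forcing F s - forcing F s)" by (intro tendsto_intros)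
        then show ?case by simp
      qed
    qed simp
    then show ?thesis by simp
  qed
  let ?b = "\<lambda>j. L\<^sub>1 * dg j + L\<^sub>1 * (L\<^sub>2 * (sqrt a * (L\<^sub>3 * (dg j + L\<^sub>1 * dg j + L\<^sub>1 * D j)))) + L\<^sub>1 * D j"
  have "?b \<longlonglongrightarrow> L\<^sub>1 * 0 + L\<^sub>1 * (L\<^sub>2 * (sqrt a * (L\<^sub>3 * (0 + L\<^sub>1 * 0 + L\<^sub>1 * 0)))) + L\<^sub>1 * 0"
    by (intro tendsto_intros dg D)
  then have b: "?b \<longlonglongrightarrow> 0" by simp
  have "norm (steer (X j) - steer F) \<le> ?b j" for j
    unfolding dg_def D_def by (rule steer_diff_le[OF X F])
  then have "(\<lambda>j. steer (X j) - steer F) \<longlonglongrightarrow> 0"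
    by (intro Lim_null_comparison[OF always_eventually b]) blast
  then show "(steer \<circ> X) \<longlonglongrightarrow> steer F" unfolding comp_def by (rule LIM_zero_cancel)
qed

definition pointwise_net :: "real \<Rightarrow> (nat \<Rightarrow> 'x bfun) \<Rightarrow> bool" where
  "pointwise_net \<Lambda> F \<longleftrightarrow> (\<forall>t\<in>{0..a}. \<forall>r>\<Lambda>. finite_net r (range (\<lambda>j. val (F j) t)))"

text \<open>The factor from a radius valid for the trajectories at each time to one for what the
  impulses contribute at a later time.\<close>

abbreviation "q\<^sub>1 \<equiv> 2 * L\<^sub>1 * IU"

lemma IU_nonneg: "0 \<le> IU"
proof (rule Bochner_Integration.integral_nonneg_AE, rule AE_I2)
  fix s assume "s \<in> space M\<^sub>h"
  then show "0 \<le> U s" by (intro U(1)) (simp add: space_MH)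
qed

lemma IP_nonneg: "0 \<le> IP"
proof (rule Bochner_Integration.integral_nonneg_AE, rule AE_I2)
  fix s assume "s \<in> space M\<^sub>L"
  then show "0 \<le> P\<^sub>Z s" by (intro PZ(1)) simp
qed

context
  fixes F :: "nat \<Rightarrow> 'x bfun" and k
  assumes F: "\<And>j. F j \<in> admissible k"
begin

lemma res_bounded:
  assumes "t \<in> {0..a}"
  shows "bounded (range (\<lambda>j. res (F j) t))"
  unfolding bounded_iff
proof (intro exI ballI)
  fix x assume "x \<in> range (\<lambda>j. res (F j) t)"
  then obtain j where "x = res (F j) t" by (rule rangeE)
  then show "norm x \<le> k" using admissibleD(5)[OF F[of j] assms] by simp
qed

lemma pointwise_net_radius: "pointwise_net k F"
  unfolding pointwise_net_def
proof (intro ballI allI impI)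
  fix t r assume "k < r"
  then have "\<forall>j. norm (val (F j) t - 0) \<le> r" using order_trans[OF admissibleD(4)[OF F]] by simp
  then show "finite_net r (range (\<lambda>j. val (F j) t))"
    unfolding finite_net_def by (intro exI[of _ "{0}"]) auto
qed

text \<open>Compactness of \<open>g\<close>: the nonlocal term does not contribute to noncompactness.\<close>

lemma g_net: "0 < e \<Longrightarrow> finite_net e (range (\<lambda>j. g (res (F j))))"
proof -
  assume e: "0 < e"
  have "range (\<lambda>j. res (F j)) \<subseteq> regulated a" using admissibleD(6)[OF F] by auto
  moreover have "\<forall>f\<in>range (\<lambda>j. res (F j)). regulated_norm a f \<le> k"
  proof
    fix f assume "f \<in> range (\<lambda>j. res (F j))"
    then obtain j where f: "f = res (F j)" by (rule rangeE)
    show "regulated_norm a f \<le> k"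
      unfolding f using a_pos admissibleD(5)[OF F[of j]] by (intro regulated_norm_le) auto
  qed
  ultimately have "compact (closure (g ` range (\<lambda>j. res (F j))))" using g_compact unfolding regulated_compact_def by blast
  then have "finite_net e (g ` range (\<lambda>j. res (F j)))" using closure_subset e by (rule compact_imp_finite_net)
  then show ?thesis by (simp add: image_image)
qed

lemma forcing_dominated: "nearly_dominated M\<^sub>h (\<lambda>j. forcing (F j))"
proof (rule nearly_dominatedI_dominated)
  show "integrable M\<^sub>h (\<lambda>s. n s * \<omega> k)" using n(2) by simp
qed (rule forcing(2)[OF F])

lemma forcing_net:
  assumes \<Lambda>: "0 \<le> \<Lambda>" "pointwise_net \<Lambda> F"
  shows "AE s in M\<^sub>h. \<forall>r>U s * \<Lambda>. finite_net r (range (\<lambda>j. forcing (F j) s))"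
  using \<delta>_mnc AE_space
proof eventually_elim
  case (elim s)
  then have s: "s \<in> {0..a}" by (auto simp: space_MH)
  have "hausdorff_mnc (\<delta> s ` range (\<lambda>j. res (F j) s)) \<le> ennreal (U s) * hausdorff_mnc (range (\<lambda>j. res (F j) s))"
    using elim(1) res_bounded[OF s] by blast
  moreover have "finite_net r (range (\<lambda>j. res (F j) s))" if "\<Lambda> < r" for r
    using \<Lambda>(2) s that unfolding pointwise_net_def res_def by simp
  ultimately have "finite_net r (\<delta> s ` range (\<lambda>j. res (F j) s))" if "U s * \<Lambda> < r" for r
    using that U(1)[OF s] \<Lambda>(1) by (rule_tac hausdorff_mnc_le_imp_finite_nets) auto
  then show ?case by (simp add: forcing_def image_image)
qed

lemma H_net:
  assumes \<Lambda>: "0 \<le> \<Lambda>" "pointwise_net \<Lambda> F" and t: "t \<in> {0..a}" and r: "q\<^sub>1 * \<Lambda> < r"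
  shows "finite_net r (range (\<lambda>j. H.volterra t (forcing (F j))))"
proof -
  have "finite_net (2 * L\<^sub>1 * (\<integral>s. U s * \<Lambda> \<partial>M\<^sub>h) + (r - q\<^sub>1 * \<Lambda>)) (range (\<lambda>j. H.volterra t (forcing (F j))))"
  proof (rule H.volterra_finite_net[OF t forcing(3)[OF F] forcing_dominated _ _ forcing_net[OF \<Lambda>]])
    show "integrable M\<^sub>h (\<lambda>s. U s * \<Lambda>)" using U(2) by simp
    show "AE s in M\<^sub>h. 0 \<le> U s * \<Lambda>" using U(1) \<Lambda>(1) by (intro AE_I2) (auto simp: space_MH)
  qed (use r in simp)
  then show ?thesis by (simp add: mult.assoc)
qed

lemma orbit_net:
  assumes t: "t \<in> {0..a}" and e: "0 < e"
  shows "finite_net e (range (\<lambda>j. R t 0 (\<zeta>0 - g (res (F j)))))"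
proof -
  have "finite_net (L\<^sub>1 * (e / L\<^sub>1)) ((\<lambda>x. R t 0 (\<zeta>0 - x)) ` range (\<lambda>j. g (res (F j))))"
  proof (rule finite_net_lipschitz_image[OF g_net])
    show "norm (R t 0 (\<zeta>0 - x) - R t 0 (\<zeta>0 - y)) \<le> L\<^sub>1 * norm (x - y)" for x y
      using norm_R0[OF t, of "y - x"] by (simp add: blinfun.diff_right algebra_simps norm_minus_commute)
  qed (use e L1 in auto)
  then show ?thesis using L1 by (simp add: image_image)
qed

text \<open>Only the impulses contribute, the other terms being a Lipschitz image of the totally bounded set of values of \<open>g\<close>.\<close>

lemma target_net:
  assumes \<Lambda>: "0 \<le> \<Lambda>" "pointwise_net \<Lambda> F" and r: "q\<^sub>1 * \<Lambda> < r"
  shows "finite_net r (range (\<lambda>j. target (F j)))"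
proof -
  define \<epsilon> where "\<epsilon> = (r - q\<^sub>1 * \<Lambda>) / 2"
  have \<epsilon>: "0 < \<epsilon>" and less: "q\<^sub>1 * \<Lambda> < r - \<epsilon>" using r by (auto simp: \<epsilon>_def field_simps)
  have at: "a \<in> {0..a}" using a_pos by simp
  have "finite_net ((1 + L\<^sub>1) * (\<epsilon> / (1 + L\<^sub>1))) ((\<lambda>x. \<zeta>1 - x - R a 0 (\<zeta>0 - x)) ` range (\<lambda>j. g (res (F j))))"
  proof (rule finite_net_lipschitz_image[OF g_net])
    fix x y
    have "(\<zeta>1 - x - R a 0 (\<zeta>0 - x)) - (\<zeta>1 - y - R a 0 (\<zeta>0 - y)) = (y - x) - R a 0 (y - x)"
      by (simp add: blinfun.diff_right)
    also have "norm \<dots> \<le> norm (y - x) + L\<^sub>1 * norm (y - x)"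
      using norm_triangle_ineq4[of "y - x" "R a 0 (y - x)"] norm_R0[OF at, of "y - x"] by linarith
    finally show "norm ((\<zeta>1 - x - R a 0 (\<zeta>0 - x)) - (\<zeta>1 - y - R a 0 (\<zeta>0 - y))) \<le> (1 + L\<^sub>1) * norm (x - y)"
      by (simp add: algebra_simps norm_minus_commute)
  qed (use \<epsilon> L1 in auto)
  then have 1: "finite_net \<epsilon> (range (\<lambda>j. \<zeta>1 - g (res (F j)) - R a 0 (\<zeta>0 - g (res (F j)))))"
    using L1 by (simp add: image_image)
  have "finite_net (1 * (r - \<epsilon>)) (uminus ` range (\<lambda>j. H.volterra a (forcing (F j))))"
  proof (rule finite_net_lipschitz_image[OF H_net[OF \<Lambda> at less]])
    show "norm (- x - - y) \<le> 1 * norm (x - y)" for x y :: 'x by (simp add: norm_minus_commute)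
  qed simp
  then have 2: "finite_net (r - \<epsilon>) (range (\<lambda>j. - H.volterra a (forcing (F j))))" by (simp add: image_image)
  from finite_net_add[OF 1 2] show ?thesis by (simp add: target_def)
qed

lemma control_net:
  assumes \<Lambda>: "0 \<le> \<Lambda>" "pointwise_net \<Lambda> F"
  shows "AE s in M\<^sub>L. \<forall>r>P\<^sub>Z s * (q\<^sub>1 * \<Lambda>). finite_net r (range (\<lambda>j. control (F j) s))"
  using Zinv_mnc AE_space
proof eventually_elim
  case (elim s)
  then have s: "s \<in> {0..a}" by simp
  have "bounded (range (\<lambda>j. target (F j)))"
    using target_bound[OF F] unfolding bounded_iff by blast
  then have "hausdorff_mnc ((\<lambda>q. Zinv q s) ` range (\<lambda>j. target (F j))) \<le> ennreal (P\<^sub>Z s) * hausdorff_mnc (range (\<lambda>j. target (F j)))"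
    using elim(1) by blast
  moreover have "0 \<le> q\<^sub>1 * \<Lambda>" using L1 IU_nonneg \<Lambda>(1) by simp
  ultimately have "finite_net r ((\<lambda>q. Zinv q s) ` range (\<lambda>j. target (F j)))" if "P\<^sub>Z s * (q\<^sub>1 * \<Lambda>) < r" for r
    using that PZ(1)[OF s] target_net[OF \<Lambda>] by (rule_tac hausdorff_mnc_le_imp_finite_nets) auto
  then show ?case by (simp add: control_def image_image)
qed

lemma V_control_net:
  assumes \<Lambda>: "0 \<le> \<Lambda>" "pointwise_net \<Lambda> F"
  shows "AE s in M\<^sub>L. \<forall>r>L\<^sub>2 * (P\<^sub>Z s * (q\<^sub>1 * \<Lambda>)). finite_net r (range (\<lambda>j. V (control (F j) s)))"
  using control_net[OF \<Lambda>]
proof eventually_elim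
  case (elim s)
  show ?case
  proof (intro allI impI)
    fix r assume "L\<^sub>2 * (P\<^sub>Z s * (q\<^sub>1 * \<Lambda>)) < r"
    then have "P\<^sub>Z s * (q\<^sub>1 * \<Lambda>) < r / L\<^sub>2" using L2(1) by (simp add: field_simps)
    then have "finite_net (r / L\<^sub>2) (range (\<lambda>j. control (F j) s))" using elim by blast
    then have "finite_net (L\<^sub>2 * (r / L\<^sub>2)) (V ` range (\<lambda>j. control (F j) s))"
    proof (rule finite_net_lipschitz_image)
      show "norm (V x - V y) \<le> L\<^sub>2 * norm (x - y)" for x y
        using norm_blinfun[of V "x - y"] L2(2) by (metis blinfun.diff_right mult_right_mono norm_ge_zero order_trans)
    qed (use L2 in simp)
    then show "finite_net r (range (\<lambda>j. V (control (F j) s)))" using L2(1) by (simp add: image_image)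
  qed
qed

text \<open>Almost everywhere the controls are bounded, because a finite measure of noncompactness entails boundedness.\<close>

lemma control_dominated: "nearly_dominated M\<^sub>L (\<lambda>j s. V (control (F j) s))"
proof (rule nearly_dominated_L2)
  show "control (F j) \<in> L2 a" for j unfolding control_def by (rule control_L2)
  show "L2_norm a (control (F j)) \<le> L\<^sub>3 * (norm \<zeta>1 + (c * k + d) + L\<^sub>1 * (norm \<zeta>0 + (c * k + d)) + L\<^sub>1 * (IN * \<omega> k))" for j
    unfolding control_def using L3(1) target_bound[OF F]
    by (intro order_trans[OF L3(2)] mult_left_mono) auto
  show "AE s in M\<^sub>L. \<exists>b. \<forall>j. norm (control (F j) s) \<le> b"
    using control_net[OF admissibleD(7)[OF F[of 0]] pointwise_net_radius]
  proof eventually_elim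
    case (elim s)
    have "finite_net (P\<^sub>Z s * (q\<^sub>1 * k) + 1) (range (\<lambda>j. control (F j) s))" using elim by simp
    then show ?case by (rule finite_net_imp_bounded)
  qed
qed (use a_pos in simp)

lemma control_integrable': "norm_integrable M\<^sub>L (\<lambda>s. V (control (F j) s))"
  unfolding control_def by (rule control_integrable)

lemma Leb_net:
  assumes \<Lambda>: "0 \<le> \<Lambda>" "pointwise_net \<Lambda> F" and t: "t \<in> {0..a}" and r: "2 * L\<^sub>1 * L\<^sub>2 * IP * (q\<^sub>1 * \<Lambda>) < r"
  shows "finite_net r (range (\<lambda>j. Leb.volterra t (\<lambda>s. V (control (F j) s))))"
proof -
  have "finite_net (2 * L\<^sub>1 * (\<integral>s. L\<^sub>2 * (P\<^sub>Z s * (q\<^sub>1 * \<Lambda>)) \<partial>M\<^sub>L) + (r - 2 * L\<^sub>1 * L\<^sub>2 * IP * (q\<^sub>1 * \<Lambda>)))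
      (range (\<lambda>j. Leb.volterra t (\<lambda>s. V (control (F j) s))))"
  proof (rule Leb.volterra_finite_net[OF t control_integrable' control_dominated _ _ V_control_net[OF \<Lambda>]])
    show "integrable M\<^sub>L (\<lambda>s. L\<^sub>2 * (P\<^sub>Z s * (q\<^sub>1 * \<Lambda>)))" using PZ(2) by simp
    show "AE s in M\<^sub>L. 0 \<le> L\<^sub>2 * (P\<^sub>Z s * (q\<^sub>1 * \<Lambda>))"
      using PZ(1) \<Lambda>(1) L1 L2(1) IU_nonneg by (intro AE_I2 mult_nonneg_nonneg) auto
  qed (use r in simp)
  then show ?thesis by (simp add: mult.assoc)
qed

abbreviation "\<kappa> \<equiv> (2 * L\<^sub>1 + 4 * L\<^sub>1\<^sup>2 * L\<^sub>2 * IP) * IU"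

text \<open>The constant \<open>\<kappa>\<close> collects \<open>2 L\<^sub>1 \<integral>U\<close> from the impulses and, for the control, this same factor from the target
  times \<open>2 L\<^sub>1 L\<^sub>2 \<integral>P\<^sub>Z\<close>.\<close>

lemma steered_net:
  assumes \<Lambda>: "0 \<le> \<Lambda>" "pointwise_net \<Lambda> F" and t: "t \<in> {0..a}" and r: "\<kappa> * \<Lambda> < r"
  shows "finite_net r (range (\<lambda>j. steered (F j) t))"
proof -
  define \<epsilon> where "\<epsilon> = (r - \<kappa> * \<Lambda>) / 3"
  have \<epsilon>: "0 < \<epsilon>" using r by (simp add: \<epsilon>_def)
  have eq: "\<epsilon> + (2 * L\<^sub>1 * L\<^sub>2 * IP * (q\<^sub>1 * \<Lambda>) + \<epsilon>) + (q\<^sub>1 * \<Lambda> + \<epsilon>) = r"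
    by (simp add: \<epsilon>_def field_simps power2_eq_square)
  have "finite_net (\<epsilon> + (2 * L\<^sub>1 * L\<^sub>2 * IP * (q\<^sub>1 * \<Lambda>) + \<epsilon>) + (q\<^sub>1 * \<Lambda> + \<epsilon>))
    (range (\<lambda>j. R t 0 (\<zeta>0 - g (res (F j))) + Leb.volterra t (\<lambda>s. V (control (F j) s)) + H.volterra t (forcing (F j))))"
    using \<epsilon> by (intro finite_net_add orbit_net[OF t] Leb_net[OF \<Lambda> t] H_net[OF \<Lambda> t]) auto
  then show ?thesis unfolding eq using t by (simp add: steered_def)
qed

lemma steered_equicontrolled:
  assumes "pointwise_net 0 F"
  shows "equicontrolled a p (range (\<lambda>j. steered (F j)))"
proof -
  have f0: "AE s in M\<^sub>h. \<forall>r>0. finite_net r (range (\<lambda>j. forcing (F j) s))"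
    using forcing_net[OF order_refl assms] by simp
  have c0: "AE s in M\<^sub>L. \<forall>r>0. finite_net r (range (\<lambda>j. V (control (F j) s)))"
    using V_control_net[OF order_refl assms] by simp
  have 1: "equicontrolled a p (range (\<lambda>j t. R t 0 (\<zeta>0 - g (res (F j)))))"
  proof (rule equicontrolled_orbits[OF _ _ L1 p_dist])
    fix x
    have "continuous_on {0..a} (\<lambda>t. (\<lambda>(t, s). R t s x) (t, 0))"
      by (intro continuous_on_compose2[OF R_cont] continuous_intros) auto
    then show "continuous_on {0..a} (\<lambda>t. R t 0 x)" by simp
  next
    fix e :: real assume e: "0 < e"
    have "finite_net (1 * e) ((\<lambda>x. \<zeta>0 - x) ` range (\<lambda>j. g (res (F j))))"
      by (rule finite_net_lipschitz_image[OF g_net[OF e]]) (auto simp: norm_minus_commute)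
    then show "finite_net e (range (\<lambda>j. \<zeta>0 - g (res (F j))))" by (simp add: image_image)
  qed (use R_bound in auto)
  have 2: "equicontrolled a p (range (\<lambda>j t. Leb.volterra t (\<lambda>s. V (control (F j) s))))"
    by (rule Leb.volterra_equi_modulus[OF control_integrable' control_dominated c0])
  have 3: "equicontrolled a p (range (\<lambda>j t. H.volterra t (forcing (F j))))"
    by (rule H.volterra_equi_modulus[OF forcing(3)[OF F] forcing_dominated f0])
  show ?thesis
    by (rule equicontrolled_cong[OF equicontrolled_add[OF equicontrolled_add[OF 1 2] 3]]) (simp add: steered_def)
qed

end

lemma steer_admissible:
  assumes k: "growth k \<le> k" and F: "F \<in> admissible k"
  shows "steer F \<in> admissible k"
proof -
  have "pointwise_net 0 (\<lambda>_. F)" unfolding pointwise_net_def by (auto intro: finite_net_finite)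
  then have "equicontrolled a p (range (\<lambda>_::nat. steered F))" by (rule steered_equicontrolled[OF F])
  then have "equicontrolled a p {steered F}" by (rule equicontrolled_mem) simp
  moreover have "norm (steer F) \<le> k"
  proof (rule norm_bfun_le)
    fix t show "norm (val (steer F) t) \<le> k"
      using steered_bound[OF F, of t] k admissibleD(7)[OF F] by (cases "t \<in> {0..a}") (auto simp: val_steer[OF F] steered_def)
  qed
  ultimately show ?thesis by (auto simp: admissible_def val_steer[OF F] steered_def)
qed

text \<open>Noncompactness of \<open>S\<close> at a fixed time is at most that of \<open>steer S\<close>, hence at most \<open>\<kappa>\<close> times its own; iteration from
  the trivial radius \<open>k\<close> shows that it is zero. Then \<open>steer S\<close> is totally bounded at each time and equicontrolled.\<close>

lemma finite_net_steer_image: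
  assumes \<kappa>: "\<kappa> < 1" and S: "countable S" "0 \<in> S" "S \<subseteq> admissible k" "S \<subseteq> convex hull (insert 0 (steer ` S))" and e: "0 < e"
  shows "finite_net e (steer ` S)"
proof -
  define F where "F = from_nat_into S"
  have range: "range F = S" unfolding F_def using S(1,2) by (intro range_from_nat_into) auto
  then have F: "F j \<in> admissible k" for j using S(3) by auto
  note nets = steered_net[OF F]
  have k0: "0 \<le> k" using admissibleD(7)[OF F[of 0]] .
  have \<kappa>0: "0 \<le> \<kappa>" using L1 L2(1) IP_nonneg IU_nonneg by simp
  have iter: "pointwise_net (\<kappa> ^ i * k) F" for i
  proof (induction i)
    case 0 then show ?case using pointwise_net_radius[OF F] by simp
  next
    case (Suc i)
    show ?case unfolding pointwise_net_def
    proof (intro ballI allI impI)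
      fix t r assume t: "t \<in> {0..a}" and r: "\<kappa> ^ Suc i * k < r"
      define r' where "r' = (\<kappa> ^ Suc i * k + r) / 2"
      have r': "\<kappa> * (\<kappa> ^ i * k) < r'" "0 < r - r'" using r by (auto simp: r'_def field_simps)
      have pos: "0 \<le> \<kappa> ^ i * k" using \<kappa>0 k0 by simp
      have "0 \<le> \<kappa> * (\<kappa> ^ i * k)" using \<kappa>0 pos by (rule mult_nonneg_nonneg)
      then have r'0: "0 \<le> r'" using r'(1) by linarith
      have "finite_net r' (range (\<lambda>j. steered (F j) t))" by (rule nets[OF pos Suc t r'(1)])
      then have "finite_net r' (insert 0 (range (\<lambda>j. steered (F j) t)))" using r'0 by (rule finite_net_insert)
      then have "finite_net (r' + (r - r')) (convex hull (insert 0 (range (\<lambda>j. steered (F j) t))))"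
        using r'(2) by (rule finite_net_convex_hull)
      moreover have "range (\<lambda>j. val (F j) t) \<subseteq> convex hull (insert 0 (range (\<lambda>j. steered (F j) t)))"
      proof -
        have im: "(\<lambda>G. val G t) ` insert 0 (steer ` S) = insert 0 (range (\<lambda>j. steered (F j) t))"
          unfolding range[symmetric] image_insert image_image by (simp add: val_steer[OF F])
        have "range (\<lambda>j. val (F j) t) = (\<lambda>G. val G t) ` S" unfolding range[symmetric] image_image ..
        also have "\<dots> \<subseteq> (\<lambda>G. val G t) ` (convex hull (insert 0 (steer ` S)))" using S(4) by (rule image_mono)
        also have "\<dots> = convex hull ((\<lambda>G. val G t) ` insert 0 (steer ` S))"
          by (rule convex_hull_linear_image) (rule bounded_linear.linear[OF bounded_linear_val])
        finally show ?thesis unfolding im .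
      qed
      ultimately show "finite_net r (range (\<lambda>j. val (F j) t))" by (elim finite_net_mono) auto
    qed
  qed
  \<comment> \<open>The radii \<open>\<kappa> ^ i * k\<close> tend to zero.\<close>
  have zero: "pointwise_net 0 F"
    unfolding pointwise_net_def
  proof (intro ballI allI impI)
    fix t r assume t: "t \<in> {0..a}" and r: "0 < (r::real)"
    have "(\<lambda>i. \<kappa> ^ i * k) \<longlonglongrightarrow> 0 * k" by (intro tendsto_intros LIMSEQ_realpow_zero \<kappa> \<kappa>0)
    then have "\<forall>\<^sub>F i in sequentially. \<kappa> ^ i * k < r" using r by (intro order_tendstoD(2)) auto
    then obtain i where "\<kappa> ^ i * k < r" by (auto simp: eventually_sequentially)
    then show "finite_net r (range (\<lambda>j. val (F j) t))" using iter[of i] t unfolding pointwise_net_def by blast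
  qed
  have "finite_net e (range (\<lambda>j. steer (F j)))"
  proof (rule finite_net_of_equicontrolled[where p = p and a = a and b = "\<bar>p 0\<bar> + \<bar>p a\<bar>"])
    show "\<bar>p t\<bar> \<le> \<bar>p 0\<bar> + \<bar>p a\<bar>" if "t \<in> {0..a}" for t
    proof -
      have "p 0 \<le> p t" "p t \<le> p a" using that a_pos by (auto intro!: mono_onD[OF mono_p] simp del: add_0)
      then show ?thesis by linarith
    qed
    show "val (steer (F j)) t = 0" if "t \<notin> {0..a}" for j t using that by (simp only: val_steer[OF F] steered_def if_False)
    show "equicontrolled a p (range (\<lambda>j. val (steer (F j))))"
      using steered_equicontrolled[OF F zero] by (simp add: val_steer[OF F])
    show "finite_net e' (range (\<lambda>j. val (steer (F j)) t))" if "t \<in> {0..a}" "0 < e'" for t e'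
      using nets[OF order_refl zero that(1), of e'] that(2) by (simp add: val_steer[OF F])
  qed (rule e)
  then show ?thesis unfolding range[symmetric] by (simp add: image_image)
qed

theorem steering_fixed_point:
  assumes \<kappa>: "\<kappa> < 1" and k: "0 \<le> k" "growth k \<le> k"
  obtains F where "F \<in> admissible k" "steer F = F"
proof (rule fixed_point_of_countable_compactness[of "admissible k" 0 steer])
  show "closed (admissible k)" "convex (admissible k)" "0 \<in> admissible k" "continuous_on (admissible k) steer"
    using closed_admissible convex_admissible zero_admissible[OF k(1)] continuous_on_steer by blast+
  show "steer ` admissible k \<subseteq> admissible k" using steer_admissible[OF k(2)] by blast
  show "finite_net e (steer ` S)" if "countable S" "0 \<in> S" "S \<subseteq> admissible k" "S \<subseteq> convex hull (insert 0 (steer ` S))" "0 < e" for S e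
    using that by (rule finite_net_steer_image[OF \<kappa>])
qed (rule that)

lemma fixed_point_solves:
  assumes F: "F \<in> admissible k" and fp: "steer F = F"
  shows "mild_solution a h R V \<delta> g \<zeta>0 (control F) (res F)" "res F a + g (res F) = \<zeta>1"
proof -
  have eq: "res F t = R t 0 (\<zeta>0 - g (res F)) + Leb.volterra t (\<lambda>s. V (control F s)) + H.volterra t (forcing F)"
    if "t \<in> {0..a}" for t
  proof -
    have "res F t = val F t" unfolding res_def restrict_def using that by (rule if_P)
    also have "\<dots> = steered F t" using fun_cong[OF val_steer[OF F], of t] unfolding fp .
    finally show ?thesis unfolding steered_def if_P[OF that] .
  qed
  have vol: "Leb.volterra t w = banach_integral (lebesgue_on {0..t}) (\<lambda>s. R t s (w s))" if "t \<in> {0..a}" for t w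
    using that unfolding Leb.volterra_def by (simp add: lebesgue_on_restrict)
  show "mild_solution a h R V \<delta> g \<zeta>0 (control F) (res F)"
    unfolding mild_solution_def
  proof (intro conjI ballI)
    show "res F \<in> regulated a" by (rule admissibleD(6)[OF F])
    fix t assume t: "t \<in> {0..a}"
    then have ta: "t \<le> a" by simp
    show "banach_integrable (lebesgue_on {0..t}) (\<lambda>s. R t s (V (control F s)))"
      using Leb.volterra_integrable[OF t control_integrable] unfolding control_def lebesgue_on_restrict[OF ta] .
    show "banach_integrable (ls_upto a h t) (\<lambda>s. R t s (\<delta> s (res F s)))"
      using H.volterra_integrable[OF t forcing(3)[OF F]] unfolding ls_upto_restrict[OF ta] forcing_def .
    show "res F t = R t 0 (\<zeta>0 - g (res F)) + banach_integral (lebesgue_on {0..t}) (\<lambda>s. R t s (V (control F s)))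
        + banach_integral (ls_upto a h t) (\<lambda>s. R t s (\<delta> s (res F s)))"
      using eq[OF t] unfolding vol[OF t] H.volterra_def ls_upto_restrict[OF ta] forcing_def .
  qed
  have at: "a \<in> {0..a}" using a_pos by simp
  have "Leb.volterra a (\<lambda>s. V (control F s)) = control_op a R V (Zinv (target F))"
    unfolding vol[OF at] control_op_def control_def ..
  also have "\<dots> = target F" using Zinv by (simp add: control_inverse_def)
  finally show "res F a + g (res F) = \<zeta>1" unfolding eq[OF at] by (simp add: target_def)
qed

end


section \<open>Radius of an invariant ball\<close>

lemma frequently_below_liminf:
  assumes "Liminf at_top (\<lambda>k::real. ereal (\<omega> k / k)) = ereal \<gamma>" "\<gamma> < y"
  obtains k where "K < k" "\<omega> k / k < y"
proof -
  have "\<exists>k>K. \<omega> k / k < y"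
  proof (rule ccontr)
    assume "\<not> (\<exists>k>K. \<omega> k / k < y)"
    then have le: "y \<le> \<omega> k / k" if "K < k" for k using that by (meson not_le)
    have "\<forall>\<^sub>F k in at_top. ereal y \<le> ereal (\<omega> k / k)"
      using eventually_gt_at_top[of K] by eventually_elim (simp add: le)
    then have "ereal y \<le> ereal \<gamma>" using Liminf_bounded assms(1) by metis
    then show False using assms(2) by simp
  qed
  then show ?thesis using that by blast
qed

text \<open>Along a sequence tending to infinity \<open>\<omega> k\<close> is at most \<open>(\<gamma> + \<epsilon>) k\<close>; with \<open>\<alpha> + \<beta> (\<gamma> + \<epsilon>) < 1\<close> the
  constant \<open>C\<close> is absorbed by large \<open>k\<close>.\<close>

lemma affine_growth_radius:
  fixes \<alpha> \<beta> \<gamma> C :: real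
  assumes lim: "Liminf at_top (\<lambda>k::real. ereal (\<omega> k / k)) = ereal \<gamma>" and \<beta>: "0 \<le> \<beta>" and small: "\<alpha> + \<beta> * \<gamma> < 1"
  obtains k where "0 < k" "C + \<alpha> * k + \<beta> * \<omega> k \<le> k"
proof -
  define s where "s = 1 - (\<alpha> + \<beta> * \<gamma>)"
  have s: "0 < s" using small by (simp add: s_def)
  \<comment> \<open>This \<open>y\<close> still satisfies \<open>\<alpha> + \<beta> y \<le> 1 - s / 2\<close>.\<close>
  define y where "y = \<gamma> + s / (2 * (\<beta> + 1))"
  have "\<gamma> < y" using s \<beta> by (simp add: y_def)
  then obtain k where k: "max 0 (2 * C / s) < k" "\<omega> k / k < y" by (rule frequently_below_liminf[OF lim])
  then have k0: "0 < k" "2 * C < s * k" using s by (auto simp: field_simps)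
  have y: "\<beta> * y \<le> \<beta> * \<gamma> + s / 2" unfolding y_def using s \<beta> by (simp add: field_simps)
  have "\<beta> * \<omega> k \<le> \<beta> * (y * k)" using k(2) k0(1) \<beta> by (intro mult_left_mono) (auto simp: field_simps)
  also have "\<dots> = \<beta> * y * k" by simp
  also have "\<dots> \<le> (\<beta> * \<gamma> + s / 2) * k" using y k0(1) by (intro mult_right_mono) auto
  finally have "C + \<alpha> * k + \<beta> * \<omega> k \<le> C + (\<alpha> + \<beta> * \<gamma>) * k + s / 2 * k" by (simp add: algebra_simps)
  also have "\<dots> = C + (1 - s) * k + s / 2 * k" by (simp add: s_def)
  also have "\<dots> \<le> k" using k0(2) by (simp add: algebra_simps)
  finally show ?thesis using that k0(1) by blast
qed

section \<open>Controllability\<close>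

theorem theorem4:
  fixes a :: real
    and D :: "'x::complex_banach set"
    and A :: "real \<Rightarrow> 'x \<Rightarrow> 'x"
    and DB :: "'x set"
    and \<Delta> :: "real \<Rightarrow> real \<Rightarrow> 'x \<Rightarrow> 'x"
    and V :: "'k::banach \<Rightarrow>\<^sub>L 'x"
    and h :: "real \<Rightarrow> real"
    and R :: "real \<Rightarrow> real \<Rightarrow> 'x \<Rightarrow>\<^sub>L 'x"
    and \<delta> :: "real \<Rightarrow> 'x \<Rightarrow> 'x"
    and g :: "(real \<Rightarrow> 'x) \<Rightarrow> 'x"
    and n U P\<^sub>Z \<omega> :: "real \<Rightarrow> real"
    and Zinv :: "'x \<Rightarrow> real \<Rightarrow> 'k"
    and \<gamma> c d L\<^sub>1 L\<^sub>2 L\<^sub>3 :: real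
  assumes a_pos: "0 < a"
    and data: "linear_data a D A DB \<Delta>"
    and h_mono: "mono_on {0..a} h"
    and h_left: "\<forall>t\<in>{0<..a}. (h \<longlongrightarrow> h t) (at_left t)"
    and C1: "cond_C1 a D A \<Delta>"
    and C2: "cond_C2 D A \<Delta>"
    and C3: "cond_C3 D A \<Delta>"
    and E1: "cond_E1 D A"
    and E2: "cond_E2 D A"
    and resolvent: "resolvent_operator a D A \<Delta> R"
    and H1_cont: "continuous_on {(t, s). 0 \<le> s \<and> s < t \<and> t \<le> a} (\<lambda>(t, s). R t s)"
    and H1_bound: "0 < L\<^sub>1" "\<forall>s t. 0 \<le> s \<and> s \<le> t \<and> t \<le> a \<longrightarrow> norm (R t s) \<le> L\<^sub>1"
    and H2_i_cont: "AE t in ls_measure a h. continuous_on UNIV (\<delta> t)"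
    and H2_i_meas: "\<forall>x. strongly_measurable (ls_measure a h) (\<lambda>t. \<delta> t x)"
    and H2_ii_n: "\<forall>t\<in>{0..a}. 0 \<le> n t" "integrable (ls_measure a h) n"
    and H2_ii_omega: "\<forall>r\<ge>0. 0 \<le> \<omega> r" "mono_on {0..} \<omega>" "continuous_on {0..} \<omega>"
    and H2_ii_growth: "AE t in ls_measure a h. \<forall>x. norm (\<delta> t x) \<le> n t * \<omega> (norm x)"
    and H2_ii_liminf: "Liminf at_top (\<lambda>k::real. ereal (\<omega> k / k)) = ereal \<gamma>"
    and H2_iii_U: "\<forall>t\<in>{0..a}. 0 \<le> U t" "integrable (ls_measure a h) U"
    and H2_iii: "AE t in ls_measure a h. \<forall>B. bounded B \<longrightarrow>
      hausdorff_mnc (\<delta> t ` B) \<le> ennreal (U t) * hausdorff_mnc B"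
    and H3_cont: "regulated_continuous a g"
    and H3_compact: "regulated_compact a g"
    and H3_growth: "0 < c" "0 < d" "\<forall>\<zeta>\<in>regulated a. norm (g \<zeta>) \<le> c * regulated_norm a \<zeta> + d"
    and H4_i: "control_inverse a (control_op a R V) Zinv"
    and H4_i_bounds: "0 < L\<^sub>2" "norm V \<le> L\<^sub>2" "0 < L\<^sub>3" "\<forall>q. L2_norm a (Zinv q) \<le> L\<^sub>3 * norm q"
    and H4_ii_P: "\<forall>t\<in>{0..a}. 0 \<le> P\<^sub>Z t" "integrable (lebesgue_on {0..a}) P\<^sub>Z"
    and H4_ii: "AE t in lebesgue_on {0..a}. \<forall>Q. bounded Q \<longrightarrow>
      hausdorff_mnc ((\<lambda>q. Zinv q t) ` Q) \<le> ennreal (P\<^sub>Z t) * hausdorff_mnc Q"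
    and small_1: "c * (L\<^sub>1 + L\<^sub>1 * L\<^sub>2 * L\<^sub>3 * sqrt a * (1 + L\<^sub>1))
      + L\<^sub>1 * \<gamma> * (1 + L\<^sub>1 * L\<^sub>2 * L\<^sub>3 * sqrt a) * integral\<^sup>L (ls_upto a h a) n < 1"
    and small_2: "(2 * L\<^sub>1 + 4 * L\<^sub>1\<^sup>2 * L\<^sub>2 * integral\<^sup>L (lebesgue_on {0..a}) P\<^sub>Z)
      * integral\<^sup>L (ls_upto a h a) U < 1"
  shows "controllable a h R V \<delta> g"
proof -
  let ?T = "{(t, s). 0 \<le> s \<and> s \<le> t \<and> t \<le> a}"
  have R_cont: "continuous_on ?T (\<lambda>(t, s). R t s x)" for x
    using resolvent unfolding resolvent_operator_def Let_def by blast
  have left: "{0..<a} \<in> sets (ls_measure a h)" by (rule sets_ls_measure) auto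
  have system: "nonlocal_control a h R V \<delta> g n U P\<^sub>Z \<omega> Zinv c d L\<^sub>1 L\<^sub>2 L\<^sub>3"
  proof (rule nonlocal_control.intro)
    show "strongly_measurable (ls_upto a h a) (\<lambda>t. \<delta> t x)" for x
      unfolding ls_upto_def using H2_i_meas left by (blast intro: strongly_measurable_restrict_spaceI)
    show "norm (R t s) \<le> L\<^sub>1" if "0 \<le> s" "s \<le> t" "t \<le> a" for t s using H1_bound(2) that by blast
    show "0 \<le> n t" if "t \<in> {0..a}" for t using H2_ii_n(1) that by blast
    show "0 \<le> \<omega> r" if "0 \<le> r" for r using H2_ii_omega(1) that by blast
    show "0 \<le> U t" if "t \<in> {0..a}" for t using H2_iii_U(1) that by blast
    show "0 \<le> P\<^sub>Z t" if "t \<in> {0..a}" for t using H4_ii_P(1) that by blast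
    show "norm (g \<zeta>) \<le> c * regulated_norm a \<zeta> + d" if "\<zeta> \<in> regulated a" for \<zeta> using H3_growth(3) that by blast
    show "L2_norm a (Zinv q) \<le> L\<^sub>3 * norm q" for q using H4_i_bounds(4) by blast
  qed (fact a_pos h_mono h_left R_cont H1_bound(1) H2_ii_omega(2) H3_cont H3_compact H3_growth(1,2) H4_i
      H4_i_bounds(1-3) H4_ii_P(2) H4_ii integrable_ls_upto[OF H2_ii_n(2)] integrable_ls_upto[OF H2_iii_U(2)]
      AE_ls_upto[OF H2_i_cont] AE_ls_upto[OF H2_ii_growth] AE_ls_upto[OF H2_iii])+
  show ?thesis
    unfolding controllable_def
  proof (intro allI)
    fix \<zeta>0 \<zeta>1 :: 'x
    interpret nonlocal_control a h R V \<delta> g n U P\<^sub>Z \<omega> Zinv c d L\<^sub>1 L\<^sub>2 L\<^sub>3 \<zeta>0 \<zeta>1 by (rule system)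
    define \<alpha> \<beta> C where
      "\<alpha> = c * (L\<^sub>1 + L\<^sub>1 * L\<^sub>2 * L\<^sub>3 * sqrt a * (1 + L\<^sub>1))"
      "\<beta> = L\<^sub>1 * (1 + L\<^sub>1 * L\<^sub>2 * L\<^sub>3 * sqrt a) * IN"
      "C = L\<^sub>1 * (norm \<zeta>0 + d) + L\<^sub>1 * L\<^sub>2 * L\<^sub>3 * sqrt a * (norm \<zeta>1 + d + L\<^sub>1 * (norm \<zeta>0 + d))"
    have growth: "growth k = C + \<alpha> * k + \<beta> * \<omega> k" for k
      unfolding growth_def \<alpha>_\<beta>_C_def by (simp add: algebra_simps)
    have "0 \<le> IN"
    proof (rule Bochner_Integration.integral_nonneg_AE, rule AE_I2)
      fix s assume "s \<in> space M\<^sub>h"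
      then show "0 \<le> n s" using H2_ii_n(1) unfolding space_MH by auto
    qed
    then have "0 \<le> \<beta>" unfolding \<alpha>_\<beta>_C_def using L1 L2(1) L3(1) a_pos by simp
    moreover have "\<alpha> + \<beta> * \<gamma> < 1" using small_1 by (simp add: \<alpha>_\<beta>_C_def mult.commute mult.left_commute)
    ultimately obtain k where k: "0 < k" "C + \<alpha> * k + \<beta> * \<omega> k \<le> k"
      by (rule affine_growth_radius[OF H2_ii_liminf])
    obtain F where F: "F \<in> admissible k" "steer F = F"
      by (rule steering_fixed_point[OF small_2 less_imp_le[OF k(1)]]) (use k(2) growth in auto)
    have "control F \<in> L2 a" unfolding control_def by (rule control_L2)
    then show "\<exists>u\<in>L2 a. \<exists>\<zeta>. mild_solution a h R V \<delta> g \<zeta>0 u \<zeta> \<and> \<zeta> a + g \<zeta> = \<zeta>1"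
      using fixed_point_solves[OF F] by blast
  qed
qed

end
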